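(* There exist absolute constants $C_1, C_2 > 0$ such that the following holds. Let $d_1,d_2$ be positive integers, $\alpha>0$, $r>0$, $0<n\le d_1d_2$, and let $f:\mathbb{R}\to[0,1]$ be a differentiable function for which $L_\alpha$ and $\beta_\alpha$ (defined in the context) are well-defined. Let $M\in\mathbb{R}^{d_1\times d_2}$ satisfy $\|M\|_*\le \alpha\sqrt{d_1d_2r}$ and $\|M\|_\infty\le\alpha$. Suppose that $\Omega\subset[d_1]\times[d_2]$ is random, each $(i,j)$ being included in $\Omega$ independently with probability $\frac{n}{d_1d_2}$ (so $\mathbb{E}|\Omega|=n$), and that the observations $Y_{i,j}$, $(i,j)\in\Omega$, are generated from $M$ via $f$ according to the 1-bit observation model described in the context. Let $\widehat{M}$ be a solution of $$\widehat{M}=\arg\max_{X}\ \mathcal{L}_{\Omega,Y}(X)\quad\text{subject to}\quad \|X\|_*\le\alpha\sqrt{rd_1d_2}\ \text{ and }\ \|X\|_\infty\le\alpha .$$ Then with probability at least $1-C_1/(d_1+d_2)$, $$\frac{1}{d_1d_2}\|\widehat{M}-M\|_F^2\le C_\alpha\sqrt{\frac{r(d_1+d_2)}{n}}\sqrt{1+\frac{(d_1+d_2)\log(d_1d_2)}{n}},\qquad C_\alpha:=C_2\,\alpha L_\alpha\beta_\alpha .$$ If $n\ge(d_1+d_2)\log(d_1d_2)$, then this simplifies to $$\frac{1}{d_1d_2}\|\widehat{M}-M\|_F^2\le\sqrt{2}\,C_\alpha\sqrt{\frac{r(d_1+d_2)}{n}} .$$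
   Context: Notation: $[d]=\{1,\dots,d\}$; $\|\cdot\|_*$ is the nuclear norm (sum of singular values), $\|\cdot\|_F$ the Frobenius norm, $\|X\|_\infty=\max_{i,j}|X_{i,j}|$ the entrywise maximum norm; $\log$ is the natural logarithm. 1-bit observation model: given $M$, $\Omega$ and $f$, for $(i,j)\in\Omega$ one observes, independently (and independently of $\Omega$), $Y_{i,j}=+1$ with probability $f(M_{i,j})$ and $Y_{i,j}=-1$ with probability $1-f(M_{i,j})$. Log-likelihood: $\mathcal{L}_{\Omega,Y}(X)=\sum_{(i,j)\in\Omega}\big(\mathbf{1}_{[Y_{i,j}=1]}\log f(X_{i,j})+\mathbf{1}_{[Y_{i,j}=-1]}\log(1-f(X_{i,j}))\big)$. Steepness and flatness parameters: $L_\alpha:=\sup_{|x|\le\alpha}\frac{|f'(x)|}{f(x)(1-f(x))}$ and $\beta_\alpha:=\sup_{|x|\le\alpha}\frac{f(x)(1-f(x))}{(f'(x))^2}$. Standing assumption on $f$: these quantities are well-defined; in particular $0<f(x)<1$ and $f'(x)\ne0$ for all $x\in[-\alpha,\alpha]$. Probability is over the draw of both $\Omega$ and $Y$. *)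

theory Defs
  imports "HOL-Probability.Probability" "Jordan_Normal_Form.Char_Poly"
begin

(* The singular values of A are the square roots of the eigenvalues of A\<^sup>T A, counted with
   (algebraic) multiplicity. A\<^sup>T A has dim_col A eigenvalues; those in excess of
   min (dim_row A) (dim_col A) are zero and do not contribute. *)
definition nuclear_norm :: "real mat \<Rightarrow> real" where
  "nuclear_norm A =
     (let B = transpose_mat A * A
      in \<Sum>x | eigenvalue B x. real (Polynomial.order x (char_poly B)) * sqrt x)"

definition frobenius_norm :: "real mat \<Rightarrow> real" where
  "frobenius_norm A = sqrt (\<Sum>i<dim_row A. \<Sum>j<dim_col A. (A $$ (i, j))\<^sup>2)"

(* Meaningful only for matrices with at least one entry. *)
definition max_norm :: "real mat \<Rightarrow> real" where
  "max_norm A = Max (abs ` elements_mat A)"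

definition steepness :: "(real \<Rightarrow> real) \<Rightarrow> real \<Rightarrow> real" where
  "steepness f \<alpha> = (SUP x\<in>{-\<alpha>..\<alpha>}. \<bar>deriv f x\<bar> / (f x * (1 - f x)))"

definition flatness :: "(real \<Rightarrow> real) \<Rightarrow> real \<Rightarrow> real" where
  "flatness f \<alpha> = (SUP x\<in>{-\<alpha>..\<alpha>}. f x * (1 - f x) / (deriv f x)\<^sup>2)"

(* No denominator vanishes and both suprema are finite. Boundedness is a separate requirement,
   as deriv f need not be continuous. *)
definition steep_flat_well_defined :: "(real \<Rightarrow> real) \<Rightarrow> real \<Rightarrow> bool" where
  "steep_flat_well_defined f \<alpha> \<longleftrightarrow>
     (\<forall>x\<in>{-\<alpha>..\<alpha>}. 0 < f x \<and> f x < 1 \<and> deriv f x \<noteq> 0) \<and>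
     bdd_above ((\<lambda>x. \<bar>deriv f x\<bar> / (f x * (1 - f x))) ` {-\<alpha>..\<alpha>}) \<and>
     bdd_above ((\<lambda>x. f x * (1 - f x) / (deriv f x)\<^sup>2) ` {-\<alpha>..\<alpha>})"

definition entries :: "nat \<Rightarrow> nat \<Rightarrow> (nat \<times> nat) set" where
  "entries d1 d2 = {..<d1} \<times> {..<d2}"

definition sampling_pmf :: "nat \<Rightarrow> nat \<Rightarrow> real \<Rightarrow> (nat \<times> nat) set pmf" where
  "sampling_pmf d1 d2 n =
     map_pmf (\<lambda>b. {p \<in> entries d1 d2. b p})
       (Pi_pmf (entries d1 d2) False (\<lambda>_. bernoulli_pmf (n / (real d1 * real d2))))"

(* A sign is drawn for every entry; only those at positions in \<Omega> enter the log-likelihood.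
   The value 0 is a dummy outside the index range. *)
definition sign_pmf :: "(real \<Rightarrow> real) \<Rightarrow> real mat \<Rightarrow> (nat \<times> nat \<Rightarrow> int) pmf" where
  "sign_pmf f M =
     Pi_pmf (entries (dim_row M) (dim_col M)) 0
       (\<lambda>p. map_pmf (\<lambda>b. if b then 1 else - 1) (bernoulli_pmf (f (M $$ p))))"

(* pair_pmf is the product distribution: \<Omega> and Y are independent. *)
definition one_bit_model ::
  "(real \<Rightarrow> real) \<Rightarrow> real \<Rightarrow> real mat \<Rightarrow> ((nat \<times> nat) set \<times> (nat \<times> nat \<Rightarrow> int)) pmf" where
  "one_bit_model f n M = pair_pmf (sampling_pmf (dim_row M) (dim_col M) n) (sign_pmf f M)"

definition log_likelihood ::
  "(real \<Rightarrow> real) \<Rightarrow> (nat \<times> nat) set \<Rightarrow> (nat \<times> nat \<Rightarrow> int) \<Rightarrow> real mat \<Rightarrow> real" where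
  "log_likelihood f \<Omega> Y X =
     (\<Sum>p\<in>\<Omega>. of_bool (Y p = 1) * ln (f (X $$ p)) + of_bool (Y p = - 1) * ln (1 - f (X $$ p)))"

definition feasible :: "nat \<Rightarrow> nat \<Rightarrow> real \<Rightarrow> real \<Rightarrow> real mat set" where
  "feasible d1 d2 \<alpha> r =
     {X \<in> carrier_mat d1 d2.
        nuclear_norm X \<le> \<alpha> * sqrt (r * real d1 * real d2) \<and> max_norm X \<le> \<alpha>}"

end

theory Submission
  imports Defs "Jordan_Normal_Form.Spectral_Radius" "HOL-Probability.Hoeffding"
begin

text \<open>
  Let \<open>T\<close> be the finite set consisting of \<open>M\<close> and all values of the estimator, and let \<open>Z\<close> be the
  maximum over \<open>X \<in> T\<close> of the centered log-likelihood ratio of \<open>X\<close> and \<open>M\<close>. The estimator has a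
  nonnegative ratio, and the expected ratio is \<open>- q\<close> times a sum of Kullback--Leibler divergences, which
  dominate \<open>(M - X)\<^sup>2 / (8 \<beta>)\<close> entrywise; so \<open>Z\<close> bounds the squared error.

  High moments of \<open>Z\<close> are estimated by replacing the entries one after the other: symmetrization and the
  contraction principle turn the contribution of an entry into \<open>2 L s\<^sub>p (X\<^sub>p - M\<^sub>p)\<close> with independent
  sparse signs \<open>s\<^sub>p\<close>, and duality of the nuclear and the operator norm leaves \<open>4 L R\<close> times the
  operator norm of the sparse sign matrix \<open>s\<close>.

  The operator norm is controlled by \<open>E tr (S ^ N)\<close> for the symmetric dilation \<open>S\<close> and \<open>N\<close> of order
  \<open>log d\<close>, a sum over closed walks that use every edge evenly often. Comparing the numbers of choices for
  new vertices bounds it by \<open>d\<close> times the corresponding sum for a full random sign matrix of size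
  \<open>r = q d + N + O(1)\<close> (an idea of Bandeira and van Handel). For that matrix \<open>N \<le> r\<close>, and a net
  argument gives moments of the optimal order \<open>(C r) ^ (N / 2)\<close>, without the logarithmic factor of
  a matrix Bernstein bound.
\<close>

unbundle no vec_syntax and no inner_syntax

section \<open>Trace duality for the nuclear norm\<close>

text \<open>The target rate dictates the operator norm: with d = d1 + d2 it has to be of order sqrt
  (q d + log d), the logarithm entering as a summand and not as a factor. The failure probability 3
  / d dictates the moment: passing to the trace costs a factor d, and Markov's inequality at three
  times the natural scale gains 3 ^ N, at least d ^ 2 once N is at least 2 log d. The size q d + N +
  O(1) of the comparison matrix is then just the quantity under the root.

  All laws involved have finite support. Hence the estimator takes finitely many values, the
  supremum over the feasible set becomes a maximum over \<open>T\<close>, and questions of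
  measurability and attainment do not arise. No independent copy of the whole sample is needed
  either: a lemma on product laws reduces the comparison to a single entry.

  The operator norm appears only as a constant b with |S v| \<le> b |v|. Taking N as a power of two
  lets repeated Cauchy-Schwarz bound it by the trace, so that the spectral theorem is used for the
  nuclear norm alone.\<close>

lemma index_mult_transpose:
  fixes P Q :: "'a :: comm_semiring_0 mat"
  assumes "P \<in> carrier_mat m n" "Q \<in> carrier_mat m' n" "i < m" "j < m'"
  shows "(P * transpose_mat Q) $$ (i, j) = (\<Sum>k<n. P $$ (i, k) * Q $$ (j, k))"
  using assms by (simp add: scalar_prod_def lessThan_atLeast0)

lemma index_transpose_mult:
  fixes P Q :: "'a :: comm_semiring_0 mat"
  assumes "P \<in> carrier_mat m n" "Q \<in> carrier_mat m n'" "i < n" "j < n'"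
  shows "(transpose_mat P * Q) $$ (i, j) = (\<Sum>k<m. P $$ (k, i) * Q $$ (k, j))"
  using assms by (simp add: scalar_prod_def lessThan_atLeast0)

section \<open>Orthogonal diagonalization of real symmetric matrices\<close>

text \<open>Over the complex numbers an eigenvector v = a + ib exists. Symmetry equates
  \<open>(B *\<^sub>v a) \<bullet> b\<close> with \<open>a \<bullet> (B *\<^sub>v b)\<close>, which
  amounts to Im k (|a|^2 + |b|^2) = 0. So k is real, and whichever of a and b is nonzero is a real
  eigenvector.\<close>

lemma real_symmetric_eigenvector:
  fixes B :: "real mat"
  assumes B: "B \<in> carrier_mat n n" and sym: "transpose_mat B = B" and n: "0 < n"
  obtains v e where "v \<in> carrier_vec n" "v \<noteq> 0\<^sub>v n" "B *\<^sub>v v = e \<cdot>\<^sub>v v"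
proof -
  let ?C = "map_mat complex_of_real B"
  have C: "?C \<in> carrier_mat n n" using B by simp
  obtain k where "eigenvalue ?C k"
    using spectrum_non_empty[OF C n] by (auto simp: spectrum_def)
  then obtain v where v: "v \<in> carrier_vec n" "v \<noteq> 0\<^sub>v n" "?C *\<^sub>v v = k \<cdot>\<^sub>v v"
    using C by (auto simp: eigenvalue_def eigenvector_def)
  define a b where "a = map_vec Re v" and "b = map_vec Im v"
  have ab: "a \<in> carrier_vec n" "b \<in> carrier_vec n" using v(1) by (auto simp: a_def b_def)
  have k: "(\<Sum>j<n. complex_of_real (B $$ (i, j)) * v $ j) = k * v $ i" if "i < n" for i
  proof -
    have "(?C *\<^sub>v v) $ i = (\<Sum>j<n. complex_of_real (B $$ (i, j)) * v $ j)"
      using that B v(1) by (simp add: scalar_prod_def lessThan_atLeast0)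
    thus ?thesis using v that by simp
  qed
  have Ba: "(B *\<^sub>v a) $ i = Re k * a $ i - Im k * b $ i" if "i < n" for i
  proof -
    have "(B *\<^sub>v a) $ i = Re (\<Sum>j<n. complex_of_real (B $$ (i, j)) * v $ j)"
      using that B v(1) by (simp add: a_def scalar_prod_def lessThan_atLeast0)
    thus ?thesis using that v(1) by (simp add: k a_def b_def)
  qed
  have Bb: "(B *\<^sub>v b) $ i = Re k * b $ i + Im k * a $ i" if "i < n" for i
  proof -
    have "(B *\<^sub>v b) $ i = Im (\<Sum>j<n. complex_of_real (B $$ (i, j)) * v $ j)"
      using that B v(1) by (simp add: b_def scalar_prod_def lessThan_atLeast0)
    thus ?thesis using that v(1) by (simp add: k a_def b_def)
  qed
  have "(B *\<^sub>v a) \<bullet> b = a \<bullet> (B *\<^sub>v b)"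
    using transpose_vec_mult_scalar[OF B ab(1) ab(2)] sym ab B
    by (metis comm_scalar_prod mult_mat_vec_carrier transpose_vec_mult_scalar)
  hence "(\<Sum>i<n. (Re k * a $ i - Im k * b $ i) * b $ i) = (\<Sum>i<n. a $ i * (Re k * b $ i + Im k * a $ i))"
    using ab B by (simp add: scalar_prod_def lessThan_atLeast0 Ba Bb del: index_mult_mat_vec)
  hence "Im k * (\<Sum>i<n. (a $ i)\<^sup>2 + (b $ i)\<^sup>2) = 0"
    by (simp add: algebra_simps sum.distrib sum_subtractf sum_distrib_left power2_eq_square)
  moreover have "(\<Sum>i<n. (a $ i)\<^sup>2 + (b $ i)\<^sup>2) \<noteq> 0"
  proof
    assume "(\<Sum>i<n. (a $ i)\<^sup>2 + (b $ i)\<^sup>2) = 0"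
    hence "(a $ i)\<^sup>2 + (b $ i)\<^sup>2 = 0" if "i < n" for i
      using that by (subst (asm) sum_nonneg_eq_0_iff) auto
    hence "v = 0\<^sub>v n"
      using v(1) by (intro eq_vecI) (auto simp: a_def b_def complex_eq_iff sum_power2_eq_zero_iff)
    thus False using v(2) by simp
  qed
  ultimately have im: "Im k = 0" by simp
  have eig: "B *\<^sub>v a = Re k \<cdot>\<^sub>v a" "B *\<^sub>v b = Re k \<cdot>\<^sub>v b"
    using ab B im by (auto intro!: eq_vecI simp: Ba Bb simp del: index_mult_mat_vec)
  have "a \<noteq> 0\<^sub>v n \<or> b \<noteq> 0\<^sub>v n"
  proof (rule ccontr)
    assume "\<not> ?thesis"
    hence "a $ i = 0" "b $ i = 0" if "i < n" for i using that by auto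
    hence "v = 0\<^sub>v n"
      using v(1) by (intro eq_vecI) (auto simp: a_def b_def complex_eq_iff)
    thus False using v(2) by simp
  qed
  thus ?thesis using that ab eig by blast
qed

text \<open>A Householder reflection; for \<open>v\<close> the first basis vector \<open>2 / S\<close> is \<open>2 / 0 = 0\<close> and
  \<open>W\<close> is the identity.\<close>

lemma orthogonal_mat_first_col:
  fixes v :: "real vec"
  assumes v: "v \<in> carrier_vec n" and n: "0 < n" and unit: "(\<Sum>i<n. (v $ i)\<^sup>2) = 1"
  obtains W where "W \<in> carrier_mat n n" "transpose_mat W * W = 1\<^sub>m n" "col W 0 = v"
proof -
  define u where "u i = v $ i - of_bool (i = 0)" for i
  define S where "S = (\<Sum>i<n. (u i)\<^sup>2)"
  define W where "W = mat n n (\<lambda>(i, j). of_bool (i = j) - 2 / S * (u i * u j))"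
  have "S = (\<Sum>i<n. (v $ i)\<^sup>2 + of_bool (i = 0) * (1 - 2 * v $ i))"
    unfolding S_def u_def by (intro sum.cong) (auto simp: power2_eq_square algebra_simps)
  also have "\<dots> = (\<Sum>i<n. (v $ i)\<^sup>2) + (\<Sum>i<n. of_bool (i = 0) * (1 - 2 * v $ i))"
    by (rule sum.distrib)
  also have "(\<Sum>i<n. of_bool (i = 0) * (1 - 2 * v $ i)) = 1 - 2 * v $ 0"
    using n by (subst sum.remove[of _ 0]) (auto intro!: sum.neutral)
  finally have S: "S = - 2 * u 0" using unit n by (simp add: u_def)
  have "of_bool (i = 0) - 2 / S * (u i * u 0) = v $ i" if "i < n" for i
  proof (cases "S = 0")
    case True
    hence "(u i)\<^sup>2 = 0" using that unfolding S_def by (subst (asm) sum_nonneg_eq_0_iff) auto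
    thus ?thesis using True by (simp add: u_def)
  next
    case False
    hence "2 / S * (u i * u 0) = - u i" using S by (simp add: field_simps)
    thus ?thesis by (simp add: u_def)
  qed
  hence col: "col W 0 = v" using v n by (intro eq_vecI) (auto simp: W_def)
  have "transpose_mat W * W = 1\<^sub>m n"
  proof (rule eq_matI)
    fix i j assume "i < dim_row (1\<^sub>m n :: real mat)" "j < dim_col (1\<^sub>m n :: real mat)"
    hence ij: "i < n" "j < n" by auto
    have delta: "(\<Sum>k<n. of_bool (k = i) * g k) = g i" if "i < n" for i and g :: "nat \<Rightarrow> real"
      using that by (subst sum.remove[of _ i]) (auto intro!: sum.neutral)
    define c where "c = 2 / S"
    have c: "c\<^sup>2 * S = 2 * c" by (simp add: c_def power2_eq_square)
    have "(transpose_mat W * W) $$ (i, j) =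
        (\<Sum>k<n. (of_bool (k = i) - c * (u k * u i)) * (of_bool (k = j) - c * (u k * u j)))"
      using ij by (subst index_transpose_mult[of _ n n _ n]) (auto simp: W_def c_def)
    also have "\<dots> = (\<Sum>k<n. of_bool (k = i) * of_bool (k = j) - c * u j * (of_bool (k = i) * u k)
        - c * u i * (of_bool (k = j) * u k) + c\<^sup>2 * u i * u j * (u k)\<^sup>2)"
      by (intro sum.cong refl) (simp add: algebra_simps power2_eq_square)
    also have "\<dots> = (\<Sum>k<n. of_bool (k = i) * of_bool (k = j)) - c * u j * (\<Sum>k<n. of_bool (k = i) * u k)
        - c * u i * (\<Sum>k<n. of_bool (k = j) * u k) + c\<^sup>2 * u i * u j * S"
      unfolding S_def by (simp only: sum.distrib sum_subtractf sum_distrib_left)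
    also have "\<dots> = of_bool (i = j) - 2 * c * u i * u j + (c\<^sup>2 * S) * u i * u j"
      using ij by (simp add: delta algebra_simps)
    also have "\<dots> = of_bool (i = j)" by (simp add: c)
    finally show "(transpose_mat W * W) $$ (i, j) = 1\<^sub>m n $$ (i, j)" using ij by simp
  qed (auto simp: W_def)
  moreover have "W \<in> carrier_mat n n" by (simp add: W_def)
  ultimately show ?thesis using that col by blast
qed

lemma mult_four_block_diag:
  fixes P Q :: "'a :: semiring_1 mat"
  assumes "a \<in> carrier_mat 1 1" "b \<in> carrier_mat 1 1" "P \<in> carrier_mat n n" "Q \<in> carrier_mat n n"
  shows "four_block_mat a (0\<^sub>m 1 n) (0\<^sub>m n 1) P * four_block_mat b (0\<^sub>m 1 n) (0\<^sub>m n 1) Q =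
    four_block_mat (a * b) (0\<^sub>m 1 n) (0\<^sub>m n 1) (P * Q)"
  using assms by (subst mult_four_block_mat[of _ 1 1 _ n _ n _ _ 1 _ n]) auto

text \<open>Deflation: the orthogonal \<open>W\<close> sends the first basis vector to an
  eigenvector, so W^T B W has first column (e, 0, ..., 0). Being symmetric, it has the same first
  row and splits into the block e and a smaller symmetric matrix.\<close>

lemma real_symmetric_diagonalization:
  fixes B :: "real mat"
  assumes "B \<in> carrier_mat n n" "transpose_mat B = B"
  shows "\<exists>U es. U \<in> carrier_mat n n \<and> transpose_mat U * U = 1\<^sub>m n \<and>
    transpose_mat U * B * U = mat n n (\<lambda>(i, j). if i = j then es i else 0)"
  using assms
proof (induction n arbitrary: B)
  case 0
  thus ?case by (intro exI[of _ "1\<^sub>m 0"] exI[of _ "\<lambda>_. 0"] conjI eq_matI) auto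
next
  case (Suc n)
  note B = Suc.prems(1) and sym = Suc.prems(2)
  obtain v0 e where v0: "v0 \<in> carrier_vec (Suc n)" "v0 \<noteq> 0\<^sub>v (Suc n)" "B *\<^sub>v v0 = e \<cdot>\<^sub>v v0"
    using real_symmetric_eigenvector[OF B sym] by blast
  define s where "s = sqrt (\<Sum>i<Suc n. (v0 $ i)\<^sup>2)"
  have "(\<Sum>i<Suc n. (v0 $ i)\<^sup>2) \<noteq> 0"
  proof
    assume "(\<Sum>i<Suc n. (v0 $ i)\<^sup>2) = 0"
    hence "v0 $ i = 0" if "i < Suc n" for i
      using that by (subst (asm) sum_nonneg_eq_0_iff) auto
    thus False using v0 by (auto intro!: eq_vecI)
  qed
  moreover have "0 \<le> (\<Sum>i<Suc n. (v0 $ i)\<^sup>2)" by (intro sum_nonneg) auto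
  ultimately have s: "s\<^sup>2 = (\<Sum>i<Suc n. (v0 $ i)\<^sup>2)" "s \<noteq> 0" by (auto simp: s_def)
  define v where "v = (1 / s) \<cdot>\<^sub>v v0"
  have v: "v \<in> carrier_vec (Suc n)" "B *\<^sub>v v = e \<cdot>\<^sub>v v"
    using v0 B by (auto simp: v_def mult_mat_vec smult_smult_assoc mult.commute)
  have "(\<Sum>i<Suc n. (v $ i)\<^sup>2) = (\<Sum>i<Suc n. (v0 $ i)\<^sup>2) / s\<^sup>2"
    unfolding sum_divide_distrib using v0(1) by (intro sum.cong) (auto simp: v_def power_divide)
  hence unit: "(\<Sum>i<Suc n. (v $ i)\<^sup>2) = 1"
    using s(2) unfolding s(1)[symmetric] by simp
  obtain W where W: "W \<in> carrier_mat (Suc n) (Suc n)" "transpose_mat W * W = 1\<^sub>m (Suc n)" "col W 0 = v"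
    using orthogonal_mat_first_col[OF v(1) _ unit] by blast
  define A where "A = transpose_mat W * B * W"
  have A: "A \<in> carrier_mat (Suc n) (Suc n)" using W B by (auto simp: A_def)
  have "transpose_mat A = transpose_mat W * transpose_mat (transpose_mat W * B)"
    unfolding A_def using W B by (intro transpose_mult) auto
  also have "transpose_mat (transpose_mat W * B) = transpose_mat B * transpose_mat (transpose_mat W)"
    using W B by (intro transpose_mult) auto
  also have "transpose_mat W * (transpose_mat B * transpose_mat (transpose_mat W)) = A"
    unfolding A_def using W B by (simp add: sym assoc_mult_mat[of _ "Suc n" "Suc n" _ "Suc n" _ "Suc n"])
  finally have symA: "transpose_mat A = A" .
  have "col A 0 = transpose_mat W *\<^sub>v (B *\<^sub>v v)"
  proof -
    have "A = transpose_mat W * (B * W)"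
      unfolding A_def using W(1) B by (intro assoc_mult_mat[of _ "Suc n" "Suc n" _ "Suc n" _ "Suc n"]) auto
    hence "col A 0 = transpose_mat W *\<^sub>v col (B * W) 0"
      using W(1) B by (simp only:) (intro col_mult2[of _ "Suc n" "Suc n" _ "Suc n"], auto)
    also have "col (B * W) 0 = B *\<^sub>v col W 0"
      using W(1) B by (intro col_mult2[of _ "Suc n" "Suc n" _ "Suc n"]) auto
    finally show ?thesis unfolding W(3) .
  qed
  also have "\<dots> = e \<cdot>\<^sub>v (transpose_mat W *\<^sub>v v)"
    using W v by (simp add: mult_mat_vec)
  also have "transpose_mat W *\<^sub>v v = col (transpose_mat W * W) 0"
    unfolding W(3)[symmetric] using W(1) by (intro col_mult2[symmetric]) auto
  finally have col0: "col A 0 = e \<cdot>\<^sub>v unit_vec (Suc n) 0"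
    using W by simp
  have A0: "A $$ (i, 0) = (if i = 0 then e else 0)" if "i < Suc n" for i
  proof -
    have "A $$ (i, 0) = col A 0 $ i" using that A by simp
    thus ?thesis unfolding col0 using that by (simp add: unit_vec_def)
  qed
  have A0': "A $$ (0, i) = (if i = 0 then e else 0)" if "i < Suc n" for i
    using A0[OF that] symA that A by (metis carrier_matD index_transpose_mat(1) zero_less_Suc)
  define A3 where "A3 = mat n n (\<lambda>(i, j). A $$ (Suc i, Suc j))"
  have A3: "A3 \<in> carrier_mat n n" by (simp add: A3_def)
  have "A3 $$ (j, i) = A3 $$ (i, j)" if "i < n" "j < n" for i j
    using that symA A unfolding A3_def
    by simp (metis Suc_less_eq carrier_matD index_transpose_mat(1))
  hence symA3: "transpose_mat A3 = A3" using A3 by (intro eq_matI) auto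
  have block: "A = four_block_mat (mat 1 1 (\<lambda>_. e)) (0\<^sub>m 1 n) (0\<^sub>m n 1) A3"
    using A A0 A0' by (intro eq_matI) (auto simp: A3_def four_block_mat_def Let_def simp del: index_mult_mat)
  obtain U3 es where U3: "U3 \<in> carrier_mat n n" "transpose_mat U3 * U3 = 1\<^sub>m n"
    "transpose_mat U3 * A3 * U3 = mat n n (\<lambda>(i, j). if i = j then es i else 0)"
    using Suc.IH[OF A3 symA3] by blast
  define F where "F = four_block_mat (1\<^sub>m 1) (0\<^sub>m 1 n) (0\<^sub>m n 1) U3"
  have F: "F \<in> carrier_mat (Suc n) (Suc n)" using U3(1) by (auto simp: F_def)
  have FT: "transpose_mat F = four_block_mat (1\<^sub>m 1) (0\<^sub>m 1 n) (0\<^sub>m n 1) (transpose_mat U3)"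
    unfolding F_def using U3(1) by (subst transpose_four_block_mat[of _ 1 1 _ n _ n]) auto
  have FTF: "transpose_mat F * F = 1\<^sub>m (Suc n)"
    unfolding FT unfolding F_def using U3(1,2) by (subst mult_four_block_diag) (auto simp: four_block_one_mat)
  have FTAF: "transpose_mat F * A * F =
      four_block_mat (mat 1 1 (\<lambda>_. e)) (0\<^sub>m 1 n) (0\<^sub>m n 1) (transpose_mat U3 * A3 * U3)"
    unfolding block FT unfolding F_def using U3(1) A3
    by (simp del: One_nat_def add: mult_four_block_diag[of _ _ _ n] assoc_mult_mat[of _ n n _ n _ n])
  let ?U = "W * F"
  have U: "?U \<in> carrier_mat (Suc n) (Suc n)" using W F by auto
  have UT: "transpose_mat ?U = transpose_mat F * transpose_mat W"
    using W F by (intro transpose_mult) auto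
  have "transpose_mat ?U * ?U = transpose_mat F * (transpose_mat W * W) * F"
    unfolding UT using W(1) F
    by (simp add: assoc_mult_mat[of _ "Suc n" "Suc n" _ "Suc n" _ "Suc n"])
  hence UTU: "transpose_mat ?U * ?U = 1\<^sub>m (Suc n)" using W(1,2) F FTF by simp
  have "transpose_mat ?U * B * ?U = transpose_mat F * A * F"
    unfolding UT A_def using W(1) F B
    by (simp add: assoc_mult_mat[of _ "Suc n" "Suc n" _ "Suc n" _ "Suc n"])
  also have "\<dots> = mat (Suc n) (Suc n) (\<lambda>(i, j). if i = j then (case i of 0 \<Rightarrow> e | Suc k \<Rightarrow> es k) else 0)"
    unfolding FTAF U3(3) by (intro eq_matI) (auto simp: four_block_mat_def Let_def split: nat.splits)
  finally show ?case using U UTU by blast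
qed

text \<open>Puts the definition by multiplicities into a usable form. The characteristic polynomial
  is invariant under similarity, so the order of a root counts the diagonal entries
  \<open>es k\<close> equal to it; and \<open>es k\<close> is the squared length of column k of X U,
  so its square root is a singular value.\<close>

lemma nuclear_norm_orthogonal_basis:
  assumes X: "X \<in> carrier_mat d1 d2"
  obtains U es where "U \<in> carrier_mat d2 d2" "transpose_mat U * U = 1\<^sub>m d2" "U * transpose_mat U = 1\<^sub>m d2"
    "\<And>k. k < d2 \<Longrightarrow> (\<Sum>i<d1. ((X * U) $$ (i, k))\<^sup>2) = es k"
    "nuclear_norm X = (\<Sum>k<d2. sqrt (es k))"
proof -
  let ?B = "transpose_mat X * X"
  have B: "?B \<in> carrier_mat d2 d2" using X by auto
  have "transpose_mat ?B = ?B" using X by (simp add: transpose_mult[of _ d2 d1])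
  then obtain U es where U: "U \<in> carrier_mat d2 d2" "transpose_mat U * U = 1\<^sub>m d2"
    and D: "transpose_mat U * ?B * U = mat d2 d2 (\<lambda>(i, j). if i = j then es i else 0)"
    using real_symmetric_diagonalization[OF B] by blast
  let ?D = "mat d2 d2 (\<lambda>(i, j). if i = j then es i else 0)"
  have UT: "transpose_mat U \<in> carrier_mat d2 d2" using U by simp
  have UUT: "U * transpose_mat U = 1\<^sub>m d2"
    using mat_mult_left_right_inverse[OF UT U(1) U(2)] .
  have "similar_mat_wit ?D ?B (transpose_mat U) U"
    using U UUT UT B D by (intro similar_mat_witI[of _ _ d2]) auto
  hence "char_poly ?B = char_poly ?D"
    using char_poly_similar[of ?D ?B] unfolding similar_mat_def by metis
  also have "\<dots> = (\<Prod>a\<leftarrow>diag_mat ?D. [:- a, 1:])"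
    by (intro char_poly_upper_triangular[of _ d2]) auto
  also have "diag_mat ?D = map es [0..<d2]"
    by (simp add: diag_mat_def)
  finally have cp: "char_poly ?B = (\<Prod>a\<leftarrow>map es [0..<d2]. [:- a, 1:])" .
  have ev: "{x. eigenvalue ?B x} = es ` {..<d2}"
    unfolding eigenvalue_root_char_poly[OF B] cp
    by (auto simp: poly_prod_list prod_list_zero_iff)
  have order: "Polynomial.order x (char_poly ?B) = card {k \<in> {..<d2}. es k = x}" for x
  proof -
    have "Polynomial.order x (char_poly ?B) = sum_list (map (\<lambda>k. Polynomial.order x [:- es k, 1:]) [0..<d2])"
      unfolding cp by (subst order_prod_list) (auto simp: comp_def)
    also have "\<dots> = (\<Sum>k<d2. Polynomial.order x [:- es k, 1:])"
      by (simp add: sum_list_distinct_conv_sum_set lessThan_atLeast0)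
    also have "\<dots> = (\<Sum>k<d2. if es k = x then 1 else 0)"
      by (intro sum.cong refl) (auto simp: order_linear' intro: order_0I)
    finally show ?thesis by (simp add: sum.If_cases Int_def)
  qed
  have "nuclear_norm X = (\<Sum>x\<in>es ` {..<d2}. real (card {k \<in> {..<d2}. es k = x}) * sqrt x)"
    unfolding nuclear_norm_def Let_def ev order ..
  also have "\<dots> = (\<Sum>x\<in>es ` {..<d2}. \<Sum>k\<in>{k \<in> {..<d2}. es k = x}. sqrt (es k))"
    by (intro sum.cong) auto
  also have "\<dots> = (\<Sum>k<d2. sqrt (es k))"
    by (intro sum.group) auto
  finally have nn: "nuclear_norm X = (\<Sum>k<d2. sqrt (es k))" .
  have "(\<Sum>i<d1. ((X * U) $$ (i, k))\<^sup>2) = es k" if k: "k < d2" for k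
  proof -
    have "transpose_mat U * ?B * U = transpose_mat (X * U) * (X * U)"
      using X U(1) UT
      by (simp add: transpose_mult[of X d1 d2] assoc_mult_mat[of _ d2 d2 _ d2 _ d2]
          assoc_mult_mat[of _ d2 d2 _ d1 _ d2] assoc_mult_mat[of _ d2 d1 _ d2 _ d2])
    hence "?D $$ (k, k) = (transpose_mat (X * U) * (X * U)) $$ (k, k)"
      using D by (simp only:)
    also have "\<dots> = (\<Sum>i<d1. ((X * U) $$ (i, k))\<^sup>2)"
      unfolding power2_eq_square using k X U(1) by (intro index_transpose_mult) auto
    finally show ?thesis using k by simp
  qed
  thus ?thesis using that U UUT nn by blast
qed

text \<open>Inserting U U^T = 1 turns the inner product into a sum over k of inner products of the
  k-th columns of A U and X U. The former has length at most b, being the image of a unit vector;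
  the length of the latter is the k-th singular value.\<close>

lemma inner_le_operator_bound_nuclear_norm:
  assumes X: "X \<in> carrier_mat d1 d2"
    and b: "\<And>v. L2_set (\<lambda>i. \<Sum>j<d2. A (i, j) * v j) {..<d1} \<le> b * L2_set v {..<d2}"
  shows "(\<Sum>i<d1. \<Sum>j<d2. A (i, j) * X $$ (i, j)) \<le> b * nuclear_norm X"
proof -
  obtain U es where U: "U \<in> carrier_mat d2 d2" "transpose_mat U * U = 1\<^sub>m d2" "U * transpose_mat U = 1\<^sub>m d2"
    and es: "\<And>k. k < d2 \<Longrightarrow> (\<Sum>i<d1. ((X * U) $$ (i, k))\<^sup>2) = es k"
    and nn: "nuclear_norm X = (\<Sum>k<d2. sqrt (es k))"
    using nuclear_norm_orthogonal_basis[OF X] by blast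
  define A' where "A' = mat d1 d2 A"
  have A': "A' \<in> carrier_mat d1 d2" by (simp add: A'_def)
  have XU: "X * U \<in> carrier_mat d1 d2" and AU: "A' * U \<in> carrier_mat d1 d2" using X A' U by auto
  have "(A' * U) * transpose_mat (X * U) = A' * (U * transpose_mat U) * transpose_mat X"
    using X A' U(1) by (simp add: transpose_mult[of X d1 d2] assoc_mult_mat[of _ d1 d2 _ d2 _ d1]
        assoc_mult_mat[of _ d1 d2 _ d2 _ d2] assoc_mult_mat[of _ d2 d2 _ d2 _ d1])
  hence eq: "(A' * U) * transpose_mat (X * U) = A' * transpose_mat X" using U A' by simp
  have "(\<Sum>i<d1. \<Sum>j<d2. A (i, j) * X $$ (i, j)) = (\<Sum>i<d1. (A' * transpose_mat X) $$ (i, i))"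
    using X by (intro sum.cong refl) (simp add: A'_def scalar_prod_def lessThan_atLeast0)
  also have "\<dots> = (\<Sum>i<d1. \<Sum>k<d2. (A' * U) $$ (i, k) * (X * U) $$ (i, k))"
    unfolding eq[symmetric] using XU AU by (intro sum.cong refl index_mult_transpose) auto
  also have "\<dots> = (\<Sum>k<d2. \<Sum>i<d1. (A' * U) $$ (i, k) * (X * U) $$ (i, k))" by (rule sum.swap)
  also have "\<dots> \<le> (\<Sum>k<d2. b * sqrt (es k))"
  proof (intro sum_mono)
    fix k assume "k \<in> {..<d2}"
    hence k: "k < d2" by simp
    have "(\<Sum>i<d1. (A' * U) $$ (i, k) * (X * U) $$ (i, k)) \<le>
        (\<Sum>i<d1. \<bar>(A' * U) $$ (i, k)\<bar> * \<bar>(X * U) $$ (i, k)\<bar>)"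
      by (intro sum_mono) (metis abs_ge_self abs_mult)
    also have "\<dots> \<le> L2_set (\<lambda>i. (A' * U) $$ (i, k)) {..<d1} * L2_set (\<lambda>i. (X * U) $$ (i, k)) {..<d1}"
      by (rule L2_set_mult_ineq)
    also have "L2_set (\<lambda>i. (X * U) $$ (i, k)) {..<d1} = sqrt (es k)"
      using es[OF k] by (simp add: L2_set_def)
    also have "L2_set (\<lambda>i. (A' * U) $$ (i, k)) {..<d1} = L2_set (\<lambda>i. \<Sum>j<d2. A (i, j) * U $$ (j, k)) {..<d1}"
      using k U(1) by (intro L2_set_cong) (auto simp: A'_def scalar_prod_def lessThan_atLeast0)
    also have "\<dots> \<le> b * L2_set (\<lambda>j. U $$ (j, k)) {..<d2}" by (rule b)
    also have "L2_set (\<lambda>j. U $$ (j, k)) {..<d2} = 1"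
    proof -
      have "(\<Sum>j<d2. (U $$ (j, k))\<^sup>2) = (transpose_mat U * U) $$ (k, k)"
        using k U(1) by (simp add: scalar_prod_def lessThan_atLeast0 power2_eq_square)
      thus ?thesis using U k by (simp add: L2_set_def)
    qed
    finally show "(\<Sum>i<d1. (A' * U) $$ (i, k) * (X * U) $$ (i, k)) \<le> b * sqrt (es k)"
      using es[OF k] sum_nonneg[of "{..<d1}" "\<lambda>i. ((X * U) $$ (i, k))\<^sup>2"] by (simp add: mult_right_mono)
  qed
  also have "\<dots> = b * nuclear_norm X" by (simp add: nn sum_distrib_left)
  finally show ?thesis .
qed

section \<open>Symmetrization and contraction, one coordinate at a time\<close>

lemma expectation_pair_pmf_finite:
  fixes F :: "'a \<times> 'b \<Rightarrow> real"
  assumes "finite (set_pmf p)" "finite (set_pmf q)"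
  shows "measure_pmf.expectation (pair_pmf p q) F =
    measure_pmf.expectation p (\<lambda>x. measure_pmf.expectation q (\<lambda>y. F (x, y)))"
proof -
  have "measure_pmf.expectation (pair_pmf p q) F =
      (\<Sum>z\<in>set_pmf p \<times> set_pmf q. F z * pmf (pair_pmf p q) z)"
    using assms by (intro integral_measure_pmf_real) auto
  also have "\<dots> = (\<Sum>x\<in>set_pmf p. \<Sum>y\<in>set_pmf q. F (x, y) * (pmf p x * pmf q y))"
    by (subst sum.cartesian_product) (auto intro!: sum.cong simp: pmf_pair)
  also have "\<dots> = (\<Sum>x\<in>set_pmf p. measure_pmf.expectation q (\<lambda>y. F (x, y)) * pmf p x)"
    using assms
    by (intro sum.cong refl, subst integral_measure_pmf_real[of "set_pmf q"])
       (auto simp: sum_distrib_left mult_ac)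
  also have "\<dots> = measure_pmf.expectation p (\<lambda>x. measure_pmf.expectation q (\<lambda>y. F (x, y)))"
    using assms by (intro integral_measure_pmf_real[symmetric]) auto
  finally show ?thesis .
qed

lemma finite_set_Pi_pmf:
  assumes "finite I" "\<And>i. i \<in> I \<Longrightarrow> finite (set_pmf (p i))"
  shows "finite (set_pmf (Pi_pmf I d p))"
  using assms by (auto simp: set_Pi_pmf intro!: finite_PiE_dflt)

lemma expectation_Pi_pmf_insert:
  fixes F :: "('a \<Rightarrow> 'b) \<Rightarrow> real"
  assumes "finite I" "i \<notin> I" "\<And>j. j \<in> insert i I \<Longrightarrow> finite (set_pmf (p j))"
  shows "measure_pmf.expectation (Pi_pmf (insert i I) d p) F =
    measure_pmf.expectation (p i) (\<lambda>y. measure_pmf.expectation (Pi_pmf I d p) (\<lambda>f. F (f(i := y))))"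
  using assms
  by (simp add: Pi_pmf_insert expectation_pair_pmf_finite finite_set_Pi_pmf)

lemma expectation_swap_finite:
  fixes F :: "'a \<Rightarrow> 'b \<Rightarrow> real"
  assumes "finite (set_pmf p)" "finite (set_pmf q)"
  shows "measure_pmf.expectation p (\<lambda>x. measure_pmf.expectation q (F x)) =
    measure_pmf.expectation q (\<lambda>y. measure_pmf.expectation p (\<lambda>x. F x y))"
proof -
  have "measure_pmf.expectation (pair_pmf p q) (\<lambda>(x, y). F x y) =
      measure_pmf.expectation (pair_pmf q p) (\<lambda>(y, x). F x y)"
    by (subst pair_commute_pmf) (simp add: case_prod_unfold)
  thus ?thesis
    using assms by (simp add: expectation_pair_pmf_finite)
qed

lemma expectation_mono_finite:
  fixes f g :: "'a \<Rightarrow> real"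
  assumes "finite (set_pmf p)" "\<And>x. x \<in> set_pmf p \<Longrightarrow> f x \<le> g x"
  shows "measure_pmf.expectation p f \<le> measure_pmf.expectation p g"
  using assms
  by (intro integral_mono_AE integrable_measure_pmf_finite) (auto simp: AE_measure_pmf_iff)

text \<open>The exchange argument of Lindeberg. The comparison for a single coordinate is assumed
  for every offset \<open>a\<close>, so that the coordinates already exchanged and those still to
  come can be absorbed into it. \<open>F\<close> is an arbitrary functional; it is later a power of
  the positive part of a maximum.\<close>

lemma Pi_pmf_replacement:
  fixes F :: "('x \<Rightarrow> real) \<Rightarrow> real"
  assumes "finite I"
    and "\<And>i. i \<in> I \<Longrightarrow> finite (set_pmf (\<nu> i))" "\<And>i. i \<in> I \<Longrightarrow> finite (set_pmf (\<tau> i))"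
    and "\<And>i a. i \<in> I \<Longrightarrow>
      measure_pmf.expectation (\<nu> i) (\<lambda>w. F (\<lambda>x. a x + h i w x)) \<le>
      measure_pmf.expectation (\<tau> i) (\<lambda>s. F (\<lambda>x. a x + k i s x))"
  shows "measure_pmf.expectation (Pi_pmf I d \<nu>) (\<lambda>w. F (\<lambda>x. a x + (\<Sum>i\<in>I. h i (w i) x))) \<le>
    measure_pmf.expectation (Pi_pmf I d' \<tau>) (\<lambda>s. F (\<lambda>x. a x + (\<Sum>i\<in>I. k i (s i) x)))"
  using assms
proof (induction I arbitrary: a rule: finite_induct)
  case empty
  show ?case by simp
next
  case (insert i I)
  note fin = insert.prems(1,2)
  have upd: "(\<Sum>j\<in>I. g j (if j = i then y else f j) x) = (\<Sum>j\<in>I. g j (f j) x)"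
    for f y x and g :: "'a \<Rightarrow> 'z \<Rightarrow> 'x \<Rightarrow> real"
    using insert.hyps by (intro sum.cong) auto
  have fin\<tau>: "finite (set_pmf (Pi_pmf I d' \<tau>))"
    using insert by (intro finite_set_Pi_pmf) auto
  have "measure_pmf.expectation (Pi_pmf (insert i I) d \<nu>)
        (\<lambda>w. F (\<lambda>x. a x + (\<Sum>j\<in>insert i I. h j (w j) x))) =
      measure_pmf.expectation (\<nu> i) (\<lambda>y. measure_pmf.expectation (Pi_pmf I d \<nu>)
        (\<lambda>w. F (\<lambda>x. (a x + h i y x) + (\<Sum>j\<in>I. h j (w j) x))))"
    using insert.hyps fin by (subst expectation_Pi_pmf_insert) (auto simp: upd add.assoc)
  also have "\<dots> \<le> measure_pmf.expectation (\<nu> i) (\<lambda>y. measure_pmf.expectation (Pi_pmf I d' \<tau>)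
        (\<lambda>s. F (\<lambda>x. (a x + h i y x) + (\<Sum>j\<in>I. k j (s j) x))))"
    using insert.prems by (intro expectation_mono_finite insert.IH) auto
  also have "\<dots> = measure_pmf.expectation (Pi_pmf I d' \<tau>) (\<lambda>s. measure_pmf.expectation (\<nu> i)
        (\<lambda>y. F (\<lambda>x. (a x + (\<Sum>j\<in>I. k j (s j) x)) + h i y x)))"
    using fin fin\<tau> by (subst expectation_swap_finite) (auto simp: add_ac)
  also have "\<dots> \<le> measure_pmf.expectation (Pi_pmf I d' \<tau>) (\<lambda>s. measure_pmf.expectation (\<tau> i)
        (\<lambda>y. F (\<lambda>x. (a x + (\<Sum>j\<in>I. k j (s j) x)) + k i y x)))"
    using insert.prems fin\<tau> by (intro expectation_mono_finite) auto
  also have "\<dots> = measure_pmf.expectation (\<tau> i) (\<lambda>y. measure_pmf.expectation (Pi_pmf I d' \<tau>)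
        (\<lambda>s. F (\<lambda>x. (a x + (\<Sum>j\<in>I. k j (s j) x)) + k i y x)))"
    using fin fin\<tau> by (subst expectation_swap_finite) auto
  also have "\<dots> = measure_pmf.expectation (Pi_pmf (insert i I) d' \<tau>)
        (\<lambda>s. F (\<lambda>x. a x + (\<Sum>j\<in>insert i I. k j (s j) x)))"
    using insert.hyps fin by (subst expectation_Pi_pmf_insert) (auto simp: upd add_ac)
  finally show ?case .
qed

section \<open>Symmetrization and contraction for a maximum over a finite set\<close>

text \<open>Jensen's inequality replaces the subtracted mean by an independent copy w'. Convexity
  then splits a + g w - g w' into the halves a + 2 g w and a - 2 g w'. Each half involves only one
  of the two copies, so both may be read off the same w, and what remains is a fair sign in front of
  2 g.\<close>

lemma symmetrization_step:
  fixes g :: "'b \<Rightarrow> 'x \<Rightarrow> real"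
  assumes \<nu>: "finite (set_pmf \<nu>)" and T: "finite T" "T \<noteq> {}"
    and \<Phi>: "convex_on UNIV \<Phi>" "mono \<Phi>"
  shows "measure_pmf.expectation \<nu>
      (\<lambda>w. \<Phi> (MAX x\<in>T. a x + (g w x - measure_pmf.expectation \<nu> (\<lambda>w. g w x)))) \<le>
    measure_pmf.expectation \<nu>
      (\<lambda>w. (\<Phi> (MAX x\<in>T. a x + 2 * g w x) + \<Phi> (MAX x\<in>T. a x - 2 * g w x)) / 2)"
proof -
  note int = integrable_measure_pmf_finite[OF \<nu>]
  have le: "\<Phi> (MAX x\<in>T. a x + (g w x - measure_pmf.expectation \<nu> (\<lambda>w. g w x))) \<le>
     measure_pmf.expectation \<nu> (\<lambda>w'. \<Phi> (MAX x\<in>T. a x + (g w x - g w' x)))" for w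
  proof -
    have "(MAX x\<in>T. a x + (g w x - measure_pmf.expectation \<nu> (\<lambda>w. g w x))) \<le>
        measure_pmf.expectation \<nu> (\<lambda>w'. MAX x\<in>T. a x + (g w x - g w' x))"
    proof (rule Max.boundedI)
      fix z assume "z \<in> (\<lambda>x. a x + (g w x - measure_pmf.expectation \<nu> (\<lambda>w. g w x))) ` T"
      then obtain x where x: "x \<in> T"
        "z = a x + (g w x - measure_pmf.expectation \<nu> (\<lambda>w. g w x))" by auto
      have "z = measure_pmf.expectation \<nu> (\<lambda>w'. a x + (g w x - g w' x))"
        by (simp add: x int[where 'b = real] measure_pmf.prob_space)
      also have "\<dots> \<le> measure_pmf.expectation \<nu> (\<lambda>w'. MAX x\<in>T. a x + (g w x - g w' x))"
        using T x by (intro expectation_mono_finite \<nu> Max_ge) auto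
      finally show "z \<le> \<dots>" .
    qed (use T in auto)
    hence "\<Phi> (MAX x\<in>T. a x + (g w x - measure_pmf.expectation \<nu> (\<lambda>w. g w x))) \<le>
        \<Phi> (measure_pmf.expectation \<nu> (\<lambda>w'. MAX x\<in>T. a x + (g w x - g w' x)))"
      using \<Phi>(2) by (rule monoD[rotated])
    also have "\<dots> \<le> measure_pmf.expectation \<nu> (\<lambda>w'. \<Phi> (MAX x\<in>T. a x + (g w x - g w' x)))"
      using \<Phi>(1) by (intro measure_pmf.jensens_inequality[of _ _ UNIV] int) auto
    finally show ?thesis .
  qed
  have half: "\<Phi> (MAX x\<in>T. a x + (g w x - g w' x)) \<le>
     (\<Phi> (MAX x\<in>T. a x + 2 * g w x) + \<Phi> (MAX x\<in>T. a x - 2 * g w' x)) / 2" for w w'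
  proof -
    let ?A = "MAX x\<in>T. a x + 2 * g w x" and ?B = "MAX x\<in>T. a x - 2 * g w' x"
    have "(MAX x\<in>T. a x + (g w x - g w' x)) \<le> (1/2) * ?A + (1/2) * ?B"
    proof (rule Max.boundedI)
      fix z assume "z \<in> (\<lambda>x. a x + (g w x - g w' x)) ` T"
      then obtain x where x: "x \<in> T" "z = a x + (g w x - g w' x)" by auto
      have "a x + 2 * g w x \<le> ?A" "a x - 2 * g w' x \<le> ?B"
        using T x by (auto intro!: Max_ge)
      thus "z \<le> (1/2) * ?A + (1/2) * ?B" using x by simp
    qed (use T in auto)
    hence "\<Phi> (MAX x\<in>T. a x + (g w x - g w' x)) \<le> \<Phi> ((1/2) * ?A + (1/2) * ?B)"
      using \<Phi>(2) by (rule monoD[rotated])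
    also have "\<dots> \<le> (1/2) * \<Phi> ?A + (1/2) * \<Phi> ?B"
      using convex_onD[OF \<Phi>(1), of "1/2" ?A ?B] by simp
    finally show ?thesis by simp
  qed
  let ?P = "\<lambda>w. \<Phi> (MAX x\<in>T. a x + 2 * g w x)" and ?Q = "\<lambda>w. \<Phi> (MAX x\<in>T. a x - 2 * g w x)"
  have "measure_pmf.expectation \<nu>
      (\<lambda>w. \<Phi> (MAX x\<in>T. a x + (g w x - measure_pmf.expectation \<nu> (\<lambda>w. g w x)))) \<le>
    measure_pmf.expectation \<nu> (\<lambda>w. measure_pmf.expectation \<nu> (\<lambda>w'. (?P w + ?Q w') / 2))"
    by (intro expectation_mono_finite \<nu> order.trans[OF le] half)
  also have "\<dots> = measure_pmf.expectation \<nu> (\<lambda>w. (?P w + ?Q w) / 2)"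
    by (simp add: int[where 'b = real] measure_pmf.prob_space add_divide_distrib)
  finally show ?thesis .
qed

text \<open>Weak majorization for two points. After ordering both pairs, either each value is
  dominated by its counterpart, or B lies between Q and P. In that case B and P + Q - B are mirrored
  convex combinations of P and Q, and A is at most the latter.\<close>

lemma convex_mono_weak_majorization:
  fixes \<Phi> :: "real \<Rightarrow> real"
  assumes \<Phi>: "convex_on UNIV \<Phi>" "mono \<Phi>"
    and le: "A \<le> max P Q" "B \<le> max P Q" "A + B \<le> P + Q"
  shows "\<Phi> A + \<Phi> B \<le> \<Phi> P + \<Phi> Q"
proof -
  have main: "\<Phi> A + \<Phi> B \<le> \<Phi> P + \<Phi> Q" if "B \<le> A" "Q \<le> P" "A \<le> P" "A + B \<le> P + Q" for A B P Q
  proof (cases "B \<le> Q")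
    case True
    thus ?thesis using monoD[OF \<Phi>(2)] that by (simp add: add_mono)
  next
    case False
    define t where "t = (B - Q) / (P - Q)"
    have pq: "Q < P" using that False by simp
    have t: "0 \<le> t" "t \<le> 1" using that False pq by (auto simp: t_def field_simps)
    have "t * (P - Q) = B - Q" using pq by (simp add: t_def)
    hence B: "B = (1 - t) * Q + t * P" by (simp add: algebra_simps)
    have A: "P + Q - B = (1 - t) * P + t * Q" unfolding B by (simp add: algebra_simps)
    have "\<Phi> B \<le> (1 - t) * \<Phi> Q + t * \<Phi> P"
      using convex_onD[OF \<Phi>(1) t, of Q P] B by simp
    moreover have "\<Phi> (P + Q - B) \<le> (1 - t) * \<Phi> P + t * \<Phi> Q"
      using convex_onD[OF \<Phi>(1) t, of P Q] A by simp
    moreover have "\<Phi> A \<le> \<Phi> (P + Q - B)" using that by (intro monoD[OF \<Phi>(2)]) simp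
    ultimately show ?thesis by (simp add: algebra_simps)
  qed
  show ?thesis
    using main[of A B P Q] main[of A B Q P] main[of B A P Q] main[of B A Q P] le
    by (smt (verit))
qed

text \<open>One step of the contraction principle of Ledoux and Talagrand. With x and y the
  maximizers on the left, the Lipschitz bound controls the sum of the two maxima. The pointwise
  bound controls each of them, but only by the larger of the two maxima on the right, because the
  sign of \<open>t x\<close> is unknown; this is the hypothesis of weak majorization.\<close>

lemma contraction_step:
  fixes t \<phi> :: "'x \<Rightarrow> real"
  assumes T: "finite T" "T \<noteq> {}" and \<Phi>: "convex_on UNIV \<Phi>" "mono \<Phi>"
    and lip: "\<And>x y. x \<in> T \<Longrightarrow> y \<in> T \<Longrightarrow> \<bar>\<phi> x - \<phi> y\<bar> \<le> \<bar>t x - t y\<bar>"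
    and bnd: "\<And>x. x \<in> T \<Longrightarrow> \<bar>\<phi> x\<bar> \<le> \<bar>t x\<bar>"
  shows "\<Phi> (MAX x\<in>T. a x + \<phi> x) + \<Phi> (MAX x\<in>T. a x - \<phi> x) \<le>
    \<Phi> (MAX x\<in>T. a x + t x) + \<Phi> (MAX x\<in>T. a x - t x)"
proof (rule convex_mono_weak_majorization[OF \<Phi>])
  let ?P = "MAX x\<in>T. a x + t x" and ?Q = "MAX x\<in>T. a x - t x"
  have P: "a x + t x \<le> ?P" and Q: "a x - t x \<le> ?Q" if "x \<in> T" for x
    using T that by (auto intro!: Max_ge)
  have "(MAX x\<in>T. a x + \<phi> x) \<in> (\<lambda>x. a x + \<phi> x) ` T" "(MAX x\<in>T. a x - \<phi> x) \<in> (\<lambda>x. a x - \<phi> x) ` T"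
    using T by (auto intro!: Max_in)
  then obtain x y where x: "x \<in> T" "(MAX x\<in>T. a x + \<phi> x) = a x + \<phi> x"
    and y: "y \<in> T" "(MAX x\<in>T. a x - \<phi> x) = a y - \<phi> y" by auto
  show "(MAX x\<in>T. a x + \<phi> x) \<le> max ?P ?Q"
    unfolding x(2) using P[OF x(1)] Q[OF x(1)] bnd[OF x(1)] by linarith
  show "(MAX x\<in>T. a x - \<phi> x) \<le> max ?P ?Q"
    unfolding y(2) using P[OF y(1)] Q[OF y(1)] bnd[OF y(1)] by linarith
  show "(MAX x\<in>T. a x + \<phi> x) + (MAX x\<in>T. a x - \<phi> x) \<le> ?P + ?Q"
    unfolding x(2) y(2)
    using P[OF x(1)] Q[OF x(1)] P[OF y(1)] Q[OF y(1)] lip[OF x(1) y(1)] by linarith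
qed

text \<open>Symmetrization and contraction ask for a function that is both convex and monotone. An
  even power is convex only; its restriction to the positive part has both properties.\<close>

lemma convex_on_pos_part_power:
  assumes "even N"
  shows "convex_on UNIV (\<lambda>x :: real. max 0 x ^ N)"
proof (rule convex_onI)
  fix t x y :: real assume t: "0 < t" "t < 1"
  have "max 0 ((1 - t) *\<^sub>R x + t *\<^sub>R y) \<le> (1 - t) * max 0 x + t * max 0 y"
    using t by (auto intro!: add_mono add_nonneg_nonneg mult_left_mono)
  hence "max 0 ((1 - t) *\<^sub>R x + t *\<^sub>R y) ^ N \<le> ((1 - t) * max 0 x + t * max 0 y) ^ N"
    by (intro power_mono) auto
  also have "\<dots> \<le> (1 - t) * max 0 x ^ N + t * max 0 y ^ N"
    using convex_onD[OF convex_power_even[OF assms], of t "max 0 x" "max 0 y"] t by simp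
  finally show "max 0 ((1 - t) *\<^sub>R x + t *\<^sub>R y) ^ N \<le> (1 - t) * max 0 x ^ N + t * max 0 y ^ N" .
qed simp

lemma mono_pos_part_power: "mono (\<lambda>x :: real. max 0 x ^ N)"
  by (intro monoI power_mono) auto

text \<open>Serves to merge the draws of the sampling set and of the signs into one product law over
  the entries, with inclusion and sign of an entry as a single coordinate.\<close>

lemma map_pair_Pi_pmf:
  assumes "finite I"
  shows "map_pmf (\<lambda>(f, g) i. (f i, g i)) (pair_pmf (Pi_pmf I d p) (Pi_pmf I d' p')) =
    Pi_pmf I (d, d') (\<lambda>i. pair_pmf (p i) (p' i))"
  using assms
proof (induction I rule: finite_induct)
  case empty
  show ?case by (simp add: pair_return_pmf1)
next
  case (insert i I)
  have "map_pmf (\<lambda>(f, g) i. (f i, g i)) (pair_pmf (Pi_pmf (insert i I) d p) (Pi_pmf (insert i I) d' p')) =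
    do {y \<leftarrow> p i; f \<leftarrow> Pi_pmf I d p; z \<leftarrow> p' i; g \<leftarrow> Pi_pmf I d' p'; return_pmf ((\<lambda>i. (f i, g i))(i := (y, z)))}"
    using insert.hyps
    by (simp add: Pi_pmf_insert' pair_pmf_def map_pmf_def bind_assoc_pmf bind_return_pmf fun_upd_def if_distrib)
       (intro bind_pmf_cong refl, auto simp: fun_eq_iff)
  also have "\<dots> = do {y \<leftarrow> p i; z \<leftarrow> p' i; f \<leftarrow> Pi_pmf I d p; g \<leftarrow> Pi_pmf I d' p'; return_pmf ((\<lambda>i. (f i, g i))(i := (y, z)))}"
    by (subst bind_commute_pmf[of "p' i"]) simp
  also have "\<dots> = do {yz \<leftarrow> pair_pmf (p i) (p' i); h \<leftarrow> map_pmf (\<lambda>(f, g) i. (f i, g i)) (pair_pmf (Pi_pmf I d p) (Pi_pmf I d' p')); return_pmf (h(i := yz))}"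
    by (simp add: pair_pmf_def map_pmf_def bind_assoc_pmf bind_return_pmf)
  also have "\<dots> = Pi_pmf (insert i I) (d, d') (\<lambda>i. pair_pmf (p i) (p' i))"
    using insert by (simp add: Pi_pmf_insert')
  finally show ?case .
qed

section \<open>Closed walks in sparse random sign matrices\<close>

text \<open>From here on a matrix is a function of two indices restricted to a set \<open>V\<close>,
  so that one theory covers the dilation, indexed by a sum type, and the full matrix, indexed by
  numbers.\<close>

definition mat_app :: "'v set \<Rightarrow> ('v \<Rightarrow> 'v \<Rightarrow> real) \<Rightarrow> ('v \<Rightarrow> real) \<Rightarrow> 'v \<Rightarrow> real" where
  "mat_app V S v x = (\<Sum>y\<in>V. S x y * v y)"

definition unit_fun :: "'v \<Rightarrow> 'v \<Rightarrow> real" where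
  "unit_fun y x = of_bool (x = y)"

text \<open>Lists grow at the head: \<open>last h\<close> is the start of a walk and
  \<open>hd h\<close> its current end. The whole history is handed to \<open>F\<close>, because the
  expected weight of a walk depends on which edges are repeated.\<close>

fun walk_sum :: "'v set \<Rightarrow> nat \<Rightarrow> ('v list \<Rightarrow> real) \<Rightarrow> 'v list \<Rightarrow> real" where
  "walk_sum V 0 F h = F h"
| "walk_sum V (Suc n) F h = (\<Sum>x\<in>V. walk_sum V n F (x # h))"

fun walk_edges :: "'v list \<Rightarrow> 'v set list" where
  "walk_edges (x # y # h) = {x, y} # walk_edges (y # h)"
| "walk_edges _ = []"

definition even_walk :: "'v list \<Rightarrow> bool" where
  "even_walk h \<longleftrightarrow> (\<forall>e. even (count_list (walk_edges h) e))"

lemma funpow_mat_app_eq_walk_sum: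
  fixes a :: "'v set \<Rightarrow> real"
  shows "walk_sum V n (\<lambda>h. prod_list (map a (walk_edges h)) * v (hd h)) (x # h) =
    prod_list (map a (walk_edges (x # h))) * (mat_app V (\<lambda>x y. a {x, y}) ^^ n) v x"
proof (induction n arbitrary: x h)
  case (Suc n)
  have "(mat_app V (\<lambda>x y. a {x, y}) ^^ Suc n) v x =
      (\<Sum>y\<in>V. a {x, y} * (mat_app V (\<lambda>x y. a {x, y}) ^^ n) v y)"
    by (simp add: mat_app_def[of _ _ _ x])
  thus ?case
    unfolding walk_sum.simps Suc.IH by (simp add: sum_distrib_left mult_ac insert_commute)
qed simp

lemma expectation_walk_sum:
  assumes "finite (set_pmf p)"
  shows "measure_pmf.expectation p (\<lambda>s. walk_sum V n (F s) h) =
    walk_sum V n (\<lambda>h. measure_pmf.expectation p (\<lambda>s. F s h)) h"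
proof (induction n arbitrary: h)
  case (Suc n)
  show ?case
    by (simp add: Suc.IH[symmetric] Bochner_Integration.integral_sum
        integrable_measure_pmf_finite[OF assms])
qed simp

lemma walk_sum_nonneg:
  assumes "\<And>h. 0 \<le> F h"
  shows "0 \<le> walk_sum V n F h"
  using assms by (induction n arbitrary: h) (auto intro: sum_nonneg)

lemma walk_sum_mono:
  assumes "\<And>h'. set h' \<subseteq> V \<Longrightarrow> h' \<noteq> [] \<Longrightarrow> last h' = last h \<Longrightarrow> F h' \<le> G h'"
    and "set h \<subseteq> V" "h \<noteq> []"
  shows "walk_sum V n F h \<le> walk_sum V n G h"
  using assms
proof (induction n arbitrary: h)
  case (Suc n)
  show ?case
    using Suc.prems(2) by (auto intro!: sum_mono Suc.IH simp: Suc.prems(1,3) dest: subsetD)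
qed simp

lemma walk_edges_subset: "e \<in> set (walk_edges h) \<Longrightarrow> e \<subseteq> set h"
  by (induction h rule: walk_edges.induct) auto

lemma walk_edges_map: "walk_edges (map f h) = map ((`) f) (walk_edges h)"
  by (induction h rule: walk_edges.induct) auto

text \<open>A vertex not seen before comes with an edge not seen before. This trades the weight q
  per edge, which the expectation yields, for a weight q per vertex, which the relabelling can
  handle.\<close>

lemma card_set_le_card_walk_edges: "card (set h) \<le> card (set (walk_edges h)) + 1"
proof (induction h rule: walk_edges.induct)
  case (1 x y h)
  show ?case
  proof (cases "x \<in> set (y # h)")
    case True
    hence "card (set (x # y # h)) = card (set (y # h))" by (simp add: insert_absorb)
    moreover have "card (set (walk_edges (y # h))) \<le> card (set (walk_edges (x # y # h)))"
      by (intro card_mono) auto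
    ultimately show ?thesis using 1 by linarith
  next
    case False
    hence "{x, y} \<notin> set (walk_edges (y # h))"
      using walk_edges_subset[of "{x, y}" "y # h"] by auto
    thus ?thesis using 1 False by simp
  qed
qed auto

lemma count_list_map_inj_on:
  assumes "inj_on f (insert x (set xs))"
  shows "count_list (map f xs) (f x) = count_list xs x"
  using assms by (induction xs) (auto simp: inj_on_def)

lemma all_even_count_list_map:
  assumes "inj_on f (set xs)"
  shows "(\<forall>y. even (count_list (map f xs) y)) \<longleftrightarrow> (\<forall>x. even (count_list xs x))"
proof -
  have inside: "count_list (map f xs) (f x) = count_list xs x" if "x \<in> set xs" for x
    using assms that by (subst count_list_map_inj_on) (auto simp: insert_absorb)
  have "even (count_list xs x)" if "\<forall>y. even (count_list (map f xs) y)" for x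
    using inside[of x] that[rule_format, of "f x"] by (cases "x \<in> set xs") auto
  moreover have "even (count_list (map f xs) y)" if "\<forall>x. even (count_list xs x)" for y
  proof (cases "y \<in> f ` set xs")
    case True
    then obtain x where "x \<in> set xs" "y = f x" by auto
    thus ?thesis using inside[of x] that by simp
  next
    case False
    hence "count_list (map f xs) y = 0" by (simp add: count_list_0_iff)
    thus ?thesis by simp
  qed
  ultimately show ?thesis by blast
qed

text \<open>Only the pattern of a walk matters: a relabelling that is injective on the vertices is
  injective on the edges, as sets of vertices, and keeps their multiplicities.\<close>

lemma even_walk_map:
  assumes "inj_on f (set h)"
  shows "even_walk (map f h) \<longleftrightarrow> even_walk h"
proof -
  have "inj_on ((`) f) (Pow (set h))"
    using assms by (rule inj_on_image_Pow)
  hence "inj_on ((`) f) (set (walk_edges h))"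
    by (rule inj_on_subset) (use walk_edges_subset in auto)
  thus ?thesis
    unfolding even_walk_def walk_edges_map by (rule all_even_count_list_map)
qed

text \<open>A walk of length \<open>n\<close> in a set \<open>V\<close>, weighted by \<open>q\<close> per visited vertex, is relabelled step by
  step into a walk in \<open>W\<close>: a step to a visited vertex is copied, and the (at most) \<open>card V\<close>
  choices of a new vertex, each paying \<open>q\<close>, are outnumbered by the unvisited vertices of \<open>W\<close>.\<close>

lemma walk_sum_comparison:
  fixes G :: "'v list \<Rightarrow> bool" and G' :: "'w list \<Rightarrow> bool"
  assumes V: "finite V" and W: "finite W" and q: "0 \<le> q"
    and G: "\<And>h f. set h \<subseteq> V \<Longrightarrow> h \<noteq> [] \<Longrightarrow> inj_on f (set h) \<Longrightarrow> G' (map f h) = G h"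
    and "set h \<subseteq> V" "h \<noteq> []" "inj_on f (set h)" "f ` set h \<subseteq> W"
    and "real (card V) * q + real (length h + n) \<le> real (card W)"
  shows "walk_sum V n (\<lambda>h. of_bool (G h) * q ^ card (set h)) h \<le>
    q ^ card (set h) * walk_sum W n (\<lambda>h. of_bool (G' h)) (map f h)"
  using assms(5-)
proof (induction n arbitrary: h f)
  case 0
  thus ?case by (simp add: G)
next
  case (Suc n)
  let ?A = "\<lambda>z. walk_sum V n (\<lambda>h. of_bool (G h) * q ^ card (set h)) (z # h)"
  let ?B = "\<lambda>w. walk_sum W n (\<lambda>h. of_bool (G' h)) (w # map f h)"
  let ?c = "card (set h)" and ?W' = "W - f ` set h" and ?V' = "V - set h"
  have B0: "0 \<le> ?B w" for w by (intro walk_sum_nonneg) auto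
  have old: "?A z \<le> q ^ ?c * ?B (f z)" if "z \<in> set h" for z
    using Suc.IH[of "z # h" f] Suc.prems that by (auto simp: insert_absorb)
  have new: "?A z \<le> q ^ Suc ?c * ?B w" if "z \<in> ?V'" "w \<in> ?W'" for z w
  proof -
    have map: "map (f(z := w)) (z # h) = w # map f h" using that by auto
    have card: "card (set (z # h)) = Suc ?c" using that by simp
    have inj: "inj_on (f(z := w)) (set (z # h))"
      using Suc.prems that by (auto simp: inj_on_def)
    have ran: "f(z := w) ` set (z # h) \<subseteq> W"
      using Suc.prems that by auto
    have "?A z \<le> q ^ card (set (z # h)) *
        walk_sum W n (\<lambda>h. of_bool (G' h)) (map (f(z := w)) (z # h))"
      by (rule Suc.IH[OF _ _ inj ran]) (use Suc.prems that in auto)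
    thus ?thesis unfolding map card .
  qed
  have "card (f ` set h) \<le> length h"
    by (metis card_length length_map list.set_map)
  hence "real (card W) - real (length h) \<le> real (card ?W')"
    using W Suc.prems(4) by (subst card_Diff_subset) auto
  moreover have "real (card ?V') * q \<le> real (card V) * q"
    using V q by (intro mult_right_mono) (auto intro: card_mono)
  \<comment> \<open>The size hypothesis, read at \<open>Suc n\<close>, leaves at least one unvisited
    label; this permits the division by \<open>card ?W'\<close> below.\<close>
  ultimately have cW: "real (card ?V') * q \<le> real (card ?W')" "0 < real (card ?W')"
    using Suc.prems(5) mult_nonneg_nonneg[OF of_nat_0_le_iff q, of "card V"] by linarith+
  have "(\<Sum>z\<in>?V'. ?A z) * real (card ?W') = (\<Sum>z\<in>?V'. \<Sum>w\<in>?W'. ?A z)"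
    by (simp add: sum_distrib_right sum_distrib_left mult_ac)
  also have "\<dots> \<le> (\<Sum>z\<in>?V'. \<Sum>w\<in>?W'. q ^ Suc ?c * ?B w)"
    by (intro sum_mono new)
  also have "\<dots> = (real (card ?V') * q) * (q ^ ?c * (\<Sum>w\<in>?W'. ?B w))"
    by (simp add: sum_distrib_left mult_ac)
  also have "\<dots> \<le> real (card ?W') * (q ^ ?c * (\<Sum>w\<in>?W'. ?B w))"
    using q B0 by (intro mult_right_mono cW) (auto intro!: mult_nonneg_nonneg sum_nonneg)
  finally have new_sum: "(\<Sum>z\<in>?V'. ?A z) \<le> q ^ ?c * (\<Sum>w\<in>?W'. ?B w)"
    using cW(2) by (simp add: mult.commute)
  have "(\<Sum>z\<in>V. ?A z) = (\<Sum>z\<in>set h. ?A z) + (\<Sum>z\<in>?V'. ?A z)"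
    using Suc.prems V by (simp add: sum.subset_diff[of "set h" V])
  also have "\<dots> \<le> (\<Sum>z\<in>set h. q ^ ?c * ?B (f z)) + q ^ ?c * (\<Sum>w\<in>?W'. ?B w)"
    by (intro add_mono sum_mono old new_sum)
  also have "(\<Sum>z\<in>set h. q ^ ?c * ?B (f z)) = q ^ ?c * (\<Sum>w\<in>f ` set h. ?B w)"
    using Suc.prems by (simp add: sum.reindex sum_distrib_left)
  also have "\<dots> + q ^ ?c * (\<Sum>w\<in>?W'. ?B w) = q ^ ?c * (\<Sum>w\<in>W. ?B w)"
    using Suc.prems W by (subst sum.subset_diff[of "f ` set h" W]) (auto simp: algebra_simps)
  finally show ?case by simp
qed

section \<open>Expected weights of closed walks\<close>

text \<open>The product of an independent inclusion and fair sign. At q = 1 it is a plain fair sign,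
  so that the sparse matrix and the full comparison matrix belong to one family.\<close>

definition sparse_sign_pmf :: "real \<Rightarrow> real pmf" where
  "sparse_sign_pmf q =
     map_pmf (\<lambda>(b, c). of_bool b * (if c then 1 else - 1)) (pair_pmf (bernoulli_pmf q) (bernoulli_pmf (1 / 2)))"

lemma finite_set_sparse_sign_pmf [simp]: "finite (set_pmf (sparse_sign_pmf q))"
  by (simp add: sparse_sign_pmf_def)

lemma expectation_sparse_sign_pmf:
  assumes "0 \<le> q" "q \<le> 1"
  shows "measure_pmf.expectation (sparse_sign_pmf q) F = (1 - q) * F 0 + q * ((F 1 + F (- 1)) / 2)"
  using assms
  by (simp add: sparse_sign_pmf_def case_prod_unfold expectation_pair_pmf_finite algebra_simps)

lemma expectation_prod_Pi_pmf_finite: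
  fixes f :: "'a \<Rightarrow> 'b \<Rightarrow> real"
  assumes "finite I" "\<And>i. i \<in> I \<Longrightarrow> finite (set_pmf (p i))"
  shows "measure_pmf.expectation (Pi_pmf I d p) (\<lambda>s. \<Prod>i\<in>I. f i (s i)) =
    (\<Prod>i\<in>I. measure_pmf.expectation (p i) (f i))"
  using assms
proof (induction I rule: finite_induct)
  case (insert i I)
  have "(\<Prod>j\<in>I. f j (if j = i then y else s j)) = (\<Prod>j\<in>I. f j (s j))" for y s
    using insert.hyps by (intro prod.cong) auto
  thus ?case
    using insert by (subst expectation_Pi_pmf_insert) auto
qed simp

lemma prod_list_map_eq_prod_power_count:
  fixes s :: "'a \<Rightarrow> 'b :: comm_monoid_mult"
  assumes "finite I" "set xs \<subseteq> I"
  shows "prod_list (map s xs) = (\<Prod>i\<in>I. s i ^ count_list xs i)"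
  using assms(2)
proof (induction xs)
  case (Cons x xs)
  have "(\<Prod>i\<in>I. s i ^ count_list (x # xs) i) =
      (\<Prod>i\<in>I. (if i = x then s i else 1) * s i ^ count_list xs i)"
    by (intro prod.cong) auto
  also have "\<dots> = s x * (\<Prod>i\<in>I. s i ^ count_list xs i)"
    using Cons.prems assms(1) by (simp add: prod.distrib prod.delta)
  finally show ?case using Cons by simp
qed simp

text \<open>Odd moments of a sparse sign vanish, and every even moment of positive order equals q. A
  monomial therefore pays q once per distinct variable, whatever the multiplicities.\<close>

lemma expectation_sparse_sign_monomial:
  assumes I: "finite I" "set xs \<subseteq> I" and q: "0 \<le> q" "q \<le> 1"
  shows "measure_pmf.expectation (Pi_pmf I d (\<lambda>_. sparse_sign_pmf q)) (\<lambda>s. prod_list (map s xs)) =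
    of_bool (\<forall>x. even (count_list xs x)) * q ^ card (set xs)"
proof -
  have "measure_pmf.expectation (Pi_pmf I d (\<lambda>_. sparse_sign_pmf q)) (\<lambda>s. prod_list (map s xs)) =
      measure_pmf.expectation (Pi_pmf I d (\<lambda>_. sparse_sign_pmf q)) (\<lambda>s. \<Prod>i\<in>I. s i ^ count_list xs i)"
    using I by (simp add: prod_list_map_eq_prod_power_count)
  also have "\<dots> = (\<Prod>i\<in>I. measure_pmf.expectation (sparse_sign_pmf q) (\<lambda>y. y ^ count_list xs i))"
    using I by (subst expectation_prod_Pi_pmf_finite) auto
  also have "\<dots> = (\<Prod>i\<in>I. of_bool (even (count_list xs i)) * (if i \<in> set xs then q else 1))"
    using q by (intro prod.cong refl)
      (auto simp: expectation_sparse_sign_pmf power_0_left count_list_0_iff)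
  also have "\<dots> = (\<Prod>i\<in>I. of_bool (even (count_list xs i))) * q ^ card (set xs)"
    using I by (simp add: prod.distrib prod.If_cases Int_absorb1)
  also have "(\<Prod>i\<in>I. of_bool (even (count_list xs i))) = (of_bool (\<forall>x. even (count_list xs x)) :: real)"
  proof (cases "\<forall>x. even (count_list xs x)")
    case False
    then obtain x where "odd (count_list xs x)" by auto
    moreover from this have "x \<in> I" using I(2) by (metis count_list_0_iff even_zero subsetD)
    ultimately show ?thesis using I(1) False by auto
  qed simp
  finally show ?thesis .
qed

text \<open>Turns variables indexed by \<open>I\<close> into weights on undirected edges, zero where
  no index is attached. For the dilation \<open>I\<close> consists of matrix positions; for the full
  matrix \<open>I\<close> is the set of edges itself, labelled by \<open>id\<close>.\<close>

definition edge_fun :: "'i set \<Rightarrow> ('i \<Rightarrow> 'e) \<Rightarrow> ('i \<Rightarrow> real) \<Rightarrow> 'e \<Rightarrow> real" where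
  "edge_fun I \<epsilon> s e = (if e \<in> \<epsilon> ` I then s (inv_into I \<epsilon> e) else 0)"

lemma edge_fun_apply: "inj_on \<epsilon> I \<Longrightarrow> i \<in> I \<Longrightarrow> edge_fun I \<epsilon> s (\<epsilon> i) = s i"
  by (simp add: edge_fun_def)

lemma expectation_edge_monomial:
  assumes I: "finite I" "inj_on \<epsilon> I" and q: "0 \<le> q" "q \<le> 1"
  shows "measure_pmf.expectation (Pi_pmf I d (\<lambda>_. sparse_sign_pmf q))
      (\<lambda>s. prod_list (map (edge_fun I \<epsilon> s) es)) =
    of_bool (set es \<subseteq> \<epsilon> ` I \<and> (\<forall>e. even (count_list es e))) * q ^ card (set es)"
proof (cases "set es \<subseteq> \<epsilon> ` I")
  case True
  let ?xs = "map (inv_into I \<epsilon>) es"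
  have inj: "inj_on (inv_into I \<epsilon>) (set es)"
    using True by (intro inj_on_inv_into)
  have eq: "map (edge_fun I \<epsilon> s) es = map s ?xs" for s
    using True by (auto simp: edge_fun_def)
  have "set ?xs \<subseteq> I" using True by (auto intro: inv_into_into)
  thus ?thesis
    unfolding eq expectation_sparse_sign_monomial[OF I(1) \<open>set ?xs \<subseteq> I\<close> q]
    using True card_image[OF inj] all_even_count_list_map[OF inj] by simp
next
  case False
  then obtain e where "e \<in> set es" "e \<notin> \<epsilon> ` I" by auto
  hence "0 \<in> set (map (edge_fun I \<epsilon> s) es)" for s
    by (force simp: edge_fun_def)
  hence eq: "prod_list (map (edge_fun I \<epsilon> s) es) = 0" for s
    by (subst prod_list_zero_iff)
  show ?thesis unfolding eq using False by simp
qed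

lemma expectation_closed_walks:
  assumes I: "finite I" "inj_on \<epsilon> I" and q: "0 \<le> q" "q \<le> 1"
  shows "measure_pmf.expectation (Pi_pmf I d (\<lambda>_. sparse_sign_pmf q))
      (\<lambda>s. (mat_app V (\<lambda>x y. edge_fun I \<epsilon> s {x, y}) ^^ n) (unit_fun x) x) =
    walk_sum V n (\<lambda>h. of_bool (set (walk_edges h) \<subseteq> \<epsilon> ` I \<and> even_walk h \<and> hd h = x) *
      q ^ card (set (walk_edges h))) [x]"
proof -
  let ?p = "Pi_pmf I d (\<lambda>_. sparse_sign_pmf q)"
  have fin: "finite (set_pmf ?p)" using I by (intro finite_set_Pi_pmf) auto
  have "(mat_app V (\<lambda>x y. edge_fun I \<epsilon> s {x, y}) ^^ n) (unit_fun x) x =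
      walk_sum V n (\<lambda>h. prod_list (map (edge_fun I \<epsilon> s) (walk_edges h)) * unit_fun x (hd h)) [x]" for s
    by (simp add: funpow_mat_app_eq_walk_sum)
  thus ?thesis
    using expectation_edge_monomial[OF I q]
    by (simp add: expectation_walk_sum[OF fin] unit_fun_def even_walk_def)
       (auto intro!: arg_cong[of _ _ "\<lambda>F. walk_sum V n F [x]"])
qed

lemma expectation_trace_comparison:
  fixes \<epsilon> :: "'i \<Rightarrow> 'v set" and W :: "'w set"
  assumes I: "finite I" "inj_on \<epsilon> I" and q: "0 < q" "q \<le> 1"
    and V: "finite V" and W: "finite W" "w \<in> W"
    and card: "real (card V) * q + real n + 1 \<le> real (card W)"
  defines "J \<equiv> (\<lambda>(x, y). {x, y}) ` (W \<times> W)"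
  shows "measure_pmf.expectation (Pi_pmf I d (\<lambda>_. sparse_sign_pmf q))
      (\<lambda>s. \<Sum>x\<in>V. (mat_app V (\<lambda>x y. edge_fun I \<epsilon> s {x, y}) ^^ n) (unit_fun x) x) \<le>
    real (card V) * measure_pmf.expectation (Pi_pmf J d' (\<lambda>_. sparse_sign_pmf 1))
      (\<lambda>s. (mat_app W (\<lambda>x y. edge_fun J id s {x, y}) ^^ n) (unit_fun w) w)"
proof -
  let ?p = "Pi_pmf I d (\<lambda>_. sparse_sign_pmf q)"
  let ?G = "\<lambda>h. even_walk h \<and> hd h = last h"
  have fin: "finite (set_pmf ?p)" using I by (intro finite_set_Pi_pmf) auto
  have J: "finite J" using W by (auto simp: J_def)
  have edges_J: "set (walk_edges h) \<subseteq> J" if "set h \<subseteq> W" for h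
    using that by (induction h rule: walk_edges.induct) (auto simp: J_def)
  have target: "walk_sum W n (\<lambda>h. of_bool (?G h)) [w] \<le>
      measure_pmf.expectation (Pi_pmf J d' (\<lambda>_. sparse_sign_pmf 1))
      (\<lambda>s. (mat_app W (\<lambda>x y. edge_fun J id s {x, y}) ^^ n) (unit_fun w) w)"
    using J W edges_J
    by (subst expectation_closed_walks) (auto intro!: walk_sum_mono)
  have G: "?G (map f h) = ?G h" if "h \<noteq> []" "inj_on f (set h)" for h :: "'v list" and f :: "'v \<Rightarrow> 'w"
    using that by (auto simp: even_walk_map hd_map last_map inj_on_eq_iff)
  have bound: "measure_pmf.expectation ?p
      (\<lambda>s. (mat_app V (\<lambda>x y. edge_fun I \<epsilon> s {x, y}) ^^ n) (unit_fun x) x) \<le>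
      walk_sum W n (\<lambda>h. of_bool (?G h)) [w]" if x: "x \<in> V" for x
  proof -
    \<comment> \<open>A walk with k distinct edges visits up to k + 1 vertices. The additional
      factor q supplies the missing power and cancels at the end against
      \<open>q ^ card (set [x])\<close>.\<close>
    have "q * measure_pmf.expectation ?p
        (\<lambda>s. (mat_app V (\<lambda>x y. edge_fun I \<epsilon> s {x, y}) ^^ n) (unit_fun x) x) =
      q * walk_sum V n (\<lambda>h. of_bool (set (walk_edges h) \<subseteq> \<epsilon> ` I \<and> even_walk h \<and> hd h = x) *
      q ^ card (set (walk_edges h))) [x]"
      using q by (subst expectation_closed_walks[OF I]) auto
    also have "\<dots> = walk_sum V n (\<lambda>h. of_bool (set (walk_edges h) \<subseteq> \<epsilon> ` I \<and> even_walk h \<and> hd h = x) *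
      q ^ (card (set (walk_edges h)) + 1)) [x]" for h
    proof -
      have "q * walk_sum V n F h = walk_sum V n (\<lambda>h. q * F h) h" for F h
        by (induction n arbitrary: h) (auto simp: sum_distrib_left)
      thus ?thesis by (simp add: mult_ac)
    qed
    also have "\<dots> \<le> walk_sum V n (\<lambda>h. of_bool (?G h) * q ^ card (set h)) [x]"
    proof (rule walk_sum_mono)
      fix h' assume "last h' = last [x]"
      moreover have "q ^ (card (set (walk_edges h')) + 1) \<le> q ^ card (set h')"
        using q by (intro power_decreasing card_set_le_card_walk_edges) auto
      ultimately show "of_bool (set (walk_edges h') \<subseteq> \<epsilon> ` I \<and> even_walk h' \<and> hd h' = x) *
          q ^ (card (set (walk_edges h')) + 1) \<le> of_bool (?G h') * q ^ card (set h')"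
        using q by (cases "set (walk_edges h') \<subseteq> \<epsilon> ` I \<and> even_walk h' \<and> hd h' = x") simp_all
    qed (use x in auto)
    also have "\<dots> \<le> q ^ card (set [x]) * walk_sum W n (\<lambda>h. of_bool (?G h)) (map (\<lambda>_. w) [x])"
      using V W q x card G by (intro walk_sum_comparison) auto
    finally show ?thesis using q by simp
  qed
  have "measure_pmf.expectation ?p
      (\<lambda>s. \<Sum>x\<in>V. (mat_app V (\<lambda>x y. edge_fun I \<epsilon> s {x, y}) ^^ n) (unit_fun x) x) =
    (\<Sum>x\<in>V. measure_pmf.expectation ?p
      (\<lambda>s. (mat_app V (\<lambda>x y. edge_fun I \<epsilon> s {x, y}) ^^ n) (unit_fun x) x))"
    by (intro Bochner_Integration.integral_sum integrable_measure_pmf_finite fin)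
  also have "\<dots> \<le> (\<Sum>x\<in>V. walk_sum W n (\<lambda>h. of_bool (?G h)) [w])"
    by (intro sum_mono bound)
  also have "\<dots> \<le> real (card V) * measure_pmf.expectation (Pi_pmf J d' (\<lambda>_. sparse_sign_pmf 1))
      (\<lambda>s. (mat_app W (\<lambda>x y. edge_fun J id s {x, y}) ^^ n) (unit_fun w) w)"
    using target by (simp add: mult_left_mono)
  finally show ?thesis .
qed

section \<open>Operator norm and traces of powers of a symmetric matrix\<close>

lemma L2_set_power2: "finite V \<Longrightarrow> (L2_set v V)\<^sup>2 = (\<Sum>x\<in>V. (v x)\<^sup>2)"
  by (simp add: L2_set_def sum_nonneg)

lemma sum_mult_le_L2_set: "(\<Sum>x\<in>V. u x * v x) \<le> L2_set u V * L2_set v V"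
proof -
  have "(\<Sum>x\<in>V. u x * v x) \<le> (\<Sum>x\<in>V. \<bar>u x\<bar> * \<bar>v x\<bar>)"
    by (intro sum_mono) (metis abs_ge_self abs_mult)
  also have "\<dots> \<le> L2_set u V * L2_set v V" by (rule L2_set_mult_ineq)
  finally show ?thesis .
qed

lemma mat_app_self_adjoint:
  assumes "\<And>x y. S x y = S y x"
  shows "(\<Sum>x\<in>V. mat_app V S u x * v x) = (\<Sum>x\<in>V. u x * mat_app V S v x)"
proof -
  have "(\<Sum>x\<in>V. mat_app V S u x * v x) = (\<Sum>x\<in>V. \<Sum>y\<in>V. S x y * u y * v x)"
    by (simp add: mat_app_def sum_distrib_right)
  also have "\<dots> = (\<Sum>y\<in>V. \<Sum>x\<in>V. S x y * u y * v x)" by (rule sum.swap)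
  also have "\<dots> = (\<Sum>y\<in>V. u y * mat_app V S v y)"
    by (simp add: mat_app_def sum_distrib_left assms mult_ac)
  finally show ?thesis .
qed

lemma funpow_mat_app_self_adjoint:
  assumes "\<And>x y. S x y = S y x"
  shows "(\<Sum>x\<in>V. (mat_app V S ^^ n) u x * v x) = (\<Sum>x\<in>V. u x * (mat_app V S ^^ n) v x)"
proof (induction n arbitrary: v)
  case (Suc n)
  have "(\<Sum>x\<in>V. (mat_app V S ^^ Suc n) u x * v x) = (\<Sum>x\<in>V. (mat_app V S ^^ n) u x * mat_app V S v x)"
    by (simp add: mat_app_self_adjoint assms)
  also have "\<dots> = (\<Sum>x\<in>V. u x * (mat_app V S ^^ n) (mat_app V S v) x)"
    by (rule Suc.IH)
  also have "\<dots> = (\<Sum>x\<in>V. u x * (mat_app V S ^^ Suc n) v x)"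
    by (simp add: funpow_Suc_right del: funpow.simps(2))
  finally show ?case .
qed simp

lemma L2_set_funpow_mat_app:
  assumes "finite V" "\<And>x y. S x y = S y x"
  shows "(L2_set ((mat_app V S ^^ n) v) V)\<^sup>2 = (\<Sum>x\<in>V. v x * (mat_app V S ^^ (2 * n)) v x)"
  unfolding L2_set_power2[OF assms(1)] mult_2 funpow_add o_apply
  unfolding power2_eq_square
  by (rule funpow_mat_app_self_adjoint) (rule assms(2))

text \<open>By self-adjointness, |S^m v|^2 = <v, S^(2m) v> \<le> |v| |S^(2m) v|. Each use of
  Cauchy-Schwarz doubles the exponent, hence the powers of two.\<close>

lemma L2_set_mat_app_power_le:
  assumes "finite V" "\<And>x y. S x y = S y x"
  shows "L2_set (mat_app V S v) V ^ (2 ^ j) \<le>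
    L2_set ((mat_app V S ^^ (2 ^ j)) v) V * L2_set v V ^ (2 ^ j - 1)"
proof (induction j)
  case (Suc j)
  let ?m = "2 ^ j :: nat" and ?n = "\<lambda>v. L2_set v V"
  have "(?n ((mat_app V S ^^ ?m) v))\<^sup>2 \<le> ?n v * ?n ((mat_app V S ^^ (2 * ?m)) v)"
    unfolding L2_set_funpow_mat_app[OF assms] by (rule sum_mult_le_L2_set)
  moreover have "?n (mat_app V S v) ^ (2 * ?m) \<le> (?n ((mat_app V S ^^ ?m) v) * ?n v ^ (?m - 1))\<^sup>2"
    using Suc.IH unfolding mult.commute[of 2] power_mult by (intro power_mono) auto
  ultimately have "?n (mat_app V S v) ^ (2 * ?m) \<le>
      ?n v * ?n ((mat_app V S ^^ (2 * ?m)) v) * (?n v ^ (?m - 1))\<^sup>2"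
    by (smt (verit) mult_right_mono power_mult_distrib zero_le_power2)
  also have "\<dots> = ?n ((mat_app V S ^^ (2 * ?m)) v) * ?n v ^ (Suc (2 * (?m - 1)))"
    by (simp add: power_mult[symmetric] mult_ac)
  also have "Suc (2 * (?m - 1)) = 2 * ?m - 1"
    using zero_less_power[of "2 :: nat" j] by linarith
  finally show ?case by simp
qed simp

lemma funpow_mat_app_unit_expansion:
  assumes "finite V" "x \<in> V"
  shows "(mat_app V S ^^ n) v x = (\<Sum>y\<in>V. v y * (mat_app V S ^^ n) (unit_fun y) x)"
  using assms(2)
proof (induction n arbitrary: x)
  case 0
  have "(\<Sum>y\<in>V. v y * unit_fun y x) = (\<Sum>y\<in>V. if x = y then v y else 0)"
    by (intro sum.cong) (auto simp: unit_fun_def)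
  thus ?case using assms(1) 0 by (simp add: sum.delta)
next
  case (Suc n)
  have "(mat_app V S ^^ Suc n) v x = (\<Sum>z\<in>V. \<Sum>y\<in>V. S x z * (v y * (mat_app V S ^^ n) (unit_fun y) z))"
    by (simp add: mat_app_def[of _ _ _ x] Suc.IH sum_distrib_left)
  also have "\<dots> = (\<Sum>y\<in>V. \<Sum>z\<in>V. S x z * (v y * (mat_app V S ^^ n) (unit_fun y) z))"
    by (rule sum.swap)
  also have "\<dots> = (\<Sum>y\<in>V. v y * (mat_app V S ^^ Suc n) (unit_fun y) x)"
    by (simp add: mat_app_def[of _ _ _ x] sum_distrib_left mult_ac)
  finally show ?case .
qed

text \<open>The squared Hilbert-Schmidt norm of S^n dominates its squared operator norm, and it
  equals the trace of S^(2n) because S is symmetric.\<close>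

lemma L2_set_funpow_le_trace:
  assumes "finite V" "\<And>x y. S x y = S y x"
  shows "(L2_set ((mat_app V S ^^ n) v) V)\<^sup>2 \<le>
    (\<Sum>y\<in>V. (mat_app V S ^^ (2 * n)) (unit_fun y) y) * (L2_set v V)\<^sup>2"
proof -
  let ?P = "\<lambda>y. (mat_app V S ^^ n) (unit_fun y)"
  have "(L2_set ((mat_app V S ^^ n) v) V)\<^sup>2 = (\<Sum>x\<in>V. (\<Sum>y\<in>V. v y * ?P y x)\<^sup>2)"
    unfolding L2_set_power2[OF assms(1)]
    by (intro sum.cong refl arg_cong[where f = "\<lambda>z. z\<^sup>2"] funpow_mat_app_unit_expansion assms(1))
  also have "\<dots> \<le> (\<Sum>x\<in>V. (\<Sum>y\<in>V. (v y)\<^sup>2) * (\<Sum>y\<in>V. (?P y x)\<^sup>2))"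
    by (intro sum_mono Cauchy_Schwarz_ineq_sum)
  also have "\<dots> = (L2_set v V)\<^sup>2 * (\<Sum>x\<in>V. \<Sum>y\<in>V. (?P y x)\<^sup>2)"
    using assms(1) by (simp add: L2_set_power2 sum_distrib_left)
  also have "(\<Sum>x\<in>V. \<Sum>y\<in>V. (?P y x)\<^sup>2) = (\<Sum>y\<in>V. (L2_set (?P y) V)\<^sup>2)"
    using assms(1) by (subst sum.swap) (simp add: L2_set_power2)
  also have "\<dots> = (\<Sum>y\<in>V. \<Sum>x\<in>V. unit_fun y x * (mat_app V S ^^ (2 * n)) (unit_fun y) x)"
    unfolding L2_set_funpow_mat_app[OF assms] ..
  also have "\<dots> = (\<Sum>y\<in>V. (mat_app V S ^^ (2 * n)) (unit_fun y) y)"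
    using assms(1) by (intro sum.cong refl) (simp add: unit_fun_def)
  finally show ?thesis by (simp add: mult.commute)
qed

lemma L2_set_mat_app_le_trace:
  assumes "finite V" "\<And>x y. S x y = S y x"
  shows "L2_set (mat_app V S v) V ^ (2 ^ Suc j) \<le>
    (\<Sum>y\<in>V. (mat_app V S ^^ (2 ^ Suc j)) (unit_fun y) y) * L2_set v V ^ (2 ^ Suc j)"
proof -
  let ?m = "2 ^ j :: nat" and ?n = "\<lambda>v. L2_set v V"
  let ?tr = "\<Sum>y\<in>V. (mat_app V S ^^ (2 * ?m)) (unit_fun y) y"
  have "?n (mat_app V S v) ^ (2 * ?m) = (?n (mat_app V S v) ^ ?m)\<^sup>2"
    by (simp add: power_mult[symmetric] mult.commute)
  also have "\<dots> \<le> (?n ((mat_app V S ^^ ?m) v) * ?n v ^ (?m - 1))\<^sup>2"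
    using L2_set_mat_app_power_le[OF assms] by (intro power_mono) auto
  also have "\<dots> = (?n ((mat_app V S ^^ ?m) v))\<^sup>2 * (?n v ^ (?m - 1))\<^sup>2"
    by (simp add: power_mult_distrib)
  also have "\<dots> \<le> (?tr * (?n v)\<^sup>2) * (?n v ^ (?m - 1))\<^sup>2"
    by (intro mult_right_mono L2_set_funpow_le_trace assms) auto
  also have "(?tr * (?n v)\<^sup>2) * (?n v ^ (?m - 1))\<^sup>2 = ?tr * (?n v * ?n v ^ (?m - 1))\<^sup>2"
    by (simp add: power_mult_distrib)
  also have "?n v * ?n v ^ (?m - 1) = ?n v ^ ?m"
    using power_minus_mult[of ?m "?n v"] by (simp add: mult.commute)
  also have "(?n v ^ ?m)\<^sup>2 = ?n v ^ (2 * ?m)"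
    by (simp add: power_mult[symmetric] mult.commute)
  finally show ?thesis by simp
qed

lemma trace_even_power_nonneg:
  assumes "finite V" "\<And>x y. S x y = S y x"
  shows "0 \<le> (\<Sum>y\<in>V. (mat_app V S ^^ (2 * n)) (unit_fun y) y)"
proof (intro sum_nonneg)
  fix y assume "y \<in> V"
  hence "(mat_app V S ^^ (2 * n)) (unit_fun y) y = (\<Sum>x\<in>V. unit_fun y x * (mat_app V S ^^ (2 * n)) (unit_fun y) x)"
    using assms(1) by (simp add: unit_fun_def)
  also have "\<dots> = (L2_set ((mat_app V S ^^ n) (unit_fun y)) V)\<^sup>2"
    by (rule L2_set_funpow_mat_app[OF assms, symmetric])
  finally show "0 \<le> (mat_app V S ^^ (2 * n)) (unit_fun y) y" by simp
qed

lemma funpow_mat_app_diag_le: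
  assumes V: "finite V" "w \<in> V" and b: "\<And>v. L2_set (mat_app V S v) V \<le> b * L2_set v V" "0 \<le> b"
  shows "(mat_app V S ^^ n) (unit_fun w) w \<le> b ^ n"
proof -
  have "L2_set ((mat_app V S ^^ n) (unit_fun w)) V \<le> b ^ n"
  proof (induction n)
    case 0
    have "L2_set (unit_fun w) V = 1"
      using V by (simp add: L2_set_def unit_fun_def if_distrib power2_eq_square cong: if_cong)
    thus ?case by simp
  next
    case (Suc n)
    have "L2_set ((mat_app V S ^^ Suc n) (unit_fun w)) V \<le> b * L2_set ((mat_app V S ^^ n) (unit_fun w)) V"
      using b(1) by simp
    also have "\<dots> \<le> b * b ^ n" using Suc b(2) by (rule mult_left_mono)
    finally show ?case by simp
  qed
  moreover have "\<bar>(mat_app V S ^^ n) (unit_fun w) w\<bar> \<le> L2_set ((mat_app V S ^^ n) (unit_fun w)) V"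
    using V member_le_L2_set[of V w "\<lambda>x. \<bar>(mat_app V S ^^ n) (unit_fun w) x\<bar>"]
    by (simp add: L2_set_def)
  ultimately show ?thesis by linarith
qed

section \<open>Moments of full random sign matrices\<close>

definition bilin :: "'v set \<Rightarrow> ('v \<Rightarrow> 'v \<Rightarrow> real) \<Rightarrow> ('v \<Rightarrow> real) \<Rightarrow> ('v \<Rightarrow> real) \<Rightarrow> real" where
  "bilin V Y u v = (\<Sum>x\<in>V. \<Sum>y\<in>V. Y x y * (u x * v y))"

text \<open>Integer coordinates of the points of the unit ball in a lattice of mesh 1 / (4 sqrt r).
  With this mesh, rounding all r coordinates costs at most 1/4 in Euclidean norm, while the number
  of points is still only exponential in r. The box for the single coordinates makes finiteness
  evident.\<close>

definition grid :: "nat \<Rightarrow> (nat \<Rightarrow> int) set" where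
  "grid r = {k \<in> {..<r} \<rightarrow>\<^sub>E {- int (16 * r)..int (16 * r)}. (\<Sum>i<r. (k i)\<^sup>2) \<le> 16 * int r}"

definition grid_point :: "nat \<Rightarrow> (nat \<Rightarrow> int) \<Rightarrow> nat \<Rightarrow> real" where
  "grid_point r k i = real_of_int (k i) / (4 * sqrt (real r))"

lemma finite_grid: "finite (grid r)"
  unfolding grid_def
  by (intro finite_subset[OF _ finite_PiE[of "{..<r}" "\<lambda>_. {- int (16 * r)..int (16 * r)}"]]) auto

lemma abs_le_power2_int: "\<bar>k\<bar> \<le> k\<^sup>2" for k :: int
proof (cases "k = 0")
  case False
  hence "\<bar>k\<bar> * 1 \<le> \<bar>k\<bar> * \<bar>k\<bar>" by (intro mult_left_mono) auto
  thus ?thesis by (simp add: power2_eq_square)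
qed simp

lemma sum_half_power_abs_le: "(\<Sum>j\<in>{- int m..int m}. (1 / 2 :: real) ^ nat \<bar>j\<bar>) = 3 - 2 * (1 / 2) ^ m"
proof (induction m)
  case (Suc m)
  have "{- int (Suc m)..int (Suc m)} = insert (int (Suc m)) (insert (- int (Suc m)) {- int m..int m})"
    by auto
  hence "(\<Sum>j\<in>{- int (Suc m)..int (Suc m)}. (1 / 2 :: real) ^ nat \<bar>j\<bar>) =
      (1 / 2) ^ Suc m + ((1 / 2) ^ Suc m + (3 - 2 * (1 / 2) ^ m))"
    using Suc by (simp add: nat_add_distrib)
  thus ?case by simp
qed simp

text \<open>Weighting each grid point by \<open>2 ^ (16 r - \<Sum>|k i|) \<ge> 1\<close> makes the count factorize.\<close>

lemma card_grid_le: "real (card (grid r)) \<le> (3 * 2 ^ 16) ^ r"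
proof -
  let ?I = "{- int (16 * r)..int (16 * r)}"
  have "1 \<le> 2 ^ (16 * r) * (\<Prod>i<r. (1 / 2 :: real) ^ nat \<bar>k i\<bar>)" if "k \<in> grid r" for k
  proof -
    have "int (\<Sum>i<r. nat \<bar>k i\<bar>) \<le> (\<Sum>i<r. (k i)\<^sup>2)"
      by (simp add: sum_mono abs_le_power2_int)
    also have "\<dots> \<le> int (16 * r)" using that by (simp add: grid_def)
    finally have "(\<Sum>i<r. nat \<bar>k i\<bar>) \<le> 16 * r" by (simp only: of_nat_le_iff)
    hence "(1 / 2 :: real) ^ (16 * r) \<le> (1 / 2) ^ (\<Sum>i<r. nat \<bar>k i\<bar>)"
      by (intro power_decreasing) auto
    hence "2 ^ (16 * r) * (1 / 2 :: real) ^ (16 * r) \<le> 2 ^ (16 * r) * (1 / 2) ^ (\<Sum>i<r. nat \<bar>k i\<bar>)"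
      by (intro mult_left_mono) auto
    thus ?thesis by (simp only: power_sum power_mult_distrib[symmetric]) simp
  qed
  hence "real (card (grid r)) \<le> (\<Sum>k\<in>grid r. 2 ^ (16 * r) * (\<Prod>i<r. (1 / 2 :: real) ^ nat \<bar>k i\<bar>))"
    using sum_mono[of "grid r" "\<lambda>_. 1 :: real"] by simp
  also have "\<dots> \<le> (\<Sum>k\<in>{..<r} \<rightarrow>\<^sub>E ?I. 2 ^ (16 * r) * (\<Prod>i<r. (1 / 2 :: real) ^ nat \<bar>k i\<bar>))"
  proof (rule sum_mono2)
    show "finite ({..<r} \<rightarrow>\<^sub>E ?I)" by (intro finite_PiE) auto
    show "grid r \<subseteq> {..<r} \<rightarrow>\<^sub>E ?I" unfolding grid_def by (rule Collect_restrict)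
  qed (simp add: prod_nonneg)
  also have "\<dots> = 2 ^ (16 * r) * (\<Prod>i<r. \<Sum>j\<in>?I. (1 / 2 :: real) ^ nat \<bar>j\<bar>)"
    by (simp only: prod_sum_PiE finite_lessThan finite_atLeastAtMost_int sum_distrib_left)
  also have "\<dots> \<le> 2 ^ (16 * r) * (\<Prod>i<r. 3)"
    unfolding sum_half_power_abs_le
    by (intro mult_left_mono prod_mono) (auto intro: order.trans[OF mult_left_mono[OF power_le_one]])
  also have "\<dots> = (3 * 2 ^ 16) ^ r"
    by (simp add: power_mult flip: power_mult_distrib)
  finally show ?thesis .
qed

text \<open>Rounding goes towards zero, so that a rounded vector is no longer than the original and
  stays in the unit ball.\<close>

lemma ex_int_near: "\<exists>k :: int. \<bar>real_of_int k\<bar> \<le> \<bar>t\<bar> \<and> \<bar>t - real_of_int k\<bar> \<le> 1"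
proof (cases "0 \<le> t")
  case True
  thus ?thesis by (intro exI[of _ "\<lfloor>t\<rfloor>"]) (auto, linarith+)
next
  case False
  thus ?thesis by (intro exI[of _ "\<lceil>t\<rceil>"]) (auto, linarith+)
qed

lemma grid_approx:
  assumes r: "0 < r" and u: "L2_set u {..<r} \<le> 1"
  obtains k where "k \<in> grid r" "L2_set (grid_point r k) {..<r} \<le> 1"
    "L2_set (\<lambda>i. u i - grid_point r k i) {..<r} \<le> 1 / 4"
proof -
  let ?c = "4 * sqrt (real r)"
  have c: "0 < ?c" "?c\<^sup>2 = 16 * real r" using r by (auto simp: power_mult_distrib)
  obtain kk where kk: "\<And>i. \<bar>real_of_int (kk i)\<bar> \<le> \<bar>?c * u i\<bar> \<and> \<bar>?c * u i - real_of_int (kk i)\<bar> \<le> 1"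
    using ex_int_near[of "?c * u i" for i] by metis
  define k where "k = restrict kk {..<r}"
  have su: "(\<Sum>i<r. (u i)\<^sup>2) \<le> 1"
    using power_mono[OF u, of 2] by (simp add: L2_set_power2)
  have "real_of_int (\<Sum>i<r. (k i)\<^sup>2) \<le> (\<Sum>i<r. (?c * u i)\<^sup>2)"
    using kk by (auto simp: k_def intro!: sum_mono abs_le_square_iff[THEN iffD1])
  also have "\<dots> = ?c\<^sup>2 * (\<Sum>i<r. (u i)\<^sup>2)"
    by (simp only: power_mult_distrib sum_distrib_left)
  finally have sk: "real_of_int (\<Sum>i<r. (k i)\<^sup>2) \<le> ?c\<^sup>2 * (\<Sum>i<r. (u i)\<^sup>2)" .
  also have "\<dots> \<le> ?c\<^sup>2 * 1" by (intro mult_left_mono su) auto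
  finally have sk16: "(\<Sum>i<r. (k i)\<^sup>2) \<le> 16 * int r" using c(2) by linarith
  have "k i \<in> {- int (16 * r)..int (16 * r)}" if "i < r" for i
  proof -
    have "\<bar>k i\<bar> \<le> (k i)\<^sup>2" by (rule abs_le_power2_int)
    also have "(k i)\<^sup>2 \<le> (\<Sum>i<r. (k i)\<^sup>2)" using that by (intro member_le_sum) auto
    finally show ?thesis using sk16 by auto
  qed
  hence 1: "k \<in> grid r" using sk16 by (auto simp: grid_def k_def)
  have "(L2_set (grid_point r k) {..<r})\<^sup>2 = real_of_int (\<Sum>i<r. (k i)\<^sup>2) / ?c\<^sup>2"
    by (simp add: L2_set_power2 grid_point_def power_divide sum_divide_distrib)
  also have "\<dots> \<le> 1"
  proof -
    have "real_of_int (\<Sum>i<r. (k i)\<^sup>2) \<le> ?c\<^sup>2" using sk16 unfolding c(2) by linarith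
    thus ?thesis using c(1) by (simp only: divide_le_eq_1_pos zero_less_power)
  qed
  finally have 2: "L2_set (grid_point r k) {..<r} \<le> 1"
    by (rule power2_le_imp_le[of _ 1, simplified])
  have "(L2_set (\<lambda>i. u i - grid_point r k i) {..<r})\<^sup>2 = (\<Sum>i<r. ((?c * u i - real_of_int (kk i)) / ?c)\<^sup>2)"
    using c(1) by (auto simp: L2_set_power2 grid_point_def k_def diff_divide_distrib intro!: sum.cong)
  also have "\<dots> = (\<Sum>i<r. (?c * u i - real_of_int (kk i))\<^sup>2) / ?c\<^sup>2"
    by (simp only: power_divide sum_divide_distrib)
  also have "\<dots> \<le> (\<Sum>i<r. 1) / ?c\<^sup>2"
    using kk by (intro divide_right_mono sum_mono) (auto simp: abs_square_le_1)
  also have "\<dots> = (1 / 4)\<^sup>2" unfolding c(2) using r by (simp add: power2_eq_square)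
  finally have 3: "L2_set (\<lambda>i. u i - grid_point r k i) {..<r} \<le> 1 / 4"
    by (rule power2_le_imp_le) simp
  show ?thesis using that 1 2 3 by blast
qed

lemma bilin_diff_left: "bilin V Y (\<lambda>x. u x - u' x) v = bilin V Y u v - bilin V Y u' v"
  by (simp add: bilin_def algebra_simps sum_subtractf)

lemma bilin_diff_right: "bilin V Y u (\<lambda>x. v x - v' x) = bilin V Y u v - bilin V Y u v'"
  by (simp add: bilin_def algebra_simps sum_subtractf)

lemma bilin_scale: "bilin V Y (\<lambda>x. a * u x) (\<lambda>x. b * v x) = a * b * bilin V Y u v"
  by (simp add: bilin_def sum_distrib_left mult_ac)

lemma L2_set_scale: "L2_set (\<lambda>x. a * v x) V = \<bar>a\<bar> * L2_set v V"
proof -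
  have "L2_set (\<lambda>x. a * v x) V = L2_set (\<lambda>x. \<bar>a\<bar> * v x) V"
    by (simp add: L2_set_def power_mult_distrib)
  thus ?thesis by (simp add: L2_set_right_distrib)
qed

text \<open>If c bounds the form on the unit ball, approximating both arguments within 1/4 yields
  the bound M + c/4 + c/4. Iterating this from the crude bound \<open>c0\<close> halves the distance
  to the fixed point 2 M each time; the limit stands in for a supremum over the ball.\<close>

lemma bilin_le_grid:
  assumes r: "0 < r"
    and M: "\<And>k l. k \<in> grid r \<Longrightarrow> l \<in> grid r \<Longrightarrow> bilin {..<r} Y (grid_point r k) (grid_point r l) \<le> M"
    and u: "L2_set u {..<r} \<le> 1" and v: "L2_set v {..<r} \<le> 1"
  shows "bilin {..<r} Y u v \<le> 2 * M"
proof -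
  let ?B = "bilin {..<r} Y"
  define c0 where "c0 = (\<Sum>x<r. \<Sum>y<r. \<bar>Y x y\<bar>)"
  have iter: "?B u v \<le> 2 * M + (c0 - 2 * M) / 2 ^ n"
    if "L2_set u {..<r} \<le> 1" "L2_set v {..<r} \<le> 1" for n u v
    using that
  proof (induction n arbitrary: u v)
    case 0
    have le1: "\<bar>w x\<bar> \<le> 1" if "L2_set w {..<r} \<le> 1" "x < r" for w x
    proof -
      have "\<bar>w x\<bar> \<le> L2_set (\<lambda>x. \<bar>w x\<bar>) {..<r}" using that by (intro member_le_L2_set) auto
      also have "\<dots> = L2_set w {..<r}" by (simp add: L2_set_def)
      finally show ?thesis using that by simp
    qed
    have "?B u v \<le> (\<Sum>x<r. \<Sum>y<r. \<bar>Y x y\<bar>)"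
      unfolding bilin_def
    proof (intro sum_mono)
      fix x y assume xy: "x \<in> {..<r}" "y \<in> {..<r}"
      have "Y x y * (u x * v y) \<le> \<bar>Y x y\<bar> * (\<bar>u x\<bar> * \<bar>v y\<bar>)"
        by (metis abs_ge_self abs_mult)
      also have "\<dots> \<le> \<bar>Y x y\<bar> * (1 * 1)"
        using xy le1[OF 0(1)] le1[OF 0(2)] by (intro mult_left_mono mult_mono) auto
      finally show "Y x y * (u x * v y) \<le> \<bar>Y x y\<bar>" by simp
    qed
    thus ?case by (simp add: c0_def)
  next
    case (Suc n)
    let ?c = "2 * M + (c0 - 2 * M) / 2 ^ n"
    obtain k where k: "k \<in> grid r" "L2_set (grid_point r k) {..<r} \<le> 1"
      "L2_set (\<lambda>i. u i - grid_point r k i) {..<r} \<le> 1 / 4"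
      using grid_approx[OF r Suc.prems(1)] by blast
    obtain l where l: "l \<in> grid r" "L2_set (grid_point r l) {..<r} \<le> 1"
      "L2_set (\<lambda>i. v i - grid_point r l i) {..<r} \<le> 1 / 4"
      using grid_approx[OF r Suc.prems(2)] by blast
    have "L2_set (\<lambda>i. 4 * (u i - grid_point r k i)) {..<r} \<le> 1"
      using k(3) unfolding L2_set_scale by simp
    hence "?B (\<lambda>i. 4 * (u i - grid_point r k i)) (\<lambda>i. 1 * v i) \<le> ?c"
      by (rule Suc.IH) (simp add: Suc.prems)
    hence 1: "4 * (?B u v - ?B (grid_point r k) v) \<le> ?c"
      unfolding bilin_scale by (simp add: bilin_diff_left)
    have "L2_set (\<lambda>i. 4 * (v i - grid_point r l i)) {..<r} \<le> 1"
      using l(3) unfolding L2_set_scale by simp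
    hence "?B (\<lambda>i. 1 * grid_point r k i) (\<lambda>i. 4 * (v i - grid_point r l i)) \<le> ?c"
      by (rule Suc.IH[rotated]) (simp add: k(2))
    hence 2: "4 * (?B (grid_point r k) v - ?B (grid_point r k) (grid_point r l)) \<le> ?c"
      unfolding bilin_scale by (simp add: bilin_diff_right)
    have quarter: "x \<le> g + c / 4" if "4 * (x - g) \<le> c" for x g c :: real
      using that by simp
    have "x \<le> M + c / 2" if "4 * (x - g) \<le> c" "4 * (g - h) \<le> c" "h \<le> M" for x g h c :: real
      using quarter[OF that(1)] quarter[OF that(2)] that(3) by simp
    hence "?B u v \<le> M + ?c / 2"
      using 1 2 M[OF k(1) l(1)] by blast
    also have "\<dots> = 2 * M + (c0 - 2 * M) / 2 ^ Suc n" by (simp add: field_simps)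
    finally show ?case .
  qed
  have "(\<lambda>n. 2 * M + (c0 - 2 * M) * (1 / 2) ^ n) \<longlonglongrightarrow> 2 * M + (c0 - 2 * M) * 0"
    by (intro tendsto_intros LIMSEQ_power_zero) auto
  thus ?thesis
    using iter[OF u v] by (intro tendsto_lowerbound[of _ "2 * M" sequentially])
      (auto simp: power_divide)
qed

text \<open>The form is evaluated at v and at its image Y v, both normalized. If only the image
  vanishes, 0 \<le> M is still required; the form at the zero vectors provides it.\<close>

lemma L2_set_mat_app_le_grid:
  assumes r: "0 < r"
    and M: "\<And>k l. k \<in> grid r \<Longrightarrow> l \<in> grid r \<Longrightarrow> bilin {..<r} Y (grid_point r k) (grid_point r l) \<le> M"
  shows "L2_set (mat_app {..<r} Y v) {..<r} \<le> 2 * M * L2_set v {..<r}"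
proof -
  let ?n = "\<lambda>v. L2_set v {..<r}" let ?w = "mat_app {..<r} Y v"
  have "bilin {..<r} Y u v = (\<Sum>x<r. u x * ?w x)" for u
    by (simp add: bilin_def mat_app_def sum_distrib_left mult_ac)
  hence w2: "bilin {..<r} Y ?w v = (?n ?w)\<^sup>2"
    by (simp add: L2_set_power2) (simp add: power2_eq_square)
  consider "?n v = 0" | "?n ?w = 0" "?n v > 0" | "?n v > 0" "?n ?w > 0"
    using L2_set_nonneg[of v "{..<r}"] L2_set_nonneg[of ?w "{..<r}"] by linarith
  thus ?thesis
  proof cases
    case 1
    hence "?w = (\<lambda>_. 0)" by (auto simp: L2_set_eq_0_iff mat_app_def fun_eq_iff)
    thus ?thesis using 1 by (simp add: L2_set_def)
  next
    case 2
    have "0 \<le> 2 * M" using bilin_le_grid[OF r M, of "\<lambda>_. 0" "\<lambda>_. 0"]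
      by (simp add: L2_set_def bilin_def)
    thus ?thesis using 2 by simp
  next
    case 3
    have "bilin {..<r} Y (\<lambda>x. (1 / ?n ?w) * ?w x) (\<lambda>x. (1 / ?n v) * v x) \<le> 2 * M"
      by (rule bilin_le_grid[OF r M]) (unfold L2_set_scale, use 3 in auto)
    thus ?thesis using 3 unfolding bilin_scale w2 by (simp add: field_simps power2_eq_square)
  qed
qed

section \<open>Moments of bilinear forms in random signs\<close>

text \<open>The inequality inside Hoeffding's lemma, for the fair two-point law on -x and x;
  evenness in x reduces to 0 \<le> x.\<close>

lemma cosh_le_exp_half_square: "(exp x + exp (- x)) / 2 \<le> exp (x\<^sup>2 / 2)" for x :: real
proof -
  have main: "(exp x + exp (- x)) / 2 \<le> exp (x\<^sup>2 / 2)" if "0 \<le> x" for x :: real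
  proof -
    have "- x + ln (1 + 1 / 2 * (exp (2 * x) - 1)) \<le> x\<^sup>2 / 2"
      using Hoeffdings_lemma_aux[of "2 * x" "1 / 2"] that by (simp add: power_mult_distrib)
    hence "exp (- x + ln (1 + 1 / 2 * (exp (2 * x) - 1))) \<le> exp (x\<^sup>2 / 2)" by simp
    moreover have "0 < 1 + 1 / 2 * (exp (2 * x) - 1)" by (simp add: add_pos_pos field_simps)
    ultimately have "exp (- x) * (1 + 1 / 2 * (exp (2 * x) - 1)) \<le> exp (x\<^sup>2 / 2)"
      by (simp only: exp_add exp_ln)
    thus ?thesis by (simp add: algebra_simps mult_exp_exp)
  qed
  show ?thesis using main[of x] main[of "- x"] by (cases "0 \<le> x") (auto simp: add.commute)
qed

lemma power_le_fact_exp: "t ^ (2 * n) \<le> fact (2 * n) * (exp t + exp (- t))" for t :: real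
proof -
  have main: "t ^ m \<le> fact m * exp t" if "0 \<le> t" for t :: real and m
  proof -
    have "(\<Sum>k\<in>{m}. t ^ k /\<^sub>R fact k) \<le> (\<Sum>k. t ^ k /\<^sub>R fact k)"
      using that sums_summable[OF exp_converges[of t]] by (intro sum_le_suminf) auto
    also have "\<dots> = exp t" using exp_converges[of t] by (rule sums_unique[symmetric])
    finally show ?thesis by (simp add: field_simps)
  qed
  have "t ^ (2 * n) = \<bar>t\<bar> ^ (2 * n)" by (simp add: power_mult)
  also have "\<dots> \<le> fact (2 * n) * exp \<bar>t\<bar>" by (intro main) auto
  also have "exp \<bar>t\<bar> \<le> exp t + exp (- t)" by (simp add: abs_if)
  finally show ?thesis by (simp add: mult_left_mono)
qed

text \<open>An off-diagonal edge {x, y} carries u x v y + u y v x, since the matrix is symmetric; a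
  loop carries a single product. So each coefficient \<open>c e\<close> has at most two summands,
  and the 2 lost to Cauchy-Schwarz cancels the 1/2 in the exponent of the cosh bound.\<close>

lemma expectation_exp_bilin_le:
  fixes u v :: "'w \<Rightarrow> real"
  assumes W: "finite W"
  defines "J \<equiv> (\<lambda>(x, y). {x, y}) ` (W \<times> W)"
  shows "measure_pmf.expectation (Pi_pmf J d (\<lambda>_. sparse_sign_pmf 1))
      (\<lambda>s. exp (bilin W (\<lambda>x y. edge_fun J id s {x, y}) u v)) \<le>
    exp ((\<Sum>x\<in>W. (u x)\<^sup>2) * (\<Sum>x\<in>W. (v x)\<^sup>2))"
proof -
  let ?ed = "\<lambda>(x, y). {x, y} :: 'w set" and ?h = "\<lambda>(x, y). u x * v y"
  let ?F = "\<lambda>e. {z \<in> W \<times> W. ?ed z = e}"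
  define c where "c e = (\<Sum>z\<in>?F e. ?h z)" for e
  have WW: "finite (W \<times> W)" and J: "finite J" using W by (auto simp: J_def)
  have J': "?ed ` (W \<times> W) \<subseteq> J" by (simp add: J_def)
  have bilin: "bilin W (\<lambda>x y. edge_fun J id s {x, y}) u v = (\<Sum>e\<in>J. s e * c e)" for s
  proof -
    have "edge_fun J id s {x, y} = s {x, y}" if "x \<in> W" "y \<in> W" for x y
      using that edge_fun_apply[of id J "{x, y}" s] by (force simp: J_def)
    hence "bilin W (\<lambda>x y. edge_fun J id s {x, y}) u v = (\<Sum>z\<in>W \<times> W. s (?ed z) * ?h z)"
      unfolding bilin_def sum.cartesian_product by (intro sum.cong) auto
    also have "\<dots> = (\<Sum>e\<in>J. \<Sum>z\<in>?F e. s (?ed z) * ?h z)"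
      by (rule sum.group[OF WW J J', symmetric])
    also have "\<dots> = (\<Sum>e\<in>J. s e * c e)"
      by (intro sum.cong refl) (auto simp: c_def sum_distrib_left intro!: sum.cong)
    finally show ?thesis .
  qed
  have "(c e)\<^sup>2 \<le> 2 * (\<Sum>z\<in>?F e. (?h z)\<^sup>2)" for e
  proof (cases "?F e = {}")
    case True
    show ?thesis unfolding c_def True by simp
  next
    case False
    then obtain z where "?ed z = e" by blast
    hence e: "e = {fst z, snd z}" by (simp add: case_prod_unfold)
    have "?F e \<subseteq> {(fst z, snd z), (snd z, fst z)}"
    proof
      fix z' assume "z' \<in> ?F e"
      hence "{fst z', snd z'} = {fst z, snd z}" unfolding e by (simp add: case_prod_unfold)
      thus "z' \<in> {(fst z, snd z), (snd z, fst z)}"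
        by (cases z'; cases z) (simp add: doubleton_eq_iff)
    qed
    hence "card (?F e) \<le> card {(fst z, snd z), (snd z, fst z)}" by (intro card_mono) auto
    also have "\<dots> \<le> 2" by (simp add: card_insert_if)
    finally have card: "real (card (?F e)) \<le> 2" by simp
    have "(c e)\<^sup>2 \<le> real (card (?F e)) * (\<Sum>z\<in>?F e. (?h z)\<^sup>2)"
      using Cauchy_Schwarz_ineq_sum[of "\<lambda>_. 1" ?h "?F e"] by (simp add: c_def)
    also have "\<dots> \<le> 2 * (\<Sum>z\<in>?F e. (?h z)\<^sup>2)"
      by (intro mult_right_mono card sum_nonneg) auto
    finally show ?thesis .
  qed
  hence "(\<Sum>e\<in>J. (c e)\<^sup>2 / 2) \<le> (\<Sum>e\<in>J. \<Sum>z\<in>?F e. (?h z)\<^sup>2)"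
    by (intro sum_mono) (simp add: mult.commute)
  also have "\<dots> = (\<Sum>z\<in>W \<times> W. (?h z)\<^sup>2)" by (rule sum.group[OF WW J J'])
  also have "\<dots> = (\<Sum>x\<in>W. (u x)\<^sup>2) * (\<Sum>x\<in>W. (v x)\<^sup>2)"
    by (simp add: sum_product sum.cartesian_product power_mult_distrib case_prod_unfold)
  finally have sum: "(\<Sum>e\<in>J. (c e)\<^sup>2 / 2) \<le> (\<Sum>x\<in>W. (u x)\<^sup>2) * (\<Sum>x\<in>W. (v x)\<^sup>2)" .
  have "measure_pmf.expectation (Pi_pmf J d (\<lambda>_. sparse_sign_pmf 1))
      (\<lambda>s. exp (bilin W (\<lambda>x y. edge_fun J id s {x, y}) u v)) =
    measure_pmf.expectation (Pi_pmf J d (\<lambda>_. sparse_sign_pmf 1)) (\<lambda>s. \<Prod>e\<in>J. exp (s e * c e))"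
    unfolding bilin using J by (simp add: exp_sum)
  also have "\<dots> = (\<Prod>e\<in>J. (exp (c e) + exp (- c e)) / 2)"
    using J by (subst expectation_prod_Pi_pmf_finite) (auto simp: expectation_sparse_sign_pmf)
  also have "\<dots> \<le> (\<Prod>e\<in>J. exp ((c e)\<^sup>2 / 2))"
    by (intro prod_mono conjI cosh_le_exp_half_square) (simp add: add_nonneg_nonneg)
  also have "\<dots> = exp (\<Sum>e\<in>J. (c e)\<^sup>2 / 2)" using J by (simp add: exp_sum)
  also have "\<dots> \<le> exp ((\<Sum>x\<in>W. (u x)\<^sup>2) * (\<Sum>x\<in>W. (v x)\<^sup>2))" using sum by simp
  finally show ?thesis .
qed

text \<open>The exponential moments at sqrt r and - sqrt r, both at most e^r, control the moment of
  order 2r through one Taylor term. With (2r)! \<le> (2r)^(2r) and e \<le> 3 this reads r^r E B^(2r)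
  \<le> 2 (4 r^2)^r 3^r, whence the constant 12.\<close>

lemma expectation_bilin_moment_le:
  fixes u v :: "'w \<Rightarrow> real"
  assumes W: "finite W" and r: "0 < r"
    and u: "(\<Sum>x\<in>W. (u x)\<^sup>2) \<le> 1" and v: "(\<Sum>x\<in>W. (v x)\<^sup>2) \<le> 1"
  defines "J \<equiv> (\<lambda>(x, y). {x, y}) ` (W \<times> W)"
  shows "measure_pmf.expectation (Pi_pmf J d (\<lambda>_. sparse_sign_pmf 1))
      (\<lambda>s. bilin W (\<lambda>x y. edge_fun J id s {x, y}) u v ^ (2 * r)) \<le> 2 * (12 * real r) ^ r"
proof -
  let ?p = "Pi_pmf J d (\<lambda>_. sparse_sign_pmf 1)"
  let ?B = "\<lambda>s. bilin W (\<lambda>x y. edge_fun J id s {x, y}) u v"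
  let ?l = "sqrt (real r)"
  have fin: "finite (set_pmf ?p)" using W by (intro finite_set_Pi_pmf) (auto simp: J_def)
  note int = integrable_measure_pmf_finite[OF fin, where 'b = real]
  have mgf_le: "measure_pmf.expectation ?p (\<lambda>s. exp (a * ?B s)) \<le> exp (real r)" if "a\<^sup>2 = real r" for a
  proof -
    have "a * ?B s = bilin W (\<lambda>x y. edge_fun J id s {x, y}) (\<lambda>x. a * u x) v" for s
      using bilin_scale[of W _ a u 1 v] by simp
    hence "measure_pmf.expectation ?p (\<lambda>s. exp (a * ?B s)) \<le>
        exp ((\<Sum>x\<in>W. (a * u x)\<^sup>2) * (\<Sum>x\<in>W. (v x)\<^sup>2))"
      using expectation_exp_bilin_le[OF W, where u = "\<lambda>x. a * u x" and v = v and d = d]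
      unfolding J_def by simp
    also have "\<dots> \<le> exp (real r * (1 * 1))"
    proof -
      have "(\<Sum>x\<in>W. (a * u x)\<^sup>2) * (\<Sum>x\<in>W. (v x)\<^sup>2) =
          real r * ((\<Sum>x\<in>W. (u x)\<^sup>2) * (\<Sum>x\<in>W. (v x)\<^sup>2))"
        by (simp add: power_mult_distrib sum_distrib_left[symmetric] that)
      also have "\<dots> \<le> real r * (1 * 1)"
        using u v by (intro mult_left_mono mult_mono) (auto intro: sum_nonneg)
      finally show ?thesis by simp
    qed
    finally show ?thesis by simp
  qed
  have "real r ^ r * measure_pmf.expectation ?p (\<lambda>s. ?B s ^ (2 * r)) =
      measure_pmf.expectation ?p (\<lambda>s. (?l * ?B s) ^ (2 * r))"
    using r by (simp add: power_mult_distrib power_mult)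
  also have "\<dots> \<le> measure_pmf.expectation ?p
      (\<lambda>s. fact (2 * r) * (exp (?l * ?B s) + exp (- ?l * ?B s)))"
    using power_le_fact_exp by (intro expectation_mono_finite[OF fin]) simp
  also have "\<dots> = fact (2 * r) * (measure_pmf.expectation ?p (\<lambda>s. exp (?l * ?B s)) +
      measure_pmf.expectation ?p (\<lambda>s. exp (- ?l * ?B s)))"
    by (simp add: int)
  also have "\<dots> \<le> fact (2 * r) * (exp (real r) + exp (real r))"
    by (intro mult_left_mono add_mono mgf_le) auto
  also have "\<dots> \<le> real ((2 * r) ^ (2 * r)) * (2 * 3 ^ r)"
  proof (intro mult_mono)
    show "fact (2 * r) \<le> real ((2 * r) ^ (2 * r))" by (rule fact_le_power)
    have "exp (real r) = exp 1 ^ r" by (simp add: exp_of_nat_mult[symmetric])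
    also have "\<dots> \<le> 3 ^ r" using exp_le by (intro power_mono) auto
    finally show "exp (real r) + exp (real r) \<le> 2 * 3 ^ r" by simp
  qed auto
  also have "\<dots> = real r ^ r * (2 * (12 * real r) ^ r)"
  proof -
    have "real ((2 * r) ^ (2 * r)) = (2 * real r) ^ (2 * r)" by simp
    also have "\<dots> = ((2 * real r)\<^sup>2) ^ r" by (rule power_mult)
    also have "(2 * real r)\<^sup>2 = real r * (4 * real r)" by (simp add: power2_eq_square)
    finally have "real ((2 * r) ^ (2 * r)) * (2 * 3 ^ r) = 2 * ((real r * (4 * real r)) ^ r * 3 ^ r)"
      by simp
    also have "\<dots> = real r ^ r * (2 * ((4 * real r) ^ r * 3 ^ r))" by (simp only: power_mult_distrib mult_ac)
    also have "(4 * real r) ^ r * 3 ^ r = (12 * real r) ^ r"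
      by (subst power_mult_distrib[symmetric]) simp
    finally show ?thesis .
  qed
  finally show ?thesis using r by simp
qed

text \<open>This is 4 times (3 * 2 ^ 16) ^ 2 times 12: the square of the factor 2 lost to the net,
  the number of pairs of grid points per dimension, and the constant of the moment bound.\<close>

definition net_const :: real where
  "net_const = 432 * 2 ^ 32"

text \<open>The moment of order 2r is taken although order 2n is asked for: a sum over C^r pairs of
  grid points costs a bounded factor only after an r-th root. The inequality y^n \<le> 1 + y^r for n
  \<le> r leads back to order 2n, and 3 is 1 plus the bound 2 for the normalized moment.\<close>

lemma expectation_full_sign_walk_le:
  assumes r: "0 < r" and w: "w < r" and n: "n \<le> r"
  defines "J \<equiv> (\<lambda>(x, y). {x, y}) ` ({..<r} \<times> {..<r})"
  shows "measure_pmf.expectation (Pi_pmf J d (\<lambda>_. sparse_sign_pmf 1))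
      (\<lambda>s. (mat_app {..<r} (\<lambda>x y. edge_fun J id s {x, y}) ^^ (2 * n)) (unit_fun w) w) \<le>
    3 * (net_const * real r) ^ n"
proof -
  let ?p = "Pi_pmf J d (\<lambda>_. sparse_sign_pmf 1)"
  let ?Y = "\<lambda>s x y. edge_fun J id s {x, y}"
  let ?G = "grid r \<times> grid r"
  let ?B = "\<lambda>s (k, l). bilin {..<r} (?Y s) (grid_point r k) (grid_point r l)"
  let ?c = "net_const * real r"
  define M where "M s = Max (?B s ` ?G)" for s
  have fin: "finite (set_pmf ?p)" by (intro finite_set_Pi_pmf) (auto simp: J_def)
  note int = integrable_measure_pmf_finite[OF fin, where 'b = real]
  have c: "0 < ?c" using r by (simp add: net_const_def)
  have point: "(\<Sum>x<r. (grid_point r k x)\<^sup>2) \<le> 1" if "k \<in> grid r" for k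
  proof -
    have "(\<Sum>x<r. (grid_point r k x)\<^sup>2) = real_of_int (\<Sum>x<r. (k x)\<^sup>2) / (16 * real r)"
      using r by (simp add: grid_point_def power_divide power_mult_distrib sum_divide_distrib)
    also have "\<dots> \<le> (16 * real r) / (16 * real r)"
    proof (intro divide_right_mono)
      have "(\<Sum>x<r. (k x)\<^sup>2) \<le> 16 * int r" using that by (simp add: grid_def)
      thus "real_of_int (\<Sum>x<r. (k x)\<^sup>2) \<le> 16 * real r" by linarith
    qed simp
    finally show ?thesis using r by simp
  qed
  have G: "finite ?G" "?G \<noteq> {}"
    using finite_grid grid_approx[OF r, of "\<lambda>_. 0"] by (auto simp: L2_set_def)
  have le_M: "bilin {..<r} (?Y s) (grid_point r k) (grid_point r l) \<le> M s"
    if "k \<in> grid r" "l \<in> grid r" for s k l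
  proof -
    have "?B s (k, l) \<le> M s"
      unfolding M_def using G that by (intro Max_ge finite_imageI imageI) auto
    thus ?thesis by simp
  qed
  have M0: "0 \<le> M s" for s
    using bilin_le_grid[OF r le_M, of "\<lambda>_. 0" "\<lambda>_. 0"] by (simp add: bilin_def L2_set_def)
  have M_pow: "M s ^ (2 * r) \<le> (\<Sum>z\<in>?G. ?B s z ^ (2 * r))" for s
  proof -
    have "M s \<in> ?B s ` ?G" unfolding M_def using G by (intro Max_in) auto
    then obtain z where z: "M s = ?B s z" "z \<in> ?G" by (rule imageE)
    have "?B s z ^ (2 * r) \<le> (\<Sum>z\<in>?G. ?B s z ^ (2 * r))"
      using G z(2) by (intro member_le_sum) (auto simp: power_mult)
    thus ?thesis unfolding z(1) .
  qed
  have "measure_pmf.expectation ?p (\<lambda>s. M s ^ (2 * r)) \<le>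
      measure_pmf.expectation ?p (\<lambda>s. \<Sum>z\<in>?G. ?B s z ^ (2 * r))"
    by (intro expectation_mono_finite fin M_pow)
  also have "\<dots> = (\<Sum>z\<in>?G. measure_pmf.expectation ?p (\<lambda>s. ?B s z ^ (2 * r)))"
    by (intro Bochner_Integration.integral_sum int)
  also have "\<dots> \<le> (\<Sum>z\<in>?G. 2 * (12 * real r) ^ r)"
    using expectation_bilin_moment_le[OF finite_lessThan r point point, where d = d] unfolding J_def
    by (intro sum_mono) auto
  also have "\<dots> = real (card (grid r)) * real (card (grid r)) * (2 * (12 * real r) ^ r)"
    by (simp add: card_cartesian_product)
  also have "\<dots> \<le> (3 * 2 ^ 16) ^ r * (3 * 2 ^ 16) ^ r * (2 * (12 * real r) ^ r)"
    by (intro mult_right_mono mult_mono card_grid_le) auto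
  finally have EM: "measure_pmf.expectation ?p (\<lambda>s. M s ^ (2 * r)) \<le>
      (3 * 2 ^ 16) ^ r * (3 * 2 ^ 16) ^ r * (2 * (12 * real r) ^ r)" .
  have "((2 * M s)\<^sup>2 / ?c) ^ r = (4 ^ r / ?c ^ r) * M s ^ (2 * r)" for s
    by (simp only: power_divide power_mult_distrib power_mult) simp
  hence "measure_pmf.expectation ?p (\<lambda>s. ((2 * M s)\<^sup>2 / ?c) ^ r) =
      (4 ^ r / ?c ^ r) * measure_pmf.expectation ?p (\<lambda>s. M s ^ (2 * r))"
    by (simp only: integral_mult_right_zero)
  also have "\<dots> \<le> (4 ^ r / ?c ^ r) * ((3 * 2 ^ 16) ^ r * (3 * 2 ^ 16) ^ r * (2 * (12 * real r) ^ r))"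
    using c by (intro mult_left_mono EM) auto
  also have "\<dots> = 2 * ((4 * ((3 * 2 ^ 16) * (3 * 2 ^ 16)) * (12 * real r)) ^ r / ?c ^ r)"
    unfolding power_mult_distrib using r by simp
  also have "4 * ((3 * 2 ^ 16) * (3 * 2 ^ 16)) * (12 * real r) = ?c"
    by (simp add: net_const_def)
  also have "?c ^ r / ?c ^ r = 1"
    using zero_less_power[OF c, of r] by (intro divide_self) linarith
  finally have EY: "measure_pmf.expectation ?p (\<lambda>s. ((2 * M s)\<^sup>2 / ?c) ^ r) \<le> 2"
    by (simp only: mult_1_right)
  have rescale: "x ^ n = b ^ n * (x / b) ^ n" if "b \<noteq> 0" for x b :: real
    using that by (simp add: power_divide)
  have pow: "y ^ n \<le> 1 + y ^ r" if "0 \<le> y" for y :: real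
  proof (cases "y \<le> 1")
    case True
    thus ?thesis using that power_le_one[of y n] zero_le_power[of y r] by linarith
  next
    case False
    thus ?thesis using power_increasing[OF n, of y] by linarith
  qed
  have "(mat_app {..<r} (?Y s) ^^ (2 * n)) (unit_fun w) w \<le> ?c ^ n * (1 + ((2 * M s)\<^sup>2 / ?c) ^ r)" for s
  proof -
    have "(mat_app {..<r} (?Y s) ^^ (2 * n)) (unit_fun w) w \<le> (2 * M s) ^ (2 * n)"
      using w M0[of s] L2_set_mat_app_le_grid[OF r le_M] by (intro funpow_mat_app_diag_le) auto
    also have "\<dots> = ((2 * M s)\<^sup>2) ^ n" by (rule power_mult)
    also have "\<dots> = ?c ^ n * ((2 * M s)\<^sup>2 / ?c) ^ n"
      by (rule rescale) (use c in linarith)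
    also have "\<dots> \<le> ?c ^ n * (1 + ((2 * M s)\<^sup>2 / ?c) ^ r)"
      using c by (intro mult_left_mono pow) auto
    finally show ?thesis .
  qed
  hence "measure_pmf.expectation ?p (\<lambda>s. (mat_app {..<r} (?Y s) ^^ (2 * n)) (unit_fun w) w) \<le>
      measure_pmf.expectation ?p (\<lambda>s. ?c ^ n * (1 + ((2 * M s)\<^sup>2 / ?c) ^ r))"
    by (intro expectation_mono_finite fin)
  also have "\<dots> = ?c ^ n * (1 + measure_pmf.expectation ?p (\<lambda>s. ((2 * M s)\<^sup>2 / ?c) ^ r))"
    by (simp add: int measure_pmf.prob_space del: power_divide)
  also have "\<dots> \<le> ?c ^ n * (1 + 2)"
    using c EY by (intro mult_left_mono add_left_mono) auto
  finally show ?thesis by simp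
qed

text \<open>The summand 2 n in the matrix size serves twice: it leaves unvisited labels for walks of
  length 2 n, and it gives n \<le> r, as the net argument demands.\<close>

lemma expectation_trace_le:
  fixes \<epsilon> :: "'i \<Rightarrow> 'v set"
  assumes I: "finite I" "inj_on \<epsilon> I" and q: "0 < q" "q \<le> 1" and V: "finite V"
    and r: "real (card V) * q + 2 * real n + 1 \<le> real r"
  shows "measure_pmf.expectation (Pi_pmf I d (\<lambda>_. sparse_sign_pmf q))
      (\<lambda>s. \<Sum>x\<in>V. (mat_app V (\<lambda>x y. edge_fun I \<epsilon> s {x, y}) ^^ (2 * n)) (unit_fun x) x) \<le>
    3 * real (card V) * (net_const * real r) ^ n"
proof -
  have "0 \<le> real (card V) * q" using q by simp
  hence r': "0 < r" "n \<le> r" using r by linarith+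
  have "measure_pmf.expectation (Pi_pmf I d (\<lambda>_. sparse_sign_pmf q))
      (\<lambda>s. \<Sum>x\<in>V. (mat_app V (\<lambda>x y. edge_fun I \<epsilon> s {x, y}) ^^ (2 * n)) (unit_fun x) x) \<le>
    real (card V) * measure_pmf.expectation (Pi_pmf ((\<lambda>(x, y). {x, y}) ` ({..<r} \<times> {..<r})) 0 (\<lambda>_. sparse_sign_pmf 1))
      (\<lambda>s. (mat_app {..<r} (\<lambda>x y. edge_fun ((\<lambda>(x, y). {x, y}) ` ({..<r} \<times> {..<r})) id s {x, y}) ^^ (2 * n)) (unit_fun 0) 0)"
    using r r' by (intro expectation_trace_comparison I q V) auto
  also have "\<dots> \<le> real (card V) * (3 * (net_const * real r) ^ n)"
    using r' by (intro mult_left_mono expectation_full_sign_walk_le) auto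
  finally show ?thesis by (simp add: mult_ac)
qed

section \<open>The likelihood of a single entry\<close>

context
  fixes f :: "real \<Rightarrow> real" and \<alpha> :: real
  assumes f_diff: "\<And>x. f differentiable (at x)" and wd: "steep_flat_well_defined f \<alpha>"
begin

lemma f_bounds:
  assumes "x \<in> {- \<alpha>..\<alpha>}"
  shows "0 < f x" "f x < 1" "deriv f x \<noteq> 0"
  using wd assms by (auto simp: steep_flat_well_defined_def)

lemma f_has_deriv: "(f has_real_derivative deriv f x) (at x)"
  using f_diff by (simp add: DERIV_deriv_iff_real_differentiable)

lemma deriv_le_steepness:
  assumes "x \<in> {- \<alpha>..\<alpha>}"
  shows "\<bar>deriv f x\<bar> / (f x * (1 - f x)) \<le> steepness f \<alpha>"
  unfolding steepness_def using wd assms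
  by (intro cSUP_upper) (auto simp: steep_flat_well_defined_def)

lemma variance_le_flatness:
  assumes "x \<in> {- \<alpha>..\<alpha>}"
  shows "f x * (1 - f x) / (deriv f x)\<^sup>2 \<le> flatness f \<alpha>"
  unfolding flatness_def using wd assms
  by (intro cSUP_upper) (auto simp: steep_flat_well_defined_def)

lemma steepness_flatness_pos:
  assumes "0 < \<alpha>"
  shows "0 < steepness f \<alpha>" "0 < flatness f \<alpha>"
proof -
  have 0: "(0 :: real) \<in> {- \<alpha>..\<alpha>}" using assms by simp
  have "0 < \<bar>deriv f 0\<bar> / (f 0 * (1 - f 0))" "0 < f 0 * (1 - f 0) / (deriv f 0)\<^sup>2"
    using f_bounds[OF 0] by auto
  thus "0 < steepness f \<alpha>" "0 < flatness f \<alpha>"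
    using deriv_le_steepness[OF 0] variance_le_flatness[OF 0] by linarith+
qed

text \<open>As f and 1 - f are below 1, dividing |f'| by one of them gives no more than dividing by
  their product. So the steepness bounds both logarithmic derivatives, and the mean value inequality
  applies.\<close>

lemma ln_f_lipschitz:
  assumes "x \<in> {- \<alpha>..\<alpha>}" "y \<in> {- \<alpha>..\<alpha>}"
  shows "\<bar>ln (f x) - ln (f y)\<bar> \<le> steepness f \<alpha> * \<bar>x - y\<bar>"
    and "\<bar>ln (1 - f x) - ln (1 - f y)\<bar> \<le> steepness f \<alpha> * \<bar>x - y\<bar>"
proof -
  have 1: "((\<lambda>x. ln (f x)) has_real_derivative deriv f z / f z) (at z within {- \<alpha>..\<alpha>})"
    and 2: "((\<lambda>x. ln (1 - f x)) has_real_derivative - deriv f z / (1 - f z)) (at z within {- \<alpha>..\<alpha>})"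
    if "z \<in> {- \<alpha>..\<alpha>}" for z
    using f_bounds[OF that] has_field_derivative_at_within[OF f_has_deriv[of z], of "{- \<alpha>..\<alpha>}"]
    by (auto intro!: derivative_eq_intros simp: field_simps)
  have b1: "norm (deriv f z / f z) \<le> steepness f \<alpha>"
    and b2: "norm (- deriv f z / (1 - f z)) \<le> steepness f \<alpha>" if "z \<in> {- \<alpha>..\<alpha>}" for z
  proof -
    note fz = f_bounds[OF that]
    have "\<bar>deriv f z\<bar> / f z \<le> \<bar>deriv f z\<bar> / (f z * (1 - f z))"
      using fz by (intro divide_left_mono) (auto simp: mult_le_cancel_left1)
    thus "norm (deriv f z / f z) \<le> steepness f \<alpha>"
      using fz deriv_le_steepness[OF that] by simp
    have "\<bar>deriv f z\<bar> / (1 - f z) \<le> \<bar>deriv f z\<bar> / (f z * (1 - f z))"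
      using fz by (intro divide_left_mono) (auto simp: mult_le_cancel_right1)
    thus "norm (- deriv f z / (1 - f z)) \<le> steepness f \<alpha>"
      using fz deriv_le_steepness[OF that] by simp
  qed
  show "\<bar>ln (f x) - ln (f y)\<bar> \<le> steepness f \<alpha> * \<bar>x - y\<bar>"
    using field_differentiable_bound[OF convex_real_interval(5) 1 b1] assms by simp
  show "\<bar>ln (1 - f x) - ln (1 - f y)\<bar> \<le> steepness f \<alpha> * \<bar>x - y\<bar>"
    using field_differentiable_bound[OF convex_real_interval(5) 2 b2] assms by simp
qed

text \<open>Made for u = \<Delta> / 2 with \<Delta> \<le> pi / 2: it gives 2 - 2 cos \<Delta> = 4
  sin^2 (\<Delta> / 2) \<ge> \<Delta>^2 / 2.\<close>

lemma sin_ge_quarter: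
  assumes "0 \<le> u" "u \<le> pi / 4"
  shows "u * (sqrt 2 / 2) \<le> sin u"
proof (cases "u = 0")
  case False
  hence "0 < u" using assms by simp
  then obtain z where z: "0 < z" "z < u" "sin u - sin 0 = (u - 0) * cos z"
    using MVT2[of 0 u sin cos] by (auto intro: DERIV_sin)
  have "cos (pi / 4) \<le> cos z" using z assms by (intro cos_monotone_0_pi_le) auto
  thus ?thesis using z assms by (simp add: cos_45 mult_left_mono)
qed simp

text \<open>The Kullback--Leibler divergence dominates the squared Hellinger distance, which is
  \<open>2 - 2 cos \<Delta>\<close> for the difference \<open>\<Delta>\<close> of the angles \<open>arcsin (sqrt (f x))\<close>; the derivative of the
  angle is \<open>f' / (2 sqrt (f (1 - f)))\<close>.\<close>

lemma KL_ge_square: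
  assumes x: "x \<in> {- \<alpha>..\<alpha>}" and y: "y \<in> {- \<alpha>..\<alpha>}" and \<alpha>: "0 < \<alpha>"
  shows "(x - y)\<^sup>2 / (8 * flatness f \<alpha>) \<le>
    f x * (ln (f x) - ln (f y)) + (1 - f x) * (ln (1 - f x) - ln (1 - f y))"
proof -
  define \<theta> where "\<theta> = (\<lambda>z. arcsin (sqrt (f z)))"
  define \<theta>' where "\<theta>' = (\<lambda>z. deriv f z / (2 * sqrt (f z) * sqrt (1 - f z)))"
  let ?\<beta> = "flatness f \<alpha>"
  have \<beta>: "0 < ?\<beta>" using steepness_flatness_pos[OF \<alpha>] by simp
  have deriv: "(\<theta> has_real_derivative \<theta>' z) (at z)" if "z \<in> {- \<alpha>..\<alpha>}" for z
  proof -
    note fz = f_bounds[OF that]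
    have "- 1 < sqrt (f z)" "sqrt (f z) < 1"
      using fz real_sqrt_gt_zero[of "f z"] by (linarith, simp)
    thus ?thesis using fz unfolding \<theta>_def \<theta>'_def
      by (auto intro!: derivative_eq_intros f_has_deriv simp: field_simps)
  qed
  have \<theta>'_ge: "1 / (4 * ?\<beta>) \<le> (\<theta>' z)\<^sup>2" if "z \<in> {- \<alpha>..\<alpha>}" for z
  proof -
    note fz = f_bounds[OF that]
    have sq: "(\<theta>' z)\<^sup>2 = (deriv f z)\<^sup>2 / (4 * (f z * (1 - f z)))"
      using fz by (simp add: \<theta>'_def power_divide power_mult_distrib)
    have "f z * (1 - f z) \<le> ?\<beta> * (deriv f z)\<^sup>2"
      using variance_le_flatness[OF that] fz by (simp add: divide_le_eq)
    thus ?thesis unfolding sq using fz \<beta> by (simp add: field_simps)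
  qed
  have angle: "(x - y)\<^sup>2 / (4 * ?\<beta>) \<le> (\<theta> x - \<theta> y)\<^sup>2"
  proof -
    have main: "(v - u)\<^sup>2 / (4 * ?\<beta>) \<le> (\<theta> v - \<theta> u)\<^sup>2" if "u < v" "u \<in> {- \<alpha>..\<alpha>}" "v \<in> {- \<alpha>..\<alpha>}" for u v
    proof -
      note uv = that
      have "(\<theta> has_real_derivative \<theta>' z) (at z)" if "u \<le> z" "z \<le> v" for z
        using that \<open>u \<in> _\<close> \<open>v \<in> _\<close> by (intro deriv) auto
      then obtain z where z: "u < z" "z < v" "\<theta> v - \<theta> u = (v - u) * \<theta>' z"
        using MVT2[OF uv(1), of \<theta> \<theta>'] by auto
      have "(v - u)\<^sup>2 * (1 / (4 * ?\<beta>)) \<le> (v - u)\<^sup>2 * (\<theta>' z)\<^sup>2"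
        using z uv by (intro mult_left_mono \<theta>'_ge) auto
      thus ?thesis by (simp add: z(3) power_mult_distrib)
    qed
    show ?thesis
      using main[of x y] main[of y x] x y by (cases x y rule: linorder_cases) (auto simp: power2_commute)
  qed
  note fx = f_bounds[OF x] and fy = f_bounds[OF y]
  have \<theta>_range: "0 \<le> \<theta> z" "\<theta> z \<le> pi / 2" if "z \<in> {- \<alpha>..\<alpha>}" for z
  proof -
    have "0 \<le> sqrt (f z)" "sqrt (f z) \<le> 1" using f_bounds[OF that] by auto
    moreover from this have "- 1 \<le> sqrt (f z)" by linarith
    ultimately show "0 \<le> \<theta> z" "\<theta> z \<le> pi / 2"
      unfolding \<theta>_def by (simp_all only: arcsin_ubound arcsin_nonneg atLeastAtMost_iff)
  qed
  define \<Delta> where "\<Delta> = \<bar>\<theta> x - \<theta> y\<bar>"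
  have \<Delta>: "0 \<le> \<Delta>" "\<Delta> \<le> pi / 2"
    unfolding \<Delta>_def using \<theta>_range[OF x] \<theta>_range[OF y] by linarith+
  have "cos \<Delta> = cos (\<theta> x - \<theta> y)" by (simp add: \<Delta>_def)
  also have "\<dots> = sqrt (1 - f x) * sqrt (1 - f y) + sqrt (f x) * sqrt (f y)"
    using fx fy by (simp add: cos_diff \<theta>_def cos_arcsin order.trans[of _ 0])
  finally have cos: "cos \<Delta> = sqrt (1 - f x) * sqrt (1 - f y) + sqrt (f x) * sqrt (f y)" .
  \<comment> \<open>This is ln z \<le> z - 1 at z = sqrt (q / p). Applied to f x, f y and to their
    complements, it sums to 2 - 2 cos \<Delta>.\<close>
  have hell: "2 * p - 2 * (sqrt p * sqrt q) \<le> p * (ln p - ln q)" if "0 < p" "0 < q" for p q :: real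
  proof -
    have "ln q - ln p = 2 * ln (sqrt q / sqrt p)"
      using that by (simp add: ln_div ln_sqrt)
    also have "\<dots> \<le> 2 * (sqrt q / sqrt p - 1)"
      using that by (intro mult_left_mono ln_le_minus_one) auto
    finally have "p * (ln q - ln p) \<le> p * (2 * (sqrt q / sqrt p - 1))"
      using that by (intro mult_left_mono) auto
    also have "\<dots> = 2 * (p / sqrt p * sqrt q) - 2 * p" by (simp add: algebra_simps)
    also have "p / sqrt p = sqrt p" using that by (simp add: real_div_sqrt)
    finally show ?thesis by (simp add: algebra_simps)
  qed
  have "(\<Delta> / 2 * (sqrt 2 / 2))\<^sup>2 \<le> (sin (\<Delta> / 2))\<^sup>2"
    using \<Delta> by (intro power_mono sin_ge_quarter) auto
  hence "\<Delta>\<^sup>2 / 2 \<le> 2 - 2 * cos \<Delta>"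
    using cos_double_sin[of "\<Delta> / 2"] by (simp add: power_mult_distrib power_divide)
  also have "\<dots> = (2 * f x - 2 * (sqrt (f x) * sqrt (f y))) +
      (2 * (1 - f x) - 2 * (sqrt (1 - f x) * sqrt (1 - f y)))"
    by (simp add: cos algebra_simps)
  also have "\<dots> \<le> f x * (ln (f x) - ln (f y)) + (1 - f x) * (ln (1 - f x) - ln (1 - f y))"
    using fx fy by (intro add_mono hell) auto
  finally have "\<Delta>\<^sup>2 / 2 \<le> f x * (ln (f x) - ln (f y)) + (1 - f x) * (ln (1 - f x) - ln (1 - f y))" .
  moreover have "(x - y)\<^sup>2 / (8 * ?\<beta>) \<le> \<Delta>\<^sup>2 / 2"
    using angle by (simp add: \<Delta>_def)
  ultimately show ?thesis by linarith
qed

end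

section \<open>The comparison for one entry and the symmetric dilation\<close>

text \<open>The two possible observations y lead to different losses A and B, but contraction bounds
  both by the same function of t. Hence y drops out, and the inclusion together with the
  symmetrizing sign forms a sparse sign; an entry that is not sampled corresponds to its value
  0.\<close>

lemma coordinate_step:
  fixes t A B :: "'x \<Rightarrow> real" and p q L :: real
  assumes T: "finite T" "T \<noteq> {}" and \<Phi>: "convex_on UNIV \<Phi>" "mono \<Phi>"
    and q: "0 \<le> q" "q \<le> 1" and L: "0 \<le> L"
    and lip: "\<And>x y. x \<in> T \<Longrightarrow> y \<in> T \<Longrightarrow> \<bar>A x - A y\<bar> \<le> L * \<bar>t x - t y\<bar>"
      "\<And>x y. x \<in> T \<Longrightarrow> y \<in> T \<Longrightarrow> \<bar>B x - B y\<bar> \<le> L * \<bar>t x - t y\<bar>"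
    and bnd: "\<And>x. x \<in> T \<Longrightarrow> \<bar>A x\<bar> \<le> L * \<bar>t x\<bar>" "\<And>x. x \<in> T \<Longrightarrow> \<bar>B x\<bar> \<le> L * \<bar>t x\<bar>"
  defines "\<nu> \<equiv> pair_pmf (bernoulli_pmf q) (map_pmf (\<lambda>b. if b then 1 else - 1 :: int) (bernoulli_pmf p))"
  defines "g \<equiv> \<lambda>(b, y) x. of_bool b * (of_bool (y = 1) * A x + of_bool (y = - 1) * B x)"
  shows "measure_pmf.expectation \<nu>
      (\<lambda>w. \<Phi> (MAX x\<in>T. a x + (g w x - measure_pmf.expectation \<nu> (\<lambda>w. g w x)))) \<le>
    measure_pmf.expectation (sparse_sign_pmf q) (\<lambda>s. \<Phi> (MAX x\<in>T. a x + s * (2 * L * t x)))"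
proof -
  have \<nu>: "finite (set_pmf \<nu>)" by (simp add: \<nu>_def)
  define h where "h = (\<lambda>b. if b
    then (\<Phi> (MAX x\<in>T. a x + 2 * L * t x) + \<Phi> (MAX x\<in>T. a x - 2 * L * t x)) / 2
    else \<Phi> (MAX x\<in>T. a x))"
  have le: "(\<Phi> (MAX x\<in>T. a x + 2 * g w x) + \<Phi> (MAX x\<in>T. a x - 2 * g w x)) / 2 \<le> h (fst w)"
    if "w \<in> set_pmf \<nu>" for w
  proof -
    obtain b y where w: "w = (b, y)" by (cases w)
    have "y \<in> range (\<lambda>b. if b then 1 else - 1)"
      using that unfolding \<nu>_def w set_pair_pmf set_map_pmf by blast
    hence y: "y = 1 \<or> y = - 1" by (auto split: if_splits)
    have contr: "\<Phi> (MAX x\<in>T. a x + 2 * C x) + \<Phi> (MAX x\<in>T. a x - 2 * C x) \<le>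
        \<Phi> (MAX x\<in>T. a x + 2 * L * t x) + \<Phi> (MAX x\<in>T. a x - 2 * L * t x)"
      if "\<And>x y. x \<in> T \<Longrightarrow> y \<in> T \<Longrightarrow> \<bar>C x - C y\<bar> \<le> L * \<bar>t x - t y\<bar>"
        "\<And>x. x \<in> T \<Longrightarrow> \<bar>C x\<bar> \<le> L * \<bar>t x\<bar>" for C
    proof (rule contraction_step[OF T \<Phi>])
      fix x y assume xy: "x \<in> T" "y \<in> T"
      have "\<bar>2 * C x - 2 * C y\<bar> = 2 * \<bar>C x - C y\<bar>" by (simp only: right_diff_distrib[symmetric] abs_mult abs_numeral)
      also have "\<dots> \<le> 2 * (L * \<bar>t x - t y\<bar>)" using that(1)[OF xy] by simp
      also have "\<dots> = \<bar>2 * L * t x - 2 * L * t y\<bar>"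
        using L by (simp only: right_diff_distrib[symmetric] abs_mult)
      finally show "\<bar>2 * C x - 2 * C y\<bar> \<le> \<bar>2 * L * t x - 2 * L * t y\<bar>" .
    next
      fix x assume "x \<in> T"
      thus "\<bar>2 * C x\<bar> \<le> \<bar>2 * L * t x\<bar>" using that(2)[of x] L by (simp add: abs_mult)
    qed
    show ?thesis
      using contr[OF lip(1) bnd(1)] contr[OF lip(2) bnd(2)] y by (auto simp: g_def w h_def)
  qed
  have "measure_pmf.expectation \<nu>
      (\<lambda>w. \<Phi> (MAX x\<in>T. a x + (g w x - measure_pmf.expectation \<nu> (\<lambda>w. g w x)))) \<le>
    measure_pmf.expectation \<nu> (\<lambda>w. h (fst w))"
    by (rule order.trans[OF symmetrization_step[OF \<nu> T \<Phi>] expectation_mono_finite[OF \<nu> le]])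
  also have "\<dots> = measure_pmf.expectation (sparse_sign_pmf q) (\<lambda>s. \<Phi> (MAX x\<in>T. a x + s * (2 * L * t x)))"
    using q unfolding \<nu>_def expectation_pair_pmf_fst
    by (simp add: expectation_sparse_sign_pmf h_def mult.commute)
  finally show ?thesis .
qed

text \<open>Edges of the complete bipartite graph between rows and columns. Weighted by s they form
  the dilation with blocks 0, s, s^T, 0; the zero blocks come from the default of
  \<open>edge_fun\<close>.\<close>

definition bip_edge :: "nat \<times> nat \<Rightarrow> (nat + nat) set" where
  "bip_edge = (\<lambda>(i, j). {Inl i, Inr j})"

definition bip_trace :: "nat \<Rightarrow> nat \<Rightarrow> nat \<Rightarrow> (nat \<times> nat \<Rightarrow> real) \<Rightarrow> real" where
  "bip_trace d1 d2 N s = (\<Sum>x\<in>{..<d1} <+> {..<d2}.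
     (mat_app ({..<d1} <+> {..<d2}) (\<lambda>x y. edge_fun (entries d1 d2) bip_edge s {x, y}) ^^ N) (unit_fun x) x)"

lemma inj_bip_edge: "inj_on bip_edge I"
  by (auto simp: inj_on_def bip_edge_def doubleton_eq_iff)

lemma finite_entries: "finite (entries d1 d2)"
  by (simp add: entries_def)

lemma bip_trace_nonneg: "0 \<le> bip_trace d1 d2 (2 * n) s"
  unfolding bip_trace_def by (intro trace_even_power_nonneg) (auto simp: insert_commute)

text \<open>A vector on the columns is extended by 0 to the rows. The row part of its image under
  the dilation is the rectangular matrix applied to it, so the bound for symmetric matrices
  transfers.\<close>

lemma operator_bound_bip_trace:
  "L2_set (\<lambda>i. \<Sum>j<d2. s (i, j) * v j) {..<d1} \<le>
    root (2 ^ Suc m) (bip_trace d1 d2 (2 ^ Suc m) s) * L2_set v {..<d2}"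
proof -
  let ?V = "{..<d1} <+> {..<d2}" and ?S = "\<lambda>x y. edge_fun (entries d1 d2) bip_edge s {x, y}"
  let ?N = "2 ^ Suc m :: nat" and ?tr = "bip_trace d1 d2 (2 ^ Suc m) s"
  let ?b = "root ?N ?tr"
  define v' :: "nat + nat \<Rightarrow> real" where "v' = case_sum (\<lambda>_. 0) v"
  have tr: "0 \<le> ?tr" using bip_trace_nonneg[of d1 d2 "2 ^ m" s] by simp
  have b: "0 \<le> ?b" "?b ^ ?N = ?tr" using tr by (auto simp del: power_Suc)
  have v': "L2_set v' ?V = L2_set v {..<d2}"
    by (simp add: L2_set_def sum.Plus v'_def)
  have S: "?S (Inl i) (Inr j) = s (i, j)" if "i < d1" "j < d2" for i j
    using edge_fun_apply[OF inj_bip_edge, of "(i, j)" "entries d1 d2" s] that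
    by (simp add: bip_edge_def entries_def)
  have "L2_set (\<lambda>i. \<Sum>j<d2. s (i, j) * v j) {..<d1} = L2_set (\<lambda>i. mat_app ?V ?S v' (Inl i)) {..<d1}"
    by (intro L2_set_cong) (auto simp: mat_app_def sum.Plus v'_def S)
  also have "\<dots> \<le> L2_set (mat_app ?V ?S v') ?V"
    by (simp add: L2_set_def sum.Plus sum_nonneg)
  also have "\<dots> \<le> ?b * L2_set v' ?V"
  proof (rule power_le_imp_le_base)
    have "L2_set (mat_app ?V ?S v') ?V ^ ?N \<le> ?tr * L2_set v' ?V ^ ?N"
      unfolding bip_trace_def by (rule L2_set_mat_app_le_trace) (auto simp: insert_commute)
    also have "\<dots> = (?b * L2_set v' ?V) ^ ?N" unfolding power_mult_distrib b(2) ..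
    finally have "L2_set (mat_app ?V ?S v') ?V ^ ?N \<le> (?b * L2_set v' ?V) ^ ?N" .
    thus "L2_set (mat_app ?V ?S v') ?V ^ Suc (?N - 1) \<le> (?b * L2_set v' ?V) ^ Suc (?N - 1)"
      by (simp del: power_Suc)
  qed (use b in simp)
  finally show ?thesis unfolding v' .
qed

lemma expectation_bip_trace_le:
  assumes q: "0 < q" "q \<le> 1" and r: "real (d1 + d2) * q + 2 * real n + 1 \<le> real r"
  shows "measure_pmf.expectation (Pi_pmf (entries d1 d2) d (\<lambda>_. sparse_sign_pmf q)) (bip_trace d1 d2 (2 * n)) \<le>
    3 * real (d1 + d2) * (net_const * real r) ^ n"
proof -
  have card: "card ({..<d1} <+> {..<d2}) = d1 + d2" by (simp add: card_Plus)
  show ?thesis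
    using expectation_trace_le[OF finite_entries inj_bip_edge q, of "{..<d1} <+> {..<d2}" n r] r
    unfolding bip_trace_def card by simp
qed

section \<open>Concentration of the likelihood ratio\<close>

definition entry_pmf :: "(real \<Rightarrow> real) \<Rightarrow> real \<Rightarrow> real mat \<Rightarrow> nat \<times> nat \<Rightarrow> (bool \<times> int) pmf" where
  "entry_pmf f q M = (\<lambda>p. pair_pmf (bernoulli_pmf q)
     (map_pmf (\<lambda>b. if b then 1 else - 1) (bernoulli_pmf (f (M $$ p)))))"

text \<open>Subtracting the value at \<open>M\<close> makes the loss vanish at X = M. The
  contraction step depends on this: besides the Lipschitz bound it asks for a bound by a multiple of
  |X_p - M_p|.\<close>

definition entry_loss :: "(real \<Rightarrow> real) \<Rightarrow> real mat \<Rightarrow> nat \<times> nat \<Rightarrow> bool \<times> int \<Rightarrow> real mat \<Rightarrow> real" where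
  "entry_loss f M p = (\<lambda>(b, y) X. of_bool b *
     (of_bool (y = 1) * (ln (f (X $$ p)) - ln (f (M $$ p))) +
      of_bool (y = - 1) * (ln (1 - f (X $$ p)) - ln (1 - f (M $$ p)))))"

lemma one_bit_model_altdef:
  "one_bit_model f n M =
     map_pmf (\<lambda>w. ({p \<in> entries (dim_row M) (dim_col M). fst (w p)}, \<lambda>p. snd (w p)))
       (Pi_pmf (entries (dim_row M) (dim_col M)) (False, 0)
         (entry_pmf f (n / (real (dim_row M) * real (dim_col M))) M))"
  unfolding one_bit_model_def sampling_pmf_def sign_pmf_def entry_pmf_def
  by (simp add: map_pair_Pi_pmf[OF finite_entries, symmetric] pair_map_pmf1 pmf.map_comp
      comp_def case_prod_unfold apfst_def map_prod_def)

lemma log_likelihood_diff: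
  assumes I: "finite I"
  shows "log_likelihood f {p \<in> I. fst (w p)} (\<lambda>p. snd (w p)) X -
      log_likelihood f {p \<in> I. fst (w p)} (\<lambda>p. snd (w p)) M =
    (\<Sum>p\<in>I. entry_loss f M p (w p) X)"
proof -
  let ?h = "\<lambda>p. of_bool (snd (w p) = 1) * (ln (f (X $$ p)) - ln (f (M $$ p))) +
      of_bool (snd (w p) = - 1) * (ln (1 - f (X $$ p)) - ln (1 - f (M $$ p)))"
  have "log_likelihood f {p \<in> I. fst (w p)} (\<lambda>p. snd (w p)) X -
      log_likelihood f {p \<in> I. fst (w p)} (\<lambda>p. snd (w p)) M = (\<Sum>p | p \<in> I \<and> fst (w p). ?h p)"
    unfolding log_likelihood_def sum_subtractf[symmetric]
    by (intro sum.cong) (auto simp: algebra_simps)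
  also have "\<dots> = (\<Sum>p\<in>I. if fst (w p) then ?h p else 0)"
    by (rule sum.inter_filter[OF I])
  also have "\<dots> = (\<Sum>p\<in>I. entry_loss f M p (w p) X)"
    by (intro sum.cong refl) (simp add: entry_loss_def case_prod_unfold)
  finally show ?thesis .
qed

lemma expectation_entry_loss:
  assumes "0 \<le> q" "q \<le> 1" "0 \<le> f (M $$ p)" "f (M $$ p) \<le> 1"
  shows "measure_pmf.expectation (entry_pmf f q M p) (\<lambda>w. entry_loss f M p w X) =
    - q * (f (M $$ p) * (ln (f (M $$ p)) - ln (f (X $$ p))) +
      (1 - f (M $$ p)) * (ln (1 - f (M $$ p)) - ln (1 - f (X $$ p))))"
  using assms
  by (simp add: entry_pmf_def entry_loss_def expectation_pair_pmf_finite)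
     (simp add: algebra_simps)

lemma abs_entry_le_max_norm:
  assumes X: "X \<in> carrier_mat d1 d2" "max_norm X \<le> \<alpha>" and p: "p \<in> entries d1 d2"
  shows "X $$ p \<in> {- \<alpha>..\<alpha>}"
proof -
  obtain i j where ij: "p = (i, j)" "i < d1" "j < d2" using p by (auto simp: entries_def)
  have "finite (elements_mat X)" by (simp add: elements_mat_def)
  moreover have "X $$ p \<in> elements_mat X"
    using X ij by (auto simp: elements_mat_def intro!: bexI[of _ i] imageI)
  ultimately have "\<bar>X $$ p\<bar> \<le> max_norm X" unfolding max_norm_def by (intro Max_ge) auto
  thus ?thesis using X(2) by auto
qed

lemma sum_entries: "(\<Sum>p\<in>entries d1 d2. g p) = (\<Sum>i<d1. \<Sum>j<d2. g (i, j))"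
  by (simp add: entries_def sum.cartesian_product)

text \<open>Duality is applied to \<open>X\<close> with s and to \<open>M\<close> with - s, which
  yields 2 R without a triangle inequality for the nuclear norm.\<close>

lemma sign_sum_le_bip_trace:
  assumes X: "X \<in> carrier_mat d1 d2" "nuclear_norm X \<le> R"
    and M: "M \<in> carrier_mat d1 d2" "nuclear_norm M \<le> R"
  shows "(\<Sum>p\<in>entries d1 d2. s p * (X $$ p - M $$ p)) \<le>
    2 * R * root (2 ^ Suc m) (bip_trace d1 d2 (2 ^ Suc m) s)"
proof -
  let ?b = "root (2 ^ Suc m) (bip_trace d1 d2 (2 ^ Suc m) s)"
  have b: "0 \<le> ?b" using bip_trace_nonneg[of d1 d2 "2 ^ m" s] by simp
  have "(\<Sum>i<d1. \<Sum>j<d2. s (i, j) * X $$ (i, j)) \<le> ?b * nuclear_norm X"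
    by (rule inner_le_operator_bound_nuclear_norm[OF X(1) operator_bound_bip_trace])
  also have "\<dots> \<le> ?b * R" using b X(2) by (rule mult_left_mono[rotated])
  finally have 1: "(\<Sum>p\<in>entries d1 d2. s p * X $$ p) \<le> ?b * R" by (simp add: sum_entries)
  have neg: "L2_set (\<lambda>i. \<Sum>j<d2. - s (i, j) * v j) {..<d1} \<le> ?b * L2_set v {..<d2}" for v
    using operator_bound_bip_trace[where s = s and v = v and ?d1.0 = d1 and ?d2.0 = d2 and m = m] by (simp add: sum_negf L2_set_def)
  have "(\<Sum>i<d1. \<Sum>j<d2. - s (i, j) * M $$ (i, j)) \<le> ?b * nuclear_norm M"
    by (rule inner_le_operator_bound_nuclear_norm[OF M(1), where A = "\<lambda>p. - s p"]) (rule neg)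
  also have "\<dots> \<le> ?b * R" using b M(2) by (rule mult_left_mono[rotated])
  finally have 2: "- (\<Sum>p\<in>entries d1 d2. s p * M $$ p) \<le> ?b * R"
    by (simp add: sum_entries sum_negf)
  have "(\<Sum>p\<in>entries d1 d2. s p * (X $$ p - M $$ p)) =
      (\<Sum>p\<in>entries d1 d2. s p * X $$ p) - (\<Sum>p\<in>entries d1 d2. s p * M $$ p)"
    by (simp add: right_diff_distrib sum_subtractf)
  thus ?thesis using 1 2 unfolding mult.commute[of ?b R] mult.assoc by linarith
qed

lemma ex_power2_between:
  assumes "1 \<le> (y :: real)"
  shows "\<exists>j. y \<le> 2 ^ j \<and> 2 ^ j \<le> 2 * y"
proof -
  obtain k where k: "y < 2 ^ k" using real_arch_pow[of 2 y] by auto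
  define j where "j = (LEAST j. y \<le> 2 ^ j)"
  have j: "y \<le> 2 ^ j" unfolding j_def by (rule LeastI) (rule less_imp_le[OF k])
  moreover have "2 ^ j \<le> 2 * y"
  proof (cases j)
    case (Suc i)
    have "\<not> y \<le> 2 ^ i" using not_less_Least[of i "\<lambda>j. y \<le> 2 ^ j"] Suc by (simp add: j_def)
    thus ?thesis using Suc by simp
  qed (use assms in simp)
  ultimately show ?thesis by blast
qed

context
  fixes d1 d2 :: nat and \<alpha> R q :: real and f :: "real \<Rightarrow> real" and M :: "real mat" and T :: "real mat set"
  assumes \<alpha>: "0 < \<alpha>" and q: "0 < q" "q \<le> 1"
    and f01: "\<And>x. 0 \<le> f x" "\<And>x. f x \<le> 1"
    and f_diff: "\<And>x. f differentiable (at x)" and wd: "steep_flat_well_defined f \<alpha>"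
    and T: "finite T" "M \<in> T"
    and T_bounds: "\<And>X. X \<in> T \<Longrightarrow> X \<in> carrier_mat d1 d2" "\<And>X. X \<in> T \<Longrightarrow> nuclear_norm X \<le> R"
      "\<And>X. X \<in> T \<Longrightarrow> max_norm X \<le> \<alpha>"
begin

abbreviation "entry_law \<equiv> Pi_pmf (entries d1 d2) (False, 0) (entry_pmf f q M)"

definition centered_loss :: "(nat \<times> nat \<Rightarrow> bool \<times> int) \<Rightarrow> real mat \<Rightarrow> real" where
  "centered_loss w X = (\<Sum>p\<in>entries d1 d2. entry_loss f M p (w p) X -
     measure_pmf.expectation (entry_pmf f q M p) (\<lambda>w. entry_loss f M p w X))"

lemma finite_entry_pmf: "finite (set_pmf (entry_pmf f q M p))"
  by (simp add: entry_pmf_def)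

text \<open>The factor 4 L R is 2 L from the entrywise comparison times 2 R from duality. The bound
  by the root of the trace is uniform over \<open>T\<close>, so it bounds the maximum, and the N-th
  power removes the root.\<close>

lemma expectation_centered_loss_power_le:
  fixes m :: nat
  defines "N \<equiv> 2 ^ Suc m"
  shows "measure_pmf.expectation entry_law (\<lambda>w. max 0 (MAX X\<in>T. centered_loss w X) ^ N) \<le>
    (4 * steepness f \<alpha> * R) ^ N *
      measure_pmf.expectation (Pi_pmf (entries d1 d2) 0 (\<lambda>_. sparse_sign_pmf q)) (bip_trace d1 d2 N)"
proof -
  let ?L = "steepness f \<alpha>" and ?t = "\<lambda>p X. X $$ p - M $$ p"
  let ?\<Phi> = "\<lambda>x :: real. max 0 x ^ N"
  let ?\<tau> = "Pi_pmf (entries d1 d2) 0 (\<lambda>_. sparse_sign_pmf q)"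
  have L: "0 < ?L" using steepness_flatness_pos[OF f_diff wd \<alpha>] by simp
  have N: "even N" "0 < N" by (auto simp: N_def)
  have T': "T \<noteq> {}" using T by auto
  note \<Phi> = convex_on_pos_part_power[OF N(1)] mono_pos_part_power[of N]
  have fin: "finite (set_pmf ?\<tau>)" by (intro finite_set_Pi_pmf finite_entries) auto
  have range: "X $$ p \<in> {- \<alpha>..\<alpha>}" if "X \<in> T" "p \<in> entries d1 d2" for X p
    using abs_entry_le_max_norm T_bounds that by blast
  note lip = ln_f_lipschitz[OF f_diff wd]
  have step: "measure_pmf.expectation (entry_pmf f q M p)
      (\<lambda>w. ?\<Phi> (MAX X\<in>T. a X + (entry_loss f M p w X -
        measure_pmf.expectation (entry_pmf f q M p) (\<lambda>w. entry_loss f M p w X)))) \<le>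
    measure_pmf.expectation (sparse_sign_pmf q) (\<lambda>s. ?\<Phi> (MAX X\<in>T. a X + s * (2 * ?L * ?t p X)))"
    if p: "p \<in> entries d1 d2" for p a
  proof -
    have lip_t: "\<bar>(ln (f (X $$ p)) - ln (f (M $$ p))) - (ln (f (Y $$ p)) - ln (f (M $$ p)))\<bar> \<le> ?L * \<bar>?t p X - ?t p Y\<bar>"
      "\<bar>(ln (1 - f (X $$ p)) - ln (1 - f (M $$ p))) - (ln (1 - f (Y $$ p)) - ln (1 - f (M $$ p)))\<bar> \<le> ?L * \<bar>?t p X - ?t p Y\<bar>"
      if "X \<in> T" "Y \<in> T" for X Y
      using lip[OF range[OF that(1) p] range[OF that(2) p]] by simp_all
    have bnd_t: "\<bar>ln (f (X $$ p)) - ln (f (M $$ p))\<bar> \<le> ?L * \<bar>?t p X\<bar>"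
      "\<bar>ln (1 - f (X $$ p)) - ln (1 - f (M $$ p))\<bar> \<le> ?L * \<bar>?t p X\<bar>" if "X \<in> T" for X
      using lip[OF range[OF that p] range[OF T(2) p]] by simp_all
    show ?thesis
      unfolding entry_pmf_def entry_loss_def
      by (rule coordinate_step[OF T(1) T' \<Phi>]) (use q L lip_t bnd_t in auto)
  qed
  have "measure_pmf.expectation entry_law (\<lambda>w. ?\<Phi> (MAX X\<in>T. centered_loss w X)) =
      measure_pmf.expectation entry_law (\<lambda>w. ?\<Phi> (MAX X\<in>T. 0 + (\<Sum>p\<in>entries d1 d2. entry_loss f M p (w p) X -
        measure_pmf.expectation (entry_pmf f q M p) (\<lambda>w. entry_loss f M p w X))))"
    by (simp add: centered_loss_def)
  also have "\<dots> \<le> measure_pmf.expectation ?\<tau>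
      (\<lambda>s. ?\<Phi> (MAX X\<in>T. 0 + (\<Sum>p\<in>entries d1 d2. s p * (2 * ?L * ?t p X))))"
    by (rule Pi_pmf_replacement[OF finite_entries finite_entry_pmf, where F = "\<lambda>a. ?\<Phi> (MAX X\<in>T. a X)"
        and h = "\<lambda>p w X. entry_loss f M p w X - measure_pmf.expectation (entry_pmf f q M p) (\<lambda>w. entry_loss f M p w X)"
        and k = "\<lambda>p s X. s * (2 * ?L * ?t p X)"])
       (auto intro: step)
  also have "\<dots> \<le> measure_pmf.expectation ?\<tau> (\<lambda>s. (4 * ?L * R) ^ N * bip_trace d1 d2 N s)"
  proof (rule expectation_mono_finite[OF fin])
    fix s :: "nat \<times> nat \<Rightarrow> real"
    let ?b = "root N (bip_trace d1 d2 N s)"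
    have tr: "0 \<le> bip_trace d1 d2 N s" using bip_trace_nonneg[of d1 d2 "2 ^ m" s] by (simp add: N_def)
    have b: "0 \<le> ?b" "?b ^ N = bip_trace d1 d2 N s" using tr N by auto
    have le: "(\<Sum>p\<in>entries d1 d2. s p * (2 * ?L * ?t p X)) \<le> 4 * ?L * R * ?b" if "X \<in> T" for X
    proof -
      have "(\<Sum>p\<in>entries d1 d2. s p * (2 * ?L * ?t p X)) = 2 * ?L * (\<Sum>p\<in>entries d1 d2. s p * ?t p X)"
        by (simp add: sum_distrib_left mult_ac)
      also have "\<dots> \<le> 2 * ?L * (2 * R * ?b)"
        using L sign_sum_le_bip_trace[of X d1 d2 R M s m] T_bounds that T(2)
        by (intro mult_left_mono) (auto simp: N_def)
      finally show ?thesis by simp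
    qed
    \<comment> \<open>At X = M the sum is 0; this gives the nonnegativity of the bound that the
      positive part requires.\<close>
    have "0 \<le> (\<Sum>p\<in>entries d1 d2. s p * (2 * ?L * ?t p M))" by simp
    hence nonneg: "0 \<le> 4 * ?L * R * ?b" using le[OF T(2)] by linarith
    have "(MAX X\<in>T. 0 + (\<Sum>p\<in>entries d1 d2. s p * (2 * ?L * ?t p X))) \<le> 4 * ?L * R * ?b"
      using T T' le by (intro Max.boundedI) auto
    hence "?\<Phi> (MAX X\<in>T. 0 + (\<Sum>p\<in>entries d1 d2. s p * (2 * ?L * ?t p X))) \<le> (4 * ?L * R * ?b) ^ N"
      using nonneg by (intro power_mono) auto
    also have "\<dots> = (4 * ?L * R) ^ N * bip_trace d1 d2 N s"
      by (simp only: power_mult_distrib b(2))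
    finally show "?\<Phi> (MAX X\<in>T. 0 + (\<Sum>p\<in>entries d1 d2. s p * (2 * ?L * ?t p X))) \<le>
        (4 * ?L * R) ^ N * bip_trace d1 d2 N s" .
  qed
  also have "\<dots> = (4 * ?L * R) ^ N * measure_pmf.expectation ?\<tau> (bip_trace d1 d2 N)"
    by simp
  finally show ?thesis .
qed

text \<open>Markov's inequality for the N-th power at three times the scale 4 L R sqrt (net_const
  r), hence the 12. The moment is at most 3 d times the N-th power of that scale, and 3^N \<ge> e^N
  \<ge> d^2 leaves 3 / d.\<close>

lemma prob_centered_loss_ge:
  fixes m r :: nat
  defines "N \<equiv> 2 ^ Suc m"
  assumes R: "0 < R" and r: "real (d1 + d2) * q + real N + 1 \<le> real r"
    and N: "2 * ln (real (d1 + d2)) \<le> real N" and d: "1 \<le> d1 + d2"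
  shows "measure_pmf.prob entry_law
      {w. 12 * steepness f \<alpha> * R * sqrt (net_const * real r) \<le> (MAX X\<in>T. centered_loss w X)} \<le>
    3 / real (d1 + d2)"
proof -
  let ?L = "steepness f \<alpha>" and ?d = "real (d1 + d2)"
  let ?Z = "\<lambda>w. MAX X\<in>T. centered_loss w X"
  let ?u = "4 * ?L * R" and ?v = "sqrt (net_const * real r)"
  let ?A = "{w. 12 * ?L * R * ?v \<le> ?Z w}"
  have L: "0 < ?L" using steepness_flatness_pos[OF f_diff wd \<alpha>] by simp
  have "0 \<le> ?d * q" using q by simp
  hence r0: "0 < r" using r by linarith
  have u: "0 < ?u" using L R by simp
  have v: "0 < ?v" using r0 by (simp add: net_const_def)
  have fin: "finite (set_pmf entry_law)" by (intro finite_set_Pi_pmf finite_entries finite_entry_pmf)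
  have N2: "N = 2 * 2 ^ m" by (simp add: N_def)
  have r': "?d * q + 2 * real (2 ^ m) + 1 \<le> real r" using r unfolding N2 by simp
  have tr: "measure_pmf.expectation (Pi_pmf (entries d1 d2) 0 (\<lambda>_. sparse_sign_pmf q)) (bip_trace d1 d2 N) \<le>
      3 * ?d * ?v ^ N"
  proof -
    have "?v ^ N = (net_const * real r) ^ (2 ^ m)"
      unfolding N2 power_mult using v by simp
    thus ?thesis using expectation_bip_trace_le[OF q r', of 0] unfolding N2 by simp
  qed
  have "(3 * ?u * ?v) ^ N * measure_pmf.prob entry_law ?A =
      measure_pmf.expectation entry_law (\<lambda>w. (3 * ?u * ?v) ^ N * indicator ?A w)"
    by simp
  also have "\<dots> \<le> measure_pmf.expectation entry_law (\<lambda>w. max 0 (?Z w) ^ N)"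
  proof (rule expectation_mono_finite[OF fin])
    fix w
    show "(3 * ?u * ?v) ^ N * indicator ?A w \<le> max 0 (?Z w) ^ N"
    proof (cases "w \<in> ?A")
      case True
      hence "3 * ?u * ?v \<le> max 0 (?Z w)" by (simp add: mult.assoc)
      hence "(3 * ?u * ?v) ^ N \<le> max 0 (?Z w) ^ N" using u v by (intro power_mono) auto
      thus ?thesis using True by simp
    qed simp
  qed
  also have "\<dots> \<le> ?u ^ N * measure_pmf.expectation (Pi_pmf (entries d1 d2) 0 (\<lambda>_. sparse_sign_pmf q)) (bip_trace d1 d2 N)"
    unfolding N_def by (rule expectation_centered_loss_power_le)
  also have "\<dots> \<le> ?u ^ N * (3 * ?d * ?v ^ N)"
    using u by (intro mult_left_mono tr) auto
  also have "\<dots> = (?u * ?v) ^ N * (3 * ?d)"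
    by (simp only: power_mult_distrib mult_ac)
  also have "(3 * ?u * ?v) ^ N * measure_pmf.prob entry_law ?A =
      (?u * ?v) ^ N * (3 ^ N * measure_pmf.prob entry_law ?A)"
    by (simp only: power_mult_distrib mult_ac)
  finally have main: "3 ^ N * measure_pmf.prob entry_law ?A \<le> 3 * ?d"
    by (rule mult_left_le_imp_le) (use u v in \<open>simp only: zero_less_power mult_pos_pos\<close>)
  have "?d\<^sup>2 = exp (2 * ln ?d)" using d by (simp add: exp_double power2_eq_square)
  also have "\<dots> \<le> exp (real N)" using N by simp
  also have "\<dots> = exp 1 ^ N" by (simp add: exp_of_nat_mult[symmetric])
  also have "\<dots> \<le> 3 ^ N" using exp_le by (intro power_mono) auto
  finally have "?d\<^sup>2 * measure_pmf.prob entry_law ?A \<le> 3 ^ N * measure_pmf.prob entry_law ?A"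
    by (rule mult_right_mono) simp
  hence "?d * (?d * measure_pmf.prob entry_law ?A) \<le> ?d * 3"
    using main by (simp add: power2_eq_square mult_ac)
  hence "?d * measure_pmf.prob entry_law ?A \<le> 3" using d by (simp only: mult_le_cancel_left_pos of_nat_0_less_iff)
  thus ?thesis using d by (simp add: field_simps)
qed

lemma square_error_le_centered_loss:
  assumes X: "X \<in> T"
    and ge: "0 \<le> (\<Sum>p\<in>entries d1 d2. entry_loss f M p (w p) X)"
  shows "q * (\<Sum>p\<in>entries d1 d2. (M $$ p - X $$ p)\<^sup>2) / (8 * flatness f \<alpha>) \<le> (MAX X\<in>T. centered_loss w X)"
proof -
  have range: "Y $$ p \<in> {- \<alpha>..\<alpha>}" if "Y \<in> T" "p \<in> entries d1 d2" for Y p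
    using abs_entry_le_max_norm T_bounds that by blast
  have "q * (\<Sum>p\<in>entries d1 d2. (M $$ p - X $$ p)\<^sup>2) / (8 * flatness f \<alpha>) =
      (\<Sum>p\<in>entries d1 d2. q * ((M $$ p - X $$ p)\<^sup>2 / (8 * flatness f \<alpha>)))"
    by (simp add: sum_distrib_left sum_divide_distrib)
  also have "\<dots> \<le> (\<Sum>p\<in>entries d1 d2. q * (f (M $$ p) * (ln (f (M $$ p)) - ln (f (X $$ p))) +
      (1 - f (M $$ p)) * (ln (1 - f (M $$ p)) - ln (1 - f (X $$ p)))))"
    using q \<alpha> X T(2) range
    by (intro sum_mono mult_left_mono KL_ge_square[OF f_diff wd]) auto
  also have "\<dots> = (\<Sum>p\<in>entries d1 d2. - measure_pmf.expectation (entry_pmf f q M p) (\<lambda>w. entry_loss f M p w X))"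
    using q f01 by (simp add: expectation_entry_loss)
  also have "\<dots> \<le> centered_loss w X"
    using ge by (simp add: centered_loss_def sum_subtractf sum_negf)
  also have "\<dots> \<le> (MAX X\<in>T. centered_loss w X)"
    using T(1) X by (intro Max_ge) auto
  finally show ?thesis .
qed

end

section \<open>The rate, its constants and the error bound\<close>

text \<open>96 is the 12 of the tail bound times the 8 of the divergence bound; the 12 under the
  root comes from absorbing N into the logarithm of d1 d2.\<close>

definition recovery_const :: real where
  "recovery_const = 96 * sqrt (12 * net_const)"

lemma net_const_pos: "0 < net_const"
  by (simp add: net_const_def)

text \<open>Here k is the size of the comparison matrix and l the logarithm. Multiplying k by d1 d2
  undoes the division in q, and d1 d2 \<le> (d1 + d2)^2 brings the logarithmic term into the form of
  the claimed rate.\<close>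

lemma sqrt_rate_le:
  assumes d: "0 < d1" "0 < d2" and r: "0 < r" and n: "0 < n" and l: "0 \<le> l"
    and k: "0 \<le> k" "k \<le> (real d1 + real d2) * (n / (real d1 * real d2)) + 12 * l"
  shows "sqrt (real d1 * real d2 * r) * sqrt (net_const * k) / n \<le>
    sqrt (12 * net_const) * (sqrt (r * (real d1 + real d2) / n) * sqrt (1 + (real d1 + real d2) * l / n))"
proof -
  let ?d = "real d1 + real d2" and ?D = "real d1 * real d2"
  have D: "0 < ?D" using d by simp
  have "?D * k \<le> ?D * (?d * (n / ?D) + 12 * l)" using D k(2) by (intro mult_left_mono) auto
  also have "\<dots> = ?d * n + 12 * ?D * l" using d by (simp add: distrib_left)
  also have "\<dots> \<le> 12 * (?d * n) + 12 * (?d * ?d) * l"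
  proof (intro add_mono mult_right_mono mult_left_mono)
    show "?d * n \<le> 12 * (?d * n)" using d n by simp
    show "?D \<le> ?d * ?d" by (intro mult_mono) auto
  qed (use l in auto)
  finally have Dk: "?D * k \<le> 12 * (?d * n + ?d * ?d * l)" by (simp add: algebra_simps)
  have "sqrt (?D * r) * sqrt (net_const * k) / n = sqrt (?D * r * (net_const * k) / n\<^sup>2)"
    using n by (simp add: real_sqrt_mult real_sqrt_divide)
  also have "?D * r * (net_const * k) / n\<^sup>2 = (net_const * r / n\<^sup>2) * (?D * k)" by simp
  also have "sqrt \<dots> \<le> sqrt ((net_const * r / n\<^sup>2) * (12 * (?d * n + ?d * ?d * l)))"
    using r n net_const_pos by (intro real_sqrt_le_mono mult_left_mono Dk) auto
  also have "(net_const * r / n\<^sup>2) * (12 * (?d * n + ?d * ?d * l)) =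
      12 * net_const * ((r * ?d / n) * (1 + ?d * l / n))"
    using n by (simp add: field_simps power2_eq_square)
  finally show ?thesis by (simp only: real_sqrt_mult)
qed

text \<open>The moment order follows ln (d1 + d2), the claimed rate ln (d1 d2). The comparison rests
  on d1 + d2 \<le> (d1 d2)^2, which holds as soon as one dimension exceeds 1.\<close>

lemma ln_sum_le_ln_prod:
  assumes "0 < d1" "0 < d2" "3 \<le> d1 + (d2 :: nat)"
  shows "ln (real (d1 + d2)) \<le> 2 * ln (real d1 * real d2)"
proof -
  obtain a b where ab: "d1 = Suc a" "d2 = Suc b" using assms(1,2) by (metis gr0_implies_Suc)
  have "1 \<le> a + b" using assms(3) ab by simp
  hence "a + b + 2 \<le> (1 + (a + b)) * (1 + (a + b))" by (cases "a + b") auto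
  also have "\<dots> \<le> (d1 * d2) * (d1 * d2)" unfolding ab by (intro mult_mono) auto
  finally have "d1 + d2 \<le> (d1 * d2)\<^sup>2" by (simp add: ab power2_eq_square)
  hence "real (d1 + d2) \<le> real ((d1 * d2)\<^sup>2)" by (simp only: of_nat_le_iff)
  hence "ln (real (d1 + d2)) \<le> ln ((real d1 * real d2)\<^sup>2)" using assms by simp
  also have "\<dots> = 2 * ln (real d1 * real d2)" using assms by (simp add: ln_realpow)
  finally show ?thesis .
qed

lemma recovery_prob:
  fixes n :: real
  assumes d: "0 < d1" "0 < d2" and \<alpha>: "0 < \<alpha>" and r: "0 < r" and n: "0 < n" "n \<le> real d1 * real d2"
    and f01: "\<And>x. 0 \<le> f x" "\<And>x. f x \<le> 1"
    and f_diff: "\<And>x. f differentiable (at x)" and wd: "steep_flat_well_defined f \<alpha>"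
    and M: "M \<in> carrier_mat d1 d2" "nuclear_norm M \<le> \<alpha> * sqrt (real d1 * real d2 * r)" "max_norm M \<le> \<alpha>"
    and Mhat: "\<And>\<Omega> Y. (\<Omega>, Y) \<in> set_pmf (one_bit_model f n M) \<Longrightarrow>
      is_arg_max (log_likelihood f \<Omega> Y) (\<lambda>X. X \<in> feasible d1 d2 \<alpha> r) (Mhat (\<Omega>, Y))"
  shows "1 - 3 / (real d1 + real d2) \<le> measure_pmf.prob (one_bit_model f n M)
    {\<omega>. 1 / (real d1 * real d2) * (frobenius_norm (Mhat \<omega> - M))\<^sup>2 \<le>
      recovery_const * \<alpha> * steepness f \<alpha> * flatness f \<alpha> *
        sqrt (r * (real d1 + real d2) / n) *
        sqrt (1 + (real d1 + real d2) * ln (real d1 * real d2) / n)}"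
    (is "_ \<le> measure_pmf.prob ?P ?A")
proof (cases "d1 + d2 < 3")
  case True
  \<comment> \<open>For d1 = d2 = 1 the logarithm in the rate is 0 and cannot absorb N, but the
    asserted probability is negative.\<close>
  hence "1 - 3 / (real d1 + real d2) \<le> 0" using d by (simp add: field_simps)
  thus ?thesis using measure_nonneg[of ?P ?A] by linarith
next
  case False
  let ?d = "real (d1 + d2)" and ?D = "real d1 * real d2"
  let ?L = "steepness f \<alpha>" and ?\<beta> = "flatness f \<alpha>" and ?l = "ln (real d1 * real d2)"
  define q where "q = n / ?D"
  define R where "R = \<alpha> * sqrt (?D * r)"
  have D: "0 < ?D" using d by simp
  have q: "0 < q" "q \<le> 1" using n D by (auto simp: q_def)
  have R: "0 < R" using \<alpha> D r by (simp add: R_def)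
  have dim: "dim_row M = d1" "dim_col M = d2" using M(1) by auto
  note L\<beta> = steepness_flatness_pos[OF f_diff wd \<alpha>]
  let ?I = "entries d1 d2"
  let ?Q = "Pi_pmf ?I (False, 0) (entry_pmf f q M)"
  define h where "h = (\<lambda>w :: nat \<times> nat \<Rightarrow> bool \<times> int. ({p \<in> ?I. fst (w p)}, \<lambda>p. snd (w p)))"
  have P: "?P = map_pmf h ?Q" unfolding one_bit_model_altdef dim h_def q_def ..
  have finQ: "finite (set_pmf ?Q)"
    by (intro finite_set_Pi_pmf finite_entries) (simp add: entry_pmf_def)
  define T where "T = insert M (Mhat ` set_pmf ?P)"
  have T: "finite T" "M \<in> T" using finQ by (auto simp: T_def P)
  have comm: "\<alpha> * sqrt (r * real d1 * real d2) = R" by (simp add: R_def mult_ac)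
  have M_feas: "M \<in> feasible d1 d2 \<alpha> r" using M by (simp add: feasible_def comm R_def)
  have Mhat': "is_arg_max (log_likelihood f (fst \<omega>) (snd \<omega>)) (\<lambda>X. X \<in> feasible d1 d2 \<alpha> r) (Mhat \<omega>)"
    if "\<omega> \<in> set_pmf ?P" for \<omega>
    using Mhat[of "fst \<omega>" "snd \<omega>"] that by simp
  have "X \<in> feasible d1 d2 \<alpha> r" if "X \<in> T" for X
    using that M_feas Mhat' by (auto simp: T_def is_arg_max_def)
  hence T_bounds: "X \<in> carrier_mat d1 d2" "nuclear_norm X \<le> R" "max_norm X \<le> \<alpha>" if "X \<in> T" for X
    using that by (auto simp: feasible_def comm)
  have "exp 1 \<le> ?d" using False exp_le by linarith
  hence "1 \<le> ln ?d" using d by (simp add: ln_ge_iff)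
  then obtain m where m: "ln ?d \<le> 2 ^ m" "2 ^ m \<le> 2 * ln ?d" using ex_power2_between by blast
  \<comment> \<open>N lies between 2 ln d and 4 ln d. Markov's inequality uses the lower bound; the
    upper one and 1 \<le> ln d give N + 2 \<le> 6 ln d \<le> 12 ln (d1 d2), the 12 of
    \<open>sqrt_rate_le\<close>.\<close>
  define N :: nat where "N = 2 ^ Suc m"
  define k where "k = nat \<lceil>?d * q + real N + 1\<rceil>"
  have "0 \<le> ?d * q" using q by simp
  hence k: "?d * q + real N + 1 \<le> real k" "real k \<le> ?d * q + real N + 2"
    unfolding k_def by linarith+
  have "ln ?d \<le> 2 * ?l" using d False by (intro ln_sum_le_ln_prod) auto
  hence l: "0 \<le> ?l" "real N + 2 \<le> 12 * ?l"
    using m(2) \<open>1 \<le> ln ?d\<close> by (auto simp: N_def)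
  let ?Z = "\<lambda>w. MAX X\<in>T. centered_loss d1 d2 q f M w X"
  let ?t = "12 * ?L * R * sqrt (net_const * real k)"
  have bad: "measure_pmf.prob ?Q {w. ?t \<le> ?Z w} \<le> 3 / ?d"
    using k(1) m(1) d unfolding N_def
    by (intro prob_centered_loss_ge[OF \<alpha> q f01 f_diff wd T T_bounds R]) auto
  have good: "h w \<in> ?A" if w: "w \<in> set_pmf ?Q" "\<not> ?t \<le> ?Z w" for w
  proof -
    let ?X = "Mhat (h w)"
    have hw: "h w \<in> set_pmf ?P" using w(1) by (simp add: P)
    hence X: "?X \<in> T" by (simp add: T_def)
    have "log_likelihood f (fst (h w)) (snd (h w)) M \<le> log_likelihood f (fst (h w)) (snd (h w)) ?X"
      using Mhat'[OF hw] M_feas by (auto simp: is_arg_max_def not_less)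
    hence "0 \<le> (\<Sum>p\<in>?I. entry_loss f M p (w p) ?X)"
      using log_likelihood_diff[OF finite_entries[of d1 d2], where f = f and w = w and X = ?X and M = M] by (simp add: h_def)
    hence "q * (\<Sum>p\<in>?I. (M $$ p - ?X $$ p)\<^sup>2) / (8 * ?\<beta>) \<le> ?Z w"
      using X by (intro square_error_le_centered_loss[OF \<alpha> q f01 f_diff wd T T_bounds]) auto
    hence "q * (\<Sum>p\<in>?I. (M $$ p - ?X $$ p)\<^sup>2) \<le> ?Z w * (8 * ?\<beta>)"
      using L\<beta> by (simp add: divide_le_eq)
    also have "\<dots> \<le> ?t * (8 * ?\<beta>)"
      using w(2) L\<beta> by (intro mult_right_mono) auto
    finally have "q * (\<Sum>p\<in>?I. (M $$ p - ?X $$ p)\<^sup>2) \<le> ?t * (8 * ?\<beta>)" .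
    moreover have "(\<Sum>p\<in>?I. (M $$ p - ?X $$ p)\<^sup>2) = (frobenius_norm (?X - M))\<^sup>2"
      using M(1) T_bounds(1)[OF X]
      by (auto simp: frobenius_norm_def sum_entries sum_nonneg power2_commute intro!: sum.cong)
    ultimately have "n * (1 / ?D * (frobenius_norm (?X - M))\<^sup>2) \<le> ?t * (8 * ?\<beta>)"
      by (simp add: q_def)
    hence "1 / ?D * (frobenius_norm (?X - M))\<^sup>2 \<le> ?t * (8 * ?\<beta>) / n"
      using n by (simp add: field_simps)
    also have "\<dots> = 96 * \<alpha> * ?L * ?\<beta> * (sqrt (?D * r) * sqrt (net_const * real k) / n)"
      by (simp add: R_def)
    also have "\<dots> \<le> 96 * \<alpha> * ?L * ?\<beta> * (sqrt (12 * net_const) *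
        (sqrt (r * (real d1 + real d2) / n) * sqrt (1 + (real d1 + real d2) * ?l / n)))"
      using \<alpha> L\<beta> k l by (intro mult_left_mono sqrt_rate_le d r n) (auto simp: q_def)
    also have "\<dots> = recovery_const * \<alpha> * ?L * ?\<beta> * sqrt (r * (real d1 + real d2) / n) *
        sqrt (1 + (real d1 + real d2) * ?l / n)"
      by (simp add: recovery_const_def)
    finally show ?thesis by simp
  qed
  have "1 - 3 / ?d \<le> 1 - measure_pmf.prob ?Q {w. ?t \<le> ?Z w}" using bad by simp
  also have "\<dots> = measure_pmf.prob ?Q (- {w. ?t \<le> ?Z w})"
    using measure_pmf.prob_compl[of "{w. ?t \<le> ?Z w}" ?Q] by (simp add: Compl_eq_Diff_UNIV)
  \<comment> \<open>The estimator is known to be a maximizer only on the support, so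
    \<open>good\<close> applies only there.\<close>
  also have "\<dots> = measure_pmf.prob ?Q (- {w. ?t \<le> ?Z w} \<inter> set_pmf ?Q)"
    by (rule measure_Int_set_pmf[symmetric])
  also have "\<dots> \<le> measure_pmf.prob ?Q (h -` ?A)"
    using good by (intro measure_pmf.finite_measure_mono) auto
  also have "\<dots> = measure_pmf.prob ?P ?A" unfolding P by (rule measure_map_pmf[symmetric])
  finally show ?thesis by simp
qed

theorem theorem1:
  shows "\<exists>C1 C2 :: real. C1 > 0 \<and> C2 > 0 \<and>
    (\<forall>(d1 :: nat) (d2 :: nat) (\<alpha> :: real) (r :: real) (n :: real) (f :: real \<Rightarrow> real)
       (M :: real mat) (Mhat :: (nat \<times> nat) set \<times> (nat \<times> nat \<Rightarrow> int) \<Rightarrow> real mat).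
       0 < d1 \<longrightarrow> 0 < d2 \<longrightarrow> 0 < \<alpha> \<longrightarrow> 0 < r \<longrightarrow> 0 < n \<longrightarrow> n \<le> real d1 * real d2 \<longrightarrow>
       (\<forall>x. 0 \<le> f x \<and> f x \<le> 1) \<longrightarrow> (\<forall>x. f differentiable (at x)) \<longrightarrow>
       steep_flat_well_defined f \<alpha> \<longrightarrow>
       M \<in> carrier_mat d1 d2 \<longrightarrow>
       nuclear_norm M \<le> \<alpha> * sqrt (real d1 * real d2 * r) \<longrightarrow> max_norm M \<le> \<alpha> \<longrightarrow>
       (\<forall>(\<Omega>, Y) \<in> set_pmf (one_bit_model f n M).
          is_arg_max (log_likelihood f \<Omega> Y) (\<lambda>X. X \<in> feasible d1 d2 \<alpha> r) (Mhat (\<Omega>, Y))) \<longrightarrow>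
       (let C\<alpha> = C2 * \<alpha> * steepness f \<alpha> * flatness f \<alpha>;
            d = real d1 + real d2;
            error = (\<lambda>\<omega>. 1 / (real d1 * real d2) * (frobenius_norm (Mhat \<omega> - M))\<^sup>2)
        in measure_pmf.prob (one_bit_model f n M)
             {\<omega>. error \<omega> \<le> C\<alpha> * sqrt (r * d / n) * sqrt (1 + d * ln (real d1 * real d2) / n)}
             \<ge> 1 - C1 / d \<and>
           (n \<ge> d * ln (real d1 * real d2) \<longrightarrow>
            measure_pmf.prob (one_bit_model f n M)
              {\<omega>. error \<omega> \<le> sqrt 2 * C\<alpha> * sqrt (r * d / n)}
              \<ge> 1 - C1 / d)))"
proof (rule exI[of _ 3], rule exI[of _ recovery_const], intro conjI allI impI)
  show "0 < recovery_const" by (simp add: recovery_const_def net_const_pos)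
next
  fix d1 d2 :: nat and \<alpha> r n :: real and f :: "real \<Rightarrow> real" and M :: "real mat"
    and Mhat :: "(nat \<times> nat) set \<times> (nat \<times> nat \<Rightarrow> int) \<Rightarrow> real mat"
  assume A: "0 < d1" "0 < d2" "0 < \<alpha>" "0 < r" "0 < n" "n \<le> real d1 * real d2"
    "\<forall>x. 0 \<le> f x \<and> f x \<le> 1" "\<forall>x. f differentiable (at x)" "steep_flat_well_defined f \<alpha>"
    "M \<in> carrier_mat d1 d2" "nuclear_norm M \<le> \<alpha> * sqrt (real d1 * real d2 * r)" "max_norm M \<le> \<alpha>"
    "\<forall>(\<Omega>, Y) \<in> set_pmf (one_bit_model f n M).
       is_arg_max (log_likelihood f \<Omega> Y) (\<lambda>X. X \<in> feasible d1 d2 \<alpha> r) (Mhat (\<Omega>, Y))"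
  let ?C = "recovery_const * \<alpha> * steepness f \<alpha> * flatness f \<alpha>" and ?d = "real d1 + real d2"
  let ?l = "ln (real d1 * real d2)"
  let ?err = "\<lambda>\<omega>. 1 / (real d1 * real d2) * (frobenius_norm (Mhat \<omega> - M))\<^sup>2"
  let ?E = "{\<omega>. ?err \<omega> \<le> ?C * sqrt (r * ?d / n) * sqrt (1 + ?d * ?l / n)}"
  let ?E' = "{\<omega>. ?err \<omega> \<le> sqrt 2 * ?C * sqrt (r * ?d / n)}"
  have prob: "1 - 3 / ?d \<le> measure_pmf.prob (one_bit_model f n M) ?E"
    using A by (intro recovery_prob) auto
  have "1 - 3 / ?d \<le> measure_pmf.prob (one_bit_model f n M) ?E'" if n: "?d * ?l \<le> n"
  proof -
    have C: "0 \<le> ?C"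
      using steepness_flatness_pos[of f \<alpha>] A net_const_pos by (simp add: recovery_const_def)
    have "0 \<le> ?C * sqrt (r * ?d / n)" using A by (intro mult_nonneg_nonneg[OF C]) auto
    moreover have "sqrt (1 + ?d * ?l / n) \<le> sqrt 2" using n A(5) by simp
    ultimately have "?C * sqrt (r * ?d / n) * sqrt (1 + ?d * ?l / n) \<le> ?C * sqrt (r * ?d / n) * sqrt 2"
      by (rule mult_left_mono[rotated])
    hence "?E \<subseteq> ?E'" by (auto simp: mult_ac intro: order.trans)
    hence "measure_pmf.prob (one_bit_model f n M) ?E \<le> measure_pmf.prob (one_bit_model f n M) ?E'"
      by (intro measure_pmf.finite_measure_mono) auto
    thus ?thesis using prob by linarith
  qed
  with prob show "let C\<alpha> = ?C; d = ?d; error = ?err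
    in measure_pmf.prob (one_bit_model f n M)
         {\<omega>. error \<omega> \<le> C\<alpha> * sqrt (r * d / n) * sqrt (1 + d * ln (real d1 * real d2) / n)}
         \<ge> 1 - 3 / d \<and>
       (n \<ge> d * ln (real d1 * real d2) \<longrightarrow>
        measure_pmf.prob (one_bit_model f n M)
          {\<omega>. error \<omega> \<le> sqrt 2 * C\<alpha> * sqrt (r * d / n)}
          \<ge> 1 - 3 / d)"
    unfolding Let_def by blast
qed simp

end
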